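(* Let $\mathcal{E}$ be a connected atomic topos with a given point $p:\mathcal{S}\to\mathcal{E}$. Then $\mathcal{E}$ is a Galois topos if and only if the point $p$ is proessential.
   Context: All topoi are Grothendieck topoi over the category $\mathcal{S}$ of sets; $\gamma:\mathcal{E}\to\mathcal{S}$ is the structure morphism. A connected atomic topos is a connected ($\gamma^*$ full and faithful), locally connected ($\gamma^*$ has a left adjoint) and boolean topos. A Galois object is a non-empty connected object $A$ such that $A\to 1$ is an epimorphism and the canonical morphism $A\times\gamma^*Aut(A)\to A\times A$ is an isomorphism. A Galois topos is a connected locally connected topos generated by its Galois objects. A point $p:\mathcal{S}\to\mathcal{E}$ is proessential if its inverse image preserves cotensors of connected objects: for every connected object $X$ and every set $S$, the canonical map $p^*(\prod_S X)\to\prod_S p^*X=(p^*X)^S$ is a bijection. *)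

theory Defs
  imports Main "HOL-Library.FuncSet"
begin

unbundle cardinal_syntax

record ('o, 'a) cat =
  obj :: "'o set"
  arr :: "'a set"
  src :: "'a \<Rightarrow> 'o"
  tgt :: "'a \<Rightarrow> 'o"
  idt :: "'o \<Rightarrow> 'a"
  cmp :: "'a \<Rightarrow> 'a \<Rightarrow> 'a"  (infixr "\<cdot>\<index>" 70)

definition hom :: "('o, 'a) cat \<Rightarrow> 'o \<Rightarrow> 'o \<Rightarrow> 'a set" where
  "hom C X Y = {f \<in> arr C. src C f = X \<and> tgt C f = Y}"

definition category :: "('o, 'a) cat \<Rightarrow> bool" where
  "category C \<longleftrightarrow>
     (\<forall>f \<in> arr C. src C f \<in> obj C \<and> tgt C f \<in> obj C) \<and>
     (\<forall>X \<in> obj C. idt C X \<in> hom C X X) \<and>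
     (\<forall>X Y Z. \<forall>f \<in> hom C X Y. \<forall>g \<in> hom C Y Z. g \<cdot>\<^bsub>C\<^esub> f \<in> hom C X Z) \<and>
     (\<forall>X Y. \<forall>f \<in> hom C X Y. f \<cdot>\<^bsub>C\<^esub> idt C X = f \<and> idt C Y \<cdot>\<^bsub>C\<^esub> f = f) \<and>
     (\<forall>W X Y Z. \<forall>f \<in> hom C W X. \<forall>g \<in> hom C X Y. \<forall>h \<in> hom C Y Z.
        h \<cdot>\<^bsub>C\<^esub> (g \<cdot>\<^bsub>C\<^esub> f) = (h \<cdot>\<^bsub>C\<^esub> g) \<cdot>\<^bsub>C\<^esub> f)"

definition opposite :: "('o, 'a) cat \<Rightarrow> ('o, 'a) cat" where
  "opposite C = \<lparr>obj = obj C, arr = arr C, src = tgt C, tgt = src C, idt = idt C,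
           cmp = (\<lambda>g f. f \<cdot>\<^bsub>C\<^esub> g)\<rparr>"

record ('o, 'a, 'p, 'b) fctr =
  fobj :: "'o \<Rightarrow> 'p"
  farr :: "'a \<Rightarrow> 'b"

definition is_functor ::
    "('o, 'a) cat \<Rightarrow> ('p, 'b) cat \<Rightarrow> ('o, 'a, 'p, 'b) fctr \<Rightarrow> bool" where
  "is_functor C D F \<longleftrightarrow>
     (\<forall>X \<in> obj C. fobj F X \<in> obj D) \<and>
     (\<forall>X Y. \<forall>f \<in> hom C X Y. farr F f \<in> hom D (fobj F X) (fobj F Y)) \<and>
     (\<forall>X \<in> obj C. farr F (idt C X) = idt D (fobj F X)) \<and>
     (\<forall>X Y Z. \<forall>f \<in> hom C X Y. \<forall>g \<in> hom C Y Z.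
        farr F (g \<cdot>\<^bsub>C\<^esub> f) = farr F g \<cdot>\<^bsub>D\<^esub> farr F f)"

definition id_functor :: "('o, 'a, 'o, 'a) fctr" where
  "id_functor = \<lparr>fobj = (\<lambda>X. X), farr = (\<lambda>f. f)\<rparr>"

definition comp_functor ::
    "('p, 'b, 'q, 'c) fctr \<Rightarrow> ('o, 'a, 'p, 'b) fctr \<Rightarrow> ('o, 'a, 'q, 'c) fctr" where
  "comp_functor G F = \<lparr>fobj = fobj G \<circ> fobj F, farr = farr G \<circ> farr F\<rparr>"

definition iso :: "('o, 'a) cat \<Rightarrow> 'a \<Rightarrow> bool" where
  "iso C f \<longleftrightarrow> f \<in> arr C \<and>
     (\<exists>g \<in> hom C (tgt C f) (src C f).
        g \<cdot>\<^bsub>C\<^esub> f = idt C (src C f) \<and> f \<cdot>\<^bsub>C\<^esub> g = idt C (tgt C f))"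

definition mono_arr :: "('o, 'a) cat \<Rightarrow> 'a \<Rightarrow> bool" where
  "mono_arr C m \<longleftrightarrow> m \<in> arr C \<and>
     (\<forall>W. \<forall>f \<in> hom C W (src C m). \<forall>g \<in> hom C W (src C m). m \<cdot>\<^bsub>C\<^esub> f = m \<cdot>\<^bsub>C\<^esub> g \<longrightarrow> f = g)"

definition epi_arr :: "('o, 'a) cat \<Rightarrow> 'a \<Rightarrow> bool" where
  "epi_arr C e \<longleftrightarrow> e \<in> arr C \<and>
     (\<forall>Z. \<forall>f \<in> hom C (tgt C e) Z. \<forall>g \<in> hom C (tgt C e) Z. f \<cdot>\<^bsub>C\<^esub> e = g \<cdot>\<^bsub>C\<^esub> e \<longrightarrow> f = g)"

definition nat_trans :: "('o, 'a) cat \<Rightarrow> ('p, 'b) cat \<Rightarrow> ('o, 'a, 'p, 'b) fctr \<Rightarrow>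
    ('o, 'a, 'p, 'b) fctr \<Rightarrow> ('o \<Rightarrow> 'b) \<Rightarrow> bool" where
  "nat_trans C D F G \<eta> \<longleftrightarrow>
     (\<forall>X \<in> obj C. \<eta> X \<in> hom D (fobj F X) (fobj G X)) \<and>
     (\<forall>X Y. \<forall>f \<in> hom C X Y. farr G f \<cdot>\<^bsub>D\<^esub> \<eta> X = \<eta> Y \<cdot>\<^bsub>D\<^esub> farr F f)"

definition nat_iso :: "('o, 'a) cat \<Rightarrow> ('p, 'b) cat \<Rightarrow> ('o, 'a, 'p, 'b) fctr \<Rightarrow>
    ('o, 'a, 'p, 'b) fctr \<Rightarrow> ('o \<Rightarrow> 'b) \<Rightarrow> bool" where
  "nat_iso C D F G \<eta> \<longleftrightarrow> nat_trans C D F G \<eta> \<and> (\<forall>X \<in> obj C. iso D (\<eta> X))"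

definition equivalent :: "('o, 'a) cat \<Rightarrow> ('p, 'b) cat \<Rightarrow> bool" where
  "equivalent C D \<longleftrightarrow>
     (\<exists>F G \<eta> \<epsilon>. is_functor C D F \<and> is_functor D C G \<and>
        nat_iso C C id_functor (comp_functor G F) \<eta> \<and>
        nat_iso D D (comp_functor F G) id_functor \<epsilon>)"

definition full_faithful ::
    "('o, 'a) cat \<Rightarrow> ('p, 'b) cat \<Rightarrow> ('o, 'a, 'p, 'b) fctr \<Rightarrow> bool" where
  "full_faithful C D F \<longleftrightarrow>
     (\<forall>X \<in> obj C. \<forall>Y \<in> obj C. bij_betw (farr F) (hom C X Y) (hom D (fobj F X) (fobj F Y)))"

text \<open>\<open>L : C \<rightarrow> D\<close> is left adjoint to \<open>R : D \<rightarrow> C\<close>.\<close>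

definition adjoint :: "('o, 'a) cat \<Rightarrow> ('p, 'b) cat \<Rightarrow>
    ('o, 'a, 'p, 'b) fctr \<Rightarrow> ('p, 'b, 'o, 'a) fctr \<Rightarrow> bool" where
  "adjoint C D L R \<longleftrightarrow>
     (\<exists>\<phi>. (\<forall>X \<in> obj C. \<forall>Y \<in> obj D. bij_betw (\<phi> X Y) (hom D (fobj L X) Y) (hom C X (fobj R Y))) \<and>
          (\<forall>X X' Y Y'. \<forall>f \<in> hom C X' X. \<forall>g \<in> hom D Y Y'. \<forall>h \<in> hom D (fobj L X) Y.
             \<phi> X' Y' (g \<cdot>\<^bsub>D\<^esub> (h \<cdot>\<^bsub>D\<^esub> farr L f)) = farr R g \<cdot>\<^bsub>C\<^esub> (\<phi> X Y h \<cdot>\<^bsub>C\<^esub> f)))"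

definition cone :: "('i, 'k) cat \<Rightarrow> ('o, 'a) cat \<Rightarrow> ('i, 'k, 'o, 'a) fctr \<Rightarrow> 'o \<Rightarrow> ('i \<Rightarrow> 'a) \<Rightarrow> bool"
  where "cone I C D L \<pi> \<longleftrightarrow> L \<in> obj C \<and>
     (\<forall>i \<in> obj I. \<pi> i \<in> hom C L (fobj D i)) \<and>
     (\<forall>i j. \<forall>u \<in> hom I i j. farr D u \<cdot>\<^bsub>C\<^esub> \<pi> i = \<pi> j)"

definition limit_cone ::
    "('i, 'k) cat \<Rightarrow> ('o, 'a) cat \<Rightarrow> ('i, 'k, 'o, 'a) fctr \<Rightarrow> 'o \<Rightarrow> ('i \<Rightarrow> 'a) \<Rightarrow> bool" where
  "limit_cone I C D L \<pi> \<longleftrightarrow> cone I C D L \<pi> \<and>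
     (\<forall>M \<rho>. cone I C D M \<rho> \<longrightarrow> (\<exists>!h. h \<in> hom C M L \<and> (\<forall>i \<in> obj I. \<pi> i \<cdot>\<^bsub>C\<^esub> h = \<rho> i)))"

text \<open>Every finite category is isomorphic to one whose objects and arrows are natural numbers,
  so these diagram shapes suffice.\<close>

definition left_exact ::
    "('o, 'a) cat \<Rightarrow> ('p, 'b) cat \<Rightarrow> ('o, 'a, 'p, 'b) fctr \<Rightarrow> bool" where
  "left_exact C C' F \<longleftrightarrow>
     (\<forall>(I :: (nat, nat) cat) D L \<pi>.
        category I \<and> finite (obj I) \<and> finite (arr I) \<and> is_functor I C D \<and> limit_cone I C D L \<pi>
        \<longrightarrow> limit_cone I C' (comp_functor F D) (fobj F L) (\<lambda>i. farr F (\<pi> i)))"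

definition product_cone :: "('o, 'a) cat \<Rightarrow> 'i set \<Rightarrow> ('i \<Rightarrow> 'o) \<Rightarrow> 'o \<Rightarrow> ('i \<Rightarrow> 'a) \<Rightarrow> bool" where
  "product_cone C S X P \<pi> \<longleftrightarrow> P \<in> obj C \<and> (\<forall>s \<in> S. \<pi> s \<in> hom C P (X s)) \<and>
     (\<forall>M \<rho>. M \<in> obj C \<and> (\<forall>s \<in> S. \<rho> s \<in> hom C M (X s)) \<longrightarrow>
        (\<exists>!h. h \<in> hom C M P \<and> (\<forall>s \<in> S. \<pi> s \<cdot>\<^bsub>C\<^esub> h = \<rho> s)))"

definition binary_product :: "('o, 'a) cat \<Rightarrow> 'o \<Rightarrow> 'o \<Rightarrow> 'o \<Rightarrow> 'a \<Rightarrow> 'a \<Rightarrow> bool" where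
  "binary_product C X Y P p q \<longleftrightarrow> p \<in> hom C P X \<and> q \<in> hom C P Y \<and>
     (\<forall>M. \<forall>f \<in> hom C M X. \<forall>g \<in> hom C M Y.
        \<exists>!h. h \<in> hom C M P \<and> p \<cdot>\<^bsub>C\<^esub> h = f \<and> q \<cdot>\<^bsub>C\<^esub> h = g)"

definition binary_coproduct :: "('o, 'a) cat \<Rightarrow> 'o \<Rightarrow> 'o \<Rightarrow> 'o \<Rightarrow> 'a \<Rightarrow> 'a \<Rightarrow> bool" where
  "binary_coproduct C X Y P i j \<longleftrightarrow> binary_product (opposite C) X Y P i j"

definition terminal :: "('o, 'a) cat \<Rightarrow> 'o \<Rightarrow> bool" where
  "terminal C T \<longleftrightarrow> T \<in> obj C \<and> (\<forall>X \<in> obj C. \<exists>!f. f \<in> hom C X T)"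

definition initial :: "('o, 'a) cat \<Rightarrow> 'o \<Rightarrow> bool" where
  "initial C Z \<longleftrightarrow> Z \<in> obj C \<and> (\<forall>X \<in> obj C. \<exists>!f. f \<in> hom C Z X)"

text \<open>Sets are the small subsets of a type \<open>'u\<close> playing the role of a Grothendieck universe:
  smallness means cardinality below that of \<open>'u\<close>, and the cardinality of \<open>'u\<close> is a regular strong
  limit. Uncountability is not required (so \<open>'u = nat\<close>, with the finite sets as small sets, is
  admitted besides the inaccessible cardinals).\<close>

definition small :: "'u set \<Rightarrow> bool" where
  "small A \<longleftrightarrow> |A| <o |UNIV :: 'u set|"

definition universe :: "'u itself \<Rightarrow> bool" where
  "universe _ \<longleftrightarrow>
     (\<forall>A :: 'u set. small A \<longrightarrow> |Pow A| <o |UNIV :: 'u set| ) \<and>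
     (\<forall>(A :: 'u set) (B :: 'u \<Rightarrow> 'u set). small A \<and> (\<forall>a \<in> A. small (B a)) \<longrightarrow> small (\<Union>a \<in> A. B a))"

text \<open>A map of sets carries its domain and codomain; its graph is extensional on the domain.\<close>

type_synonym 'u setmap = "'u set \<times> ('u \<Rightarrow> 'u) \<times> 'u set"

definition app :: "'u setmap \<Rightarrow> 'u \<Rightarrow> 'u" where
  "app k = fst (snd k)"

definition Sets :: "('u set, 'u setmap) cat" where
  "Sets = \<lparr>obj = {A. small A},
           arr = {(A, f, B) | A f B. small A \<and> small B \<and> f \<in> A \<rightarrow>\<^sub>E B},
           src = fst,
           tgt = (\<lambda>k. snd (snd k)),
           idt = (\<lambda>A. (A, \<lambda>x \<in> A. x, A)),
           cmp = (\<lambda>l k. (fst k, compose (fst k) (app l) (app k), snd (snd l)))\<rparr>"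

definition sieve :: "('o, 'a) cat \<Rightarrow> 'o \<Rightarrow> 'a set \<Rightarrow> bool" where
  "sieve C c S \<longleftrightarrow> S \<subseteq> {f \<in> arr C. tgt C f = c} \<and>
     (\<forall>f \<in> S. \<forall>g \<in> arr C. tgt C g = src C f \<longrightarrow> f \<cdot>\<^bsub>C\<^esub> g \<in> S)"

definition pullback_sieve :: "('o, 'a) cat \<Rightarrow> 'a \<Rightarrow> 'a set \<Rightarrow> 'a set" where
  "pullback_sieve C g S = {h \<in> arr C. tgt C h = src C g \<and> g \<cdot>\<^bsub>C\<^esub> h \<in> S}"

definition grothendieck_topology :: "('o, 'a) cat \<Rightarrow> ('o \<Rightarrow> 'a set set) \<Rightarrow> bool" where
  "grothendieck_topology C J \<longleftrightarrow>
     (\<forall>c \<in> obj C. (\<forall>S \<in> J c. sieve C c S) \<and>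
        {f \<in> arr C. tgt C f = c} \<in> J c \<and>
        (\<forall>S \<in> J c. \<forall>g \<in> arr C. tgt C g = c \<longrightarrow> pullback_sieve C g S \<in> J (src C g)) \<and>
        (\<forall>S \<in> J c. \<forall>R. sieve C c R \<and> (\<forall>f \<in> S. pullback_sieve C f R \<in> J (src C f)) \<longrightarrow> R \<in> J c))"

type_synonym 'u presheaf = "('u, 'u, 'u set, 'u setmap) fctr"

definition matching_family ::
    "('u, 'u) cat \<Rightarrow> 'u presheaf \<Rightarrow> 'u set \<Rightarrow> ('u \<Rightarrow> 'u) \<Rightarrow> bool" where
  "matching_family C P S x \<longleftrightarrow>
     (\<forall>f \<in> S. x f \<in> fobj P (src C f) \<and>
        (\<forall>g \<in> arr C. tgt C g = src C f \<longrightarrow> x (f \<cdot>\<^bsub>C\<^esub> g) = app (farr P g) (x f)))"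

definition sheaf :: "('u, 'u) cat \<Rightarrow> ('u \<Rightarrow> 'u set set) \<Rightarrow> 'u presheaf \<Rightarrow> bool" where
  "sheaf C J P \<longleftrightarrow> is_functor (opposite C) Sets P \<and>
     (\<forall>c \<in> obj C. \<forall>S \<in> J c. \<forall>x. matching_family C P S x \<longrightarrow>
        (\<exists>!y. y \<in> fobj P c \<and> (\<forall>f \<in> S. app (farr P f) y = x f)))"

definition sheaf_cat :: "('u, 'u) cat \<Rightarrow> ('u \<Rightarrow> 'u set set) \<Rightarrow>
    ('u presheaf, 'u presheaf \<times> ('u \<Rightarrow> 'u setmap) \<times> 'u presheaf) cat" where
  "sheaf_cat C J =
     \<lparr>obj = {P. sheaf C J P},
      arr = {(P, \<eta>, Q) | P \<eta> Q. sheaf C J P \<and> sheaf C J Q \<and> nat_trans (opposite C) Sets P Q \<eta> \<and>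
                                \<eta> \<in> extensional (obj C)},
      src = fst,
      tgt = (\<lambda>k. snd (snd k)),
      idt = (\<lambda>P. (P, \<lambda>c \<in> obj C. idt Sets (fobj P c), P)),
      cmp = (\<lambda>l k. (fst k, \<lambda>c \<in> obj C. fst (snd l) c \<cdot>\<^bsub>Sets\<^esub> fst (snd k) c, snd (snd l)))\<rparr>"

definition grothendieck_topos :: "'u itself \<Rightarrow> ('o, 'a) cat \<Rightarrow> bool" where
  "grothendieck_topos _ E \<longleftrightarrow> category E \<and>
     (\<exists>(C :: ('u, 'u) cat) J. category C \<and> small (obj C) \<and> small (arr C) \<and>
        grothendieck_topology C J \<and> equivalent E (sheaf_cat C J))"

record ('o, 'a, 'p, 'b) geom =
  dir_im :: "('o, 'a, 'p, 'b) fctr"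
  inv_im :: "('p, 'b, 'o, 'a) fctr"

text \<open>\<open>f : F \<rightarrow> E\<close>, with direct image \<open>F \<rightarrow> E\<close> and inverse image \<open>E \<rightarrow> F\<close>.\<close>

definition geometric_morphism ::
    "('o, 'a) cat \<Rightarrow> ('p, 'b) cat \<Rightarrow> ('o, 'a, 'p, 'b) geom \<Rightarrow> bool" where
  "geometric_morphism F E f \<longleftrightarrow>
     is_functor F E (dir_im f) \<and> is_functor E F (inv_im f) \<and>
     adjoint E F (inv_im f) (dir_im f) \<and> left_exact E F (inv_im f)"

type_synonym ('o, 'a, 'u) structure_morphism = "('o, 'a, 'u set, 'u setmap) geom"

text \<open>The structure morphism is determined by \<open>E\<close> up to unique isomorphism, so it may be
  any geometric morphism to the category of sets.\<close>

definition topos_over_sets :: "('o, 'a) cat \<Rightarrow> ('o, 'a, 'u) structure_morphism \<Rightarrow> bool" where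
  "topos_over_sets E \<gamma> \<longleftrightarrow> grothendieck_topos TYPE('u) E \<and> geometric_morphism E Sets \<gamma>"

definition point :: "('o, 'a) cat \<Rightarrow> ('u set, 'u setmap, 'o, 'a) geom \<Rightarrow> bool" where
  "point E p \<longleftrightarrow> geometric_morphism Sets E p"

definition connected_topos :: "('o, 'a) cat \<Rightarrow> ('o, 'a, 'u) structure_morphism \<Rightarrow> bool" where
  "connected_topos E \<gamma> \<longleftrightarrow> topos_over_sets E \<gamma> \<and> full_faithful Sets E (inv_im \<gamma>)"

definition locally_connected_topos :: "('o, 'a) cat \<Rightarrow> ('o, 'a, 'u) structure_morphism \<Rightarrow> bool" where
  "locally_connected_topos E \<gamma> \<longleftrightarrow> topos_over_sets E \<gamma> \<and>
     (\<exists>L. is_functor E Sets L \<and> adjoint E Sets L (inv_im \<gamma>))"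

definition subobjects :: "('o, 'a) cat \<Rightarrow> 'o \<Rightarrow> 'a set" where
  "subobjects C X = {m. mono_arr C m \<and> tgt C m = X}"

definition sub_le :: "('o, 'a) cat \<Rightarrow> 'a \<Rightarrow> 'a \<Rightarrow> bool" where
  "sub_le C m n \<longleftrightarrow> (\<exists>h \<in> hom C (src C m) (src C n). m = n \<cdot>\<^bsub>C\<^esub> h)"

text \<open>In a topos the subobjects of \<open>X\<close> form a Heyting algebra, which is boolean iff every element
  has a complement: one whose meet with it is bottom and whose join with it is top.\<close>

definition complements :: "('o, 'a) cat \<Rightarrow> 'o \<Rightarrow> 'a \<Rightarrow> 'a \<Rightarrow> bool" where
  "complements C X m n \<longleftrightarrow>
     (\<forall>k \<in> subobjects C X. sub_le C k m \<and> sub_le C k n \<longrightarrow> (\<forall>l \<in> subobjects C X. sub_le C k l)) \<and>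
     (\<forall>k \<in> subobjects C X. sub_le C m k \<and> sub_le C n k \<longrightarrow> (\<forall>l \<in> subobjects C X. sub_le C l k))"

definition boolean_topos :: "('o, 'a) cat \<Rightarrow> bool" where
  "boolean_topos E \<longleftrightarrow>
     (\<forall>X \<in> obj E. \<forall>m \<in> subobjects E X. \<exists>n \<in> subobjects E X. complements E X m n)"

definition connected_atomic_topos :: "('o, 'a) cat \<Rightarrow> ('o, 'a, 'u) structure_morphism \<Rightarrow> bool" where
  "connected_atomic_topos E \<gamma> \<longleftrightarrow>
     connected_topos E \<gamma> \<and> locally_connected_topos E \<gamma> \<and> boolean_topos E"

text \<open>No nontrivial coproduct decomposition; the initial object counts as connected, and is excluded
  separately where necessary.\<close>

definition connected_object :: "('o, 'a) cat \<Rightarrow> 'o \<Rightarrow> bool" where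
  "connected_object E X \<longleftrightarrow> X \<in> obj E \<and>
     (\<forall>A B i j. binary_coproduct E A B X i j \<longrightarrow> initial E A \<or> initial E B)"

definition Aut :: "('o, 'a) cat \<Rightarrow> 'o \<Rightarrow> 'a set" where
  "Aut E A = {f \<in> hom E A A. iso E f}"

text \<open>For \<open>s \<in> S\<close>, the composite \<open>A \<rightarrow> \<gamma>\<^sup>*{s} \<rightarrow> \<gamma>\<^sup>*S\<close>, where \<open>\<gamma>\<^sup>*{s}\<close> is terminal.\<close>

definition const_at ::
    "('o, 'a) cat \<Rightarrow> ('o, 'a, 'u) structure_morphism \<Rightarrow> 'o \<Rightarrow> 'u set \<Rightarrow> 'u \<Rightarrow> 'a" where
  "const_at E \<gamma> A S s =
     farr (inv_im \<gamma>) ({s}, \<lambda>x \<in> {s}. x, S) \<cdot>\<^bsub>E\<^esub> (THE u. u \<in> hom E A (fobj (inv_im \<gamma>) {s}))"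

text \<open>The hom-sets of \<open>E\<close> are small only up to bijection, so \<open>Aut A\<close> is carried by a small set \<open>S\<close>
  along a bijection \<open>e\<close>. On the component \<open>A \<cong> A \<times> {s}\<close> of \<open>A \<times> \<gamma>\<^sup>*S = \<Coprod>\<^sub>S A\<close>, embedded by a
  section \<open>h\<close> of the first projection, the canonical morphism is \<open>a \<mapsto> (a, e s a)\<close>; this determines it.\<close>

definition canonical_morphism ::
    "('o, 'a) cat \<Rightarrow> ('o, 'a, 'u) structure_morphism \<Rightarrow> 'o \<Rightarrow> 'u set \<Rightarrow> ('u \<Rightarrow> 'a) \<Rightarrow>
     'o \<Rightarrow> 'a \<Rightarrow> 'a \<Rightarrow> 'o \<Rightarrow> 'a \<Rightarrow> 'a \<Rightarrow> 'a \<Rightarrow> bool" where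
  "canonical_morphism E \<gamma> A S e P p\<^sub>1 p\<^sub>2 Q q\<^sub>1 q\<^sub>2 c \<longleftrightarrow>
     c \<in> hom E P Q \<and> q\<^sub>1 \<cdot>\<^bsub>E\<^esub> c = p\<^sub>1 \<and>
     (\<forall>s \<in> S. \<forall>h \<in> hom E A P. p\<^sub>1 \<cdot>\<^bsub>E\<^esub> h = idt E A \<and> p\<^sub>2 \<cdot>\<^bsub>E\<^esub> h = const_at E \<gamma> A S s
        \<longrightarrow> q\<^sub>2 \<cdot>\<^bsub>E\<^esub> (c \<cdot>\<^bsub>E\<^esub> h) = e s)"

definition galois_object :: "('o, 'a) cat \<Rightarrow> ('o, 'a, 'u) structure_morphism \<Rightarrow> 'o \<Rightarrow> bool" where
  "galois_object E \<gamma> A \<longleftrightarrow>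
     connected_object E A \<and> \<not> initial E A \<and>
     (\<forall>T t. terminal E T \<and> t \<in> hom E A T \<longrightarrow> epi_arr E t) \<and>
     (\<exists>S e P p\<^sub>1 p\<^sub>2 Q q\<^sub>1 q\<^sub>2 c.
        small S \<and> bij_betw e S (Aut E A) \<and>
        binary_product E A (fobj (inv_im \<gamma>) S) P p\<^sub>1 p\<^sub>2 \<and> binary_product E A A Q q\<^sub>1 q\<^sub>2 \<and>
        canonical_morphism E \<gamma> A S e P p\<^sub>1 p\<^sub>2 Q q\<^sub>1 q\<^sub>2 c \<and> iso E c)"

definition generated_by :: "('o, 'a) cat \<Rightarrow> 'o set \<Rightarrow> bool" where
  "generated_by E G \<longleftrightarrow>
     (\<forall>X Y. \<forall>f \<in> hom E X Y. \<forall>g \<in> hom E X Y. f \<noteq> g \<longrightarrow>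
        (\<exists>A \<in> G. \<exists>a \<in> hom E A X. f \<cdot>\<^bsub>E\<^esub> a \<noteq> g \<cdot>\<^bsub>E\<^esub> a))"

definition galois_topos :: "('o, 'a) cat \<Rightarrow> ('o, 'a, 'u) structure_morphism \<Rightarrow> bool" where
  "galois_topos E \<gamma> \<longleftrightarrow> connected_topos E \<gamma> \<and> locally_connected_topos E \<gamma> \<and>
     generated_by E {A. galois_object E \<gamma> A}"

definition proessential :: "('o, 'a) cat \<Rightarrow> ('u set, 'u setmap, 'o, 'a) geom \<Rightarrow> bool" where
  "proessential E p \<longleftrightarrow>
     (\<forall>X (S :: 'u set) P \<pi>. connected_object E X \<and> small S \<and> product_cone E S (\<lambda>_. X) P \<pi> \<longrightarrow>
        bij_betw (\<lambda>t. \<lambda>s \<in> S. app (farr (inv_im p) (\<pi> s)) t)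
          (fobj (inv_im p) P) (S \<rightarrow>\<^sub>E fobj (inv_im p) X))"

end

theory Submission
  imports Defs
begin

text \<open>
  Write \<open>fib X = p\<^sup>*X\<close>. Since \<open>\<gamma>\<^sup>*\<close> is fully faithful, every noninitial \<open>X\<close> has nonempty fibre, and as
  every subobject is complemented, \<open>p\<^sup>*\<close> is faithful and reflects isomorphisms; so maps can be compared
  and inverted on elements of fibres. Local connectedness places every \<open>x \<in> fib X\<close> in an atom of \<open>X\<close>,
  and a map out of an atom is determined by its value at one element. An atom \<open>A\<close> is a Galois object
  iff \<open>Aut A\<close> acts transitively on \<open>fib A\<close>.

  If the topos is Galois, then for connected \<open>X\<close> some Galois \<open>A\<close> and \<open>t \<in> fib A\<close> induce a bijection
  from the maps \<open>A \<rightarrow> X\<close> to \<open>fib X\<close>; a family in \<open>fib X\<close> therefore comes from a map from \<open>A\<close> to the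
  power of \<open>X\<close>, and covering a pair of elements of that power by one Galois object gives injectivity.
  Conversely, if \<open>p\<close> is proessential and \<open>X\<close> is an atom, the power of \<open>X\<close> indexed by \<open>fib X\<close> has an
  element corresponding to the identity family, and the atom containing it is a Galois object
  from which every element of \<open>fib X\<close> is reached.
\<close>

section \<open>Small sets and categories\<close>

text \<open>\<open>E\<close> is given only as a category equivalent to sheaves on some site, and
  \<open>boolean_topos\<close> speaks only of the order on subobjects. The arguments on fibres need
  products, equalizers, a strict initial object and, above all, a coproduct decomposition
  \<open>X = M + N\<close> for every mono \<open>M \<rightarrow> X\<close>; these are proved on
  sections over a site, which is then forgotten. What \<open>p\<close> itself provides is that its
  inverse image preserves finite limits and, as a left adjoint, jointly epimorphic families. It need
  not preserve infinite products, and this is the obstacle to building Galois objects: the fibre of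
  an atom \<open>X\<close> may be infinite, and a Galois object over \<open>X\<close> has to carry
  all its elements as maps to \<open>X\<close> at once. The power of \<open>X\<close> indexed by its
  own fibre is the universal place for such a list of maps, and proessentiality says that the list
  exists as an element of the fibre of that power. Two-element sets recur because maps to the
  constant object on one of them separate a subobject from its complement.\<close>

lemma small_iff_no_inj: "small (A :: 'u set) \<longleftrightarrow> \<not> (\<exists>f. inj (f :: 'u \<Rightarrow> 'u) \<and> range f \<subseteq> A)"
  unfolding small_def card_of_ordLeq
  by (metis card_of_Well_order not_ordLess_iff_ordLeq)

lemma small_subset: "small B \<Longrightarrow> A \<subseteq> B \<Longrightarrow> small A"
  unfolding small_iff_no_inj by blast

lemma small_image: "small (A :: 'u set) \<Longrightarrow> small (f ` A :: 'u set)"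
  unfolding small_def using card_of_image ordLeq_ordLess_trans by blast

text \<open>A finite universe with n elements would have a small subset with n - 1 elements, whose
  power set has 2^(n-1) >= n elements, against the strong limit condition.\<close>

lemma universe_infinite:
  assumes "universe TYPE('u)"
  shows "infinite (UNIV :: 'u set)"
proof
  assume fin: "finite (UNIV :: 'u set)"
  define A where "A = UNIV - {undefined :: 'u}"
  have "small A"
    unfolding small_iff_no_inj
    by (metis A_def Diff_iff UNIV_I fin finite_UNIV_inj_surj insertI1 subsetD)
  then have "|Pow A| <o |UNIV :: 'u set|" using assms by (auto simp: universe_def)
  then have no: "\<not> |UNIV :: 'u set| \<le>o |Pow A|"
    using not_ordLess_ordLeq by blast
  have "card (UNIV :: 'u set) = Suc (card A)"
    unfolding A_def by (metis UNIV_I fin card.remove)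
  also have "\<dots> \<le> 2 ^ card A" by (simp add: Suc_leI)
  also have "\<dots> = card (Pow A)" using finite_subset[OF subset_UNIV fin] card_Pow by metis
  finally have "\<exists>f. inj_on f (UNIV :: 'u set) \<and> f ` UNIV \<subseteq> Pow A"
    using fin by (metis card_le_inj finite_Pow_iff rev_finite_subset subset_UNIV)
  then show False using no card_of_ordLeq by blast
qed

lemma small_finite:
  assumes "universe TYPE('u)" "finite (A :: 'u set)"
  shows "small A"
  unfolding small_iff_no_inj
  by (metis assms finite_imageD finite_subset universe_infinite)

text \<open>Supplies two labels in the universe: they index binary products and are the values of
  characteristic maps to a constant object.\<close>

lemma two_elements:
  assumes "universe TYPE('u)"
  obtains a b :: 'u where "a \<noteq> b" "small {a, b}"
proof -
  have "(UNIV :: 'u set) \<noteq> {undefined}" using universe_infinite[OF assms] by (metis finite.simps)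
  then obtain a :: 'u where "a \<noteq> undefined" by blast
  then show thesis using that small_finite[OF assms] by simp
qed

text \<open>Sections of a product sheaf have to be elements of \<open>'u\<close>, so families are
  coded by elements of the universe. A code exists because a family is determined by its graph, a
  subset of a set that regularity makes small, and the strong limit condition bounds the power
  set.\<close>

lemma small_PiE_embeds:
  fixes B :: "'u \<Rightarrow> 'u set"
  assumes u: "universe TYPE('u)" and S: "small S" and B: "\<And>s. s \<in> S \<Longrightarrow> small (B s)"
  obtains f :: "('u \<Rightarrow> 'u) \<Rightarrow> 'u" where "inj_on f (PiE S B)" "small (f ` PiE S B)"
proof -
  \<comment> \<open>A pairing on the universe, available because it is infinite, lets the graph of a
    family be a subset of \<open>'u\<close>.\<close>
  have "|(UNIV :: 'u set) \<times> (UNIV :: 'u set)| =o |UNIV :: 'u set|"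
    using card_of_Times_same_infinite[OF universe_infinite[OF u]] .
  then obtain pr :: "'u \<times> 'u \<Rightarrow> 'u" where pr: "inj pr"
    by (metis UNIV_Times_UNIV bij_betw_imp_inj_on card_of_ordIso)
  define T where "T = (\<Union>s\<in>S. (\<lambda>b. pr (s, b)) ` B s)"
  have "small T"
    unfolding T_def
  proof -
    have "\<forall>a\<in>S. small ((\<lambda>b. pr (a, b)) ` B a)" using B small_image by blast
    then show "small (\<Union>s\<in>S. (\<lambda>b. pr (s, b)) ` B s)"
      by (intro u[unfolded universe_def, THEN conjunct2, rule_format, OF conjI[OF S]])
  qed
  then have PT: "|Pow T| <o |UNIV :: 'u set|" using u by (auto simp: universe_def)
  define g where "g h = {pr (s, h s) |s. s \<in> S}" for h :: "'u \<Rightarrow> 'u"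
  have ginj: "inj_on g (PiE S B)"
  proof (rule inj_onI)
    fix h k assume h: "h \<in> PiE S B" and k: "k \<in> PiE S B" and e: "g h = g k"
    have "h s = k s" if "s \<in> S" for s
    proof -
      have "pr (s, h s) \<in> g k" using that e by (auto simp: g_def)
      then obtain s' where "pr (s, h s) = pr (s', k s')" by (auto simp: g_def)
      then show ?thesis using injD[OF pr] by blast
    qed
    then show "h = k" using h k PiE_ext by blast
  qed
  have gsub: "g ` PiE S B \<subseteq> Pow T" unfolding g_def T_def by (auto simp: PiE_def Pi_def)
  have "|PiE S B| \<le>o |Pow T|" using ginj gsub card_of_ordLeq by blast
  then have lt: "|PiE S B| <o |UNIV :: 'u set|" using PT ordLeq_ordLess_trans by blast
  then have "|PiE S B| \<le>o |UNIV :: 'u set|" using ordLess_imp_ordLeq by blast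
  then obtain f :: "('u \<Rightarrow> 'u) \<Rightarrow> 'u" where f: "inj_on f (PiE S B)"
    using card_of_ordLeq by metis
  have "small (f ` PiE S B)"
    unfolding small_def using lt card_of_image ordLeq_ordLess_trans by blast
  then show thesis using f that by blast
qed

section \<open>Categories, functors and equivalences\<close>

lemma homD: "f \<in> hom C X Y \<Longrightarrow> f \<in> arr C" "f \<in> hom C X Y \<Longrightarrow> src C f = X"
    "f \<in> hom C X Y \<Longrightarrow> tgt C f = Y"
  by (simp_all add: hom_def)

lemma hom_opposite: "hom (opposite C) X Y = hom C Y X"
  by (auto simp: hom_def opposite_def)

lemma opposite_sel [simp]: "obj (opposite C) = obj C" "arr (opposite C) = arr C"
    "src (opposite C) = tgt C" "tgt (opposite C) = src C" "idt (opposite C) = idt C"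
    "g \<cdot>\<^bsub>opposite C\<^esub> f = f \<cdot>\<^bsub>C\<^esub> g"
  by (simp_all add: opposite_def)

locale ctg =
  fixes E :: "('o, 'a) cat" (structure)
  assumes category: "category E"
begin

lemma comp_in: "f \<in> hom E X Y \<Longrightarrow> g \<in> hom E Y Z \<Longrightarrow> g \<cdot> f \<in> hom E X Z"
  using category unfolding category_def by blast

lemma id_in: "X \<in> obj E \<Longrightarrow> idt E X \<in> hom E X X"
  using category unfolding category_def by blast

lemma assoc: "f \<in> hom E W X \<Longrightarrow> g \<in> hom E X Y \<Longrightarrow> h \<in> hom E Y Z \<Longrightarrow> h \<cdot> g \<cdot> f = (h \<cdot> g) \<cdot> f"
  using category unfolding category_def by blast

lemma id_right: "f \<in> hom E X Y \<Longrightarrow> f \<cdot> idt E X = f"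
  using category unfolding category_def by blast

lemma id_left: "f \<in> hom E X Y \<Longrightarrow> idt E Y \<cdot> f = f"
  using category unfolding category_def by blast

lemma hom_obj: "f \<in> hom E X Y \<Longrightarrow> X \<in> obj E" "f \<in> hom E X Y \<Longrightarrow> Y \<in> obj E"
  using category unfolding category_def hom_def by auto

lemma isoI:
  "f \<in> hom E X Y \<Longrightarrow> g \<in> hom E Y X \<Longrightarrow> g \<cdot> f = idt E X \<Longrightarrow> f \<cdot> g = idt E Y \<Longrightarrow> iso E f"
  unfolding iso_def by (metis homD)

lemma isoE:
  assumes "iso E f" "f \<in> hom E X Y"
  obtains g where "g \<in> hom E Y X" "g \<cdot> f = idt E X" "f \<cdot> g = idt E Y"
  using assms unfolding iso_def by (metis homD(2,3))

lemma iso_cancel_right: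
  assumes "iso E f" "f \<in> hom E X Y" "g \<in> hom E Y Z" "h \<in> hom E Y Z" "g \<cdot> f = h \<cdot> f"
  shows "g = h"
proof -
  obtain k where k: "k \<in> hom E Y X" "f \<cdot> k = idt E Y" using isoE assms(1,2) by metis
  have "g \<cdot> f \<cdot> k = h \<cdot> f \<cdot> k"
    using assoc[OF k(1) assms(2,3)] assoc[OF k(1) assms(2,4)] assms(5) by simp
  then show ?thesis using k id_right[OF assms(3)] id_right[OF assms(4)] by simp
qed

lemma iso_cancel_left:
  assumes "iso E f" "f \<in> hom E X Y" "g \<in> hom E W X" "h \<in> hom E W X" "f \<cdot> g = f \<cdot> h"
  shows "g = h"
proof -
  obtain k where k: "k \<in> hom E Y X" "k \<cdot> f = idt E X" using isoE assms(1,2) by metis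
  have "(k \<cdot> f) \<cdot> g = (k \<cdot> f) \<cdot> h"
    using assoc[OF assms(3,2) k(1)] assoc[OF assms(4,2) k(1)] assms(5) by simp
  then show ?thesis using k id_left[OF assms(3)] id_left[OF assms(4)] by simp
qed

end

context
  fixes C :: "('o, 'a) cat" and D :: "('p, 'b) cat" and F
  assumes F: "is_functor C D F"
begin

lemma functor_obj: "X \<in> obj C \<Longrightarrow> fobj F X \<in> obj D"
  using F unfolding is_functor_def by blast

lemma functor_hom: "f \<in> hom C X Y \<Longrightarrow> farr F f \<in> hom D (fobj F X) (fobj F Y)"
  using F unfolding is_functor_def by blast

lemma functor_id: "X \<in> obj C \<Longrightarrow> farr F (idt C X) = idt D (fobj F X)"
  using F unfolding is_functor_def by blast

lemma functor_comp: "f \<in> hom C X Y \<Longrightarrow> g \<in> hom C Y Z \<Longrightarrow>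
    farr F (g \<cdot>\<^bsub>C\<^esub> f) = farr F g \<cdot>\<^bsub>D\<^esub> farr F f"
  using F unfolding is_functor_def by blast

end

text \<open>Naturality of the two isomorphisms makes both functors faithful. No triangle identity
  relates the isomorphisms, so fullness of \<open>F\<close> is deduced from faithfulness of
  \<open>G\<close>.\<close>

lemma equivalent_fully_faithful:
  fixes C :: "('o, 'a) cat" (structure) and D :: "('p, 'b) cat"
  assumes C: "category C" and D: "category D" and "equivalent C D"
  obtains F where "is_functor C D F" "full_faithful C D F"
    "\<And>Y. Y \<in> obj D \<Longrightarrow> \<exists>X \<in> obj C. \<exists>i \<in> hom D (fobj F X) Y. iso D i"
proof -
  interpret C: ctg C by (rule ctg.intro[OF C])
  interpret D: ctg D by (rule ctg.intro[OF D])
  from \<open>equivalent C D\<close> obtain F G \<eta> \<epsilon> where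
    F: "is_functor C D F" and G: "is_functor D C G" and
    \<eta>: "nat_iso C C id_functor (comp_functor G F) \<eta>" and
    \<epsilon>: "nat_iso D D (comp_functor F G) id_functor \<epsilon>"
    unfolding equivalent_def by blast
  have \<eta>_in: "\<eta> X \<in> hom C X (fobj G (fobj F X))" and \<eta>_iso: "iso C (\<eta> X)" if "X \<in> obj C" for X
    using \<eta> that by (auto simp: nat_iso_def nat_trans_def id_functor_def comp_functor_def)
  have \<eta>_nat: "farr G (farr F f) \<cdot> \<eta> X = \<eta> Y \<cdot> f" if "f \<in> hom C X Y" for f X Y
    using \<eta> that by (auto simp: nat_iso_def nat_trans_def id_functor_def comp_functor_def)
  have \<epsilon>_in: "\<epsilon> X \<in> hom D (fobj F (fobj G X)) X" and \<epsilon>_iso: "iso D (\<epsilon> X)" if "X \<in> obj D" for X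
    using \<epsilon> that by (auto simp: nat_iso_def nat_trans_def id_functor_def comp_functor_def)
  have \<epsilon>_nat: "f \<cdot>\<^bsub>D\<^esub> \<epsilon> X = \<epsilon> Y \<cdot>\<^bsub>D\<^esub> farr F (farr G f)" if "f \<in> hom D X Y" for f X Y
    using \<epsilon> that by (auto simp: nat_iso_def nat_trans_def id_functor_def comp_functor_def)
  have F_faithful: "f = g" if "f \<in> hom C X Y" "g \<in> hom C X Y" "farr F f = farr F g" for f g X Y
    using that C.iso_cancel_left[OF \<eta>_iso \<eta>_in] \<eta>_nat C.hom_obj by metis
  have G_faithful: "f = g" if "f \<in> hom D X Y" "g \<in> hom D X Y" "farr G f = farr G g" for f g X Y
    using that D.iso_cancel_right[OF \<epsilon>_iso \<epsilon>_in] \<epsilon>_nat D.hom_obj by metis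
  have F_full: "\<exists>f \<in> hom C X Y. farr F f = g"
    if X: "X \<in> obj C" and Y: "Y \<in> obj C" and g: "g \<in> hom D (fobj F X) (fobj F Y)" for g X Y
  proof -
    obtain i where i: "i \<in> hom C (fobj G (fobj F Y)) Y" and "i \<cdot> \<eta> Y = idt C Y"
      and ii: "\<eta> Y \<cdot> i = idt C (fobj G (fobj F Y))"
      using C.isoE[OF \<eta>_iso \<eta>_in] Y by metis
    have Gg: "farr G g \<in> hom C (fobj G (fobj F X)) (fobj G (fobj F Y))"
      using functor_hom[OF G g] .
    \<comment> \<open>Forced by naturality: \<open>i\<close> is the inverse of
      \<open>\<eta> Y\<close>, so \<open>farr G (farr F f)\<close> and \<open>farr G g\<close> agree
      after composition with the isomorphism \<open>\<eta> X\<close>.\<close>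
    define f where "f = i \<cdot> (farr G g \<cdot> \<eta> X)"
    have m: "farr G g \<cdot> \<eta> X \<in> hom C X (fobj G (fobj F Y))"
      using C.comp_in[OF \<eta>_in[OF X] Gg] .
    have f: "f \<in> hom C X Y" unfolding f_def using C.comp_in[OF m i] .
    have "\<eta> Y \<cdot> f = farr G g \<cdot> \<eta> X"
      unfolding f_def using C.assoc[OF m i \<eta>_in[OF Y]] ii C.id_left[OF m] by simp
    then have "farr G (farr F f) \<cdot> \<eta> X = farr G g \<cdot> \<eta> X" using \<eta>_nat[OF f] by simp
    then have "farr G (farr F f) = farr G g"
      using C.iso_cancel_right[OF \<eta>_iso[OF X] \<eta>_in[OF X]] functor_hom[OF G functor_hom[OF F f]] Gg
      by blast
    then show ?thesis using G_faithful[OF functor_hom[OF F f] g] f by blast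
  qed
  have "bij_betw (farr F) (hom C X Y) (hom D (fobj F X) (fobj F Y))" if "X \<in> obj C" "Y \<in> obj C" for X Y
    using F_full[OF that] F_faithful functor_hom[OF F]
    unfolding bij_betw_def by (auto simp: inj_on_def)
  then have "full_faithful C D F" by (simp add: full_faithful_def)
  moreover have "\<exists>X \<in> obj C. \<exists>i \<in> hom D (fobj F X) Y. iso D i" if "Y \<in> obj D" for Y
    using \<epsilon>_in \<epsilon>_iso that functor_obj[OF G] by blast
  ultimately show thesis using F that by blast
qed

section \<open>The category of small sets\<close>

lemma Sets_sel [simp]: "obj Sets = {A. small A}" "src Sets = fst" "tgt Sets = (\<lambda>k. snd (snd k))"
    "idt Sets A = (A, \<lambda>x \<in> A. x, A)"
  by (simp_all add: Sets_def)

abbreviation Sets_comp_syntax (infixr "\<bullet>" 70) where "l \<bullet> k \<equiv> l \<cdot>\<^bsub>Sets\<^esub> k"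

lemma Sets_cmp: "l \<bullet> k = (fst k, compose (fst k) (app l) (app k), snd (snd l))"
  by (simp add: Sets_def)

lemma app_simp [simp]: "app (A, f, B) = f"
  by (simp add: app_def)

lemma Sets_hom: "k \<in> hom Sets A B \<longleftrightarrow> small A \<and> small B \<and> (\<exists>f \<in> A \<rightarrow>\<^sub>E B. k = (A, f, B))"
  by (auto simp: hom_def Sets_def)

lemma Sets_homI: "small A \<Longrightarrow> small B \<Longrightarrow> f \<in> A \<rightarrow> B \<Longrightarrow> (A, restrict f A, B) \<in> hom Sets A B"
  by (auto simp: Sets_hom)

lemma Sets_app_in: "k \<in> hom Sets A B \<Longrightarrow> x \<in> A \<Longrightarrow> app k x \<in> B"
  by (auto simp: Sets_hom)

lemma Sets_app_comp: "k \<in> hom Sets A B \<Longrightarrow> x \<in> A \<Longrightarrow> app (l \<bullet> k) x = app l (app k x)"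
  by (auto simp: Sets_hom Sets_cmp compose_def)

lemma Sets_ext:
  assumes "k \<in> hom Sets A B" "l \<in> hom Sets A B" "\<And>x. x \<in> A \<Longrightarrow> app k x = app l x"
  shows "k = l"
proof -
  obtain f g where "f \<in> A \<rightarrow>\<^sub>E B" "g \<in> A \<rightarrow>\<^sub>E B" "k = (A, f, B)" "l = (A, g, B)"
    using assms(1,2) by (auto simp: Sets_hom)
  then show ?thesis using assms(3) PiE_ext[of f A "\<lambda>_. B" g] by simp
qed

lemma Sets_id: "small A \<Longrightarrow> idt Sets A \<in> hom Sets A A"
  by (auto simp: Sets_hom)

lemma Sets_comp:
  assumes "k \<in> hom Sets A B" "l \<in> hom Sets B C"
  shows "l \<bullet> k \<in> hom Sets A C"
proof -
  obtain f g where f: "f \<in> A \<rightarrow>\<^sub>E B" "k = (A, f, B)" and g: "g \<in> B \<rightarrow>\<^sub>E C" "l = (B, g, C)"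
    using assms by (auto simp: Sets_hom)
  have "compose A g f \<in> A \<rightarrow>\<^sub>E C" using f g by (auto simp: compose_def)
  then show ?thesis using assms f g by (auto simp: Sets_hom Sets_cmp)
qed

lemma Sets_category: "category Sets"
  unfolding category_def
proof (intro conjI allI ballI)
  fix f assume "f \<in> arr (Sets :: ('u set, 'u setmap) cat)"
  then show "src Sets f \<in> obj Sets" "tgt Sets f \<in> obj Sets" by (auto simp: Sets_def)
next
  fix W X Y Z and f g h :: "'u setmap"
  assume f: "f \<in> hom Sets W X" and g: "g \<in> hom Sets X Y" and h: "h \<in> hom Sets Y Z"
  note gf = Sets_comp[OF f g] and hg = Sets_comp[OF g h]
  show "h \<bullet> g \<bullet> f = (h \<bullet> g) \<bullet> f"
  proof (rule Sets_ext[OF Sets_comp[OF gf h] Sets_comp[OF f hg]])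
    fix x assume x: "x \<in> W"
    show "app (h \<bullet> g \<bullet> f) x = app ((h \<bullet> g) \<bullet> f) x"
      using x Sets_app_comp[OF gf x] Sets_app_comp[OF f x] Sets_app_comp[OF g Sets_app_in[OF f x]]
      by metis
  qed
next
  fix X Y and f :: "'u setmap" assume f: "f \<in> hom Sets X Y"
  have X: "small X" and Y: "small Y" using f by (auto simp: Sets_hom)
  have "f \<bullet> idt Sets X \<in> hom Sets X Y" using Sets_comp[OF Sets_id[OF X] f] .
  then show "f \<bullet> idt Sets X = f"
    by (rule Sets_ext[OF _ f]) (subst Sets_app_comp[OF Sets_id[OF X]], auto)
  have "idt Sets Y \<bullet> f \<in> hom Sets X Y" using Sets_comp[OF f Sets_id[OF Y]] .
  then show "idt Sets Y \<bullet> f = f"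
    by (rule Sets_ext[OF _ f]) (subst Sets_app_comp[OF f], auto simp: Sets_app_in[OF f])
next
  fix X assume "X \<in> obj (Sets :: ('u set, 'u setmap) cat)"
  then show "idt Sets X \<in> hom Sets X X" using Sets_id by simp
qed (rule Sets_comp)

section \<open>Sheaves through their sections\<close>

text \<open>A sheaf of small sets in elementary form: the sets of sections \<open>Q c\<close> and the restriction
  maps \<open>a u\<close>.\<close>

locale sheaf_data =
  fixes C :: "('u, 'u) cat" and J :: "'u \<Rightarrow> 'u set set" and Q :: "'u \<Rightarrow> 'u set" and a :: "'u \<Rightarrow> 'u \<Rightarrow> 'u"
  assumes small: "c \<in> obj C \<Longrightarrow> small (Q c)"
    and restrict_in: "u \<in> hom C d c \<Longrightarrow> x \<in> Q c \<Longrightarrow> a u x \<in> Q d"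
    and restrict_id: "c \<in> obj C \<Longrightarrow> x \<in> Q c \<Longrightarrow> a (idt C c) x = x"
    and restrict_comp: "u \<in> hom C d c \<Longrightarrow> v \<in> hom C b d \<Longrightarrow> x \<in> Q c \<Longrightarrow> a (u \<cdot>\<^bsub>C\<^esub> v) x = a v (a u x)"
    and amalgamation: "c \<in> obj C \<Longrightarrow> S \<in> J c \<Longrightarrow> (\<And>d u. u \<in> S \<Longrightarrow> u \<in> hom C d c \<Longrightarrow> y u \<in> Q d) \<Longrightarrow>
      (\<And>b d u v. u \<in> S \<Longrightarrow> u \<in> hom C d c \<Longrightarrow> v \<in> hom C b d \<Longrightarrow> y (u \<cdot>\<^bsub>C\<^esub> v) = a v (y u)) \<Longrightarrow>
      \<exists>!x. x \<in> Q c \<and> (\<forall>u \<in> S. a u x = y u)"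

context
  fixes C :: "('u, 'u) cat" (structure) and J :: "'u \<Rightarrow> 'u set set"
  assumes C: "category C" and J: "grothendieck_topology C J"
begin

interpretation C: ctg C by (rule ctg.intro[OF C])

lemma cover_hom: "c \<in> obj C \<Longrightarrow> S \<in> J c \<Longrightarrow> u \<in> S \<Longrightarrow> u \<in> hom C (src C u) c"
  using J unfolding grothendieck_topology_def sieve_def hom_def by blast

lemma matching_family_iff:
  assumes "c \<in> obj C" "S \<in> J c"
  shows "matching_family C P S x \<longleftrightarrow>
    (\<forall>d. \<forall>u \<in> S \<inter> hom C d c. x u \<in> fobj P d) \<and>
    (\<forall>d b. \<forall>u \<in> S \<inter> hom C d c. \<forall>v \<in> hom C b d. x (u \<cdot> v) = app (farr P v) (x u))"
  (is "_ \<longleftrightarrow> ?R1 \<and> ?R2")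
proof (intro iffI conjI)
  assume m: "matching_family C P S x"
  show ?R1 using m unfolding matching_family_def hom_def by blast
  show ?R2 using m unfolding matching_family_def hom_def by auto
next
  assume R: "?R1 \<and> ?R2"
  show "matching_family C P S x"
    unfolding matching_family_def
  proof (intro ballI conjI impI)
    fix u assume u: "u \<in> S"
    have h: "u \<in> hom C (src C u) c" using cover_hom[OF assms u] .
    show "x u \<in> fobj P (src C u)" using R u h by blast
    fix v assume "v \<in> arr C" "tgt C v = src C u"
    then have "v \<in> hom C (src C v) (src C u)" by (simp add: hom_def)
    then show "x (u \<cdot> v) = app (farr P v) (x u)" using R u h by blast
  qed
qed

lemma sheaf_imp_sheaf_data:
  assumes P: "sheaf C J P"
  shows "sheaf_data C J (fobj P) (\<lambda>u. app (farr P u))"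
proof -
  have F: "is_functor (opposite C) Sets P" using P by (simp add: sheaf_def)
  have h: "farr P u \<in> hom Sets (fobj P c) (fobj P d)" if "u \<in> hom C d c" for u c d
    using functor_hom[OF F, of u c d] that by (simp add: hom_opposite)
  show ?thesis
  proof (rule sheaf_data.intro)
    show "small (fobj P c)" if "c \<in> obj C" for c using functor_obj[OF F, of c] that by simp
    show "app (farr P u) x \<in> fobj P d" if "u \<in> hom C d c" "x \<in> fobj P c" for u c d x
      using Sets_app_in[OF h] that .
    show "app (farr P (idt C c)) x = x" if "c \<in> obj C" "x \<in> fobj P c" for c x
      using functor_id[OF F, of c] that by simp
    show "app (farr P (u \<cdot> v)) x = app (farr P v) (app (farr P u) x)"
      if "u \<in> hom C d c" "v \<in> hom C b d" "x \<in> fobj P c" for u v x b c d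
      using functor_comp[OF F, of u c d v b] that Sets_app_comp[OF h[OF that(1)] that(3)]
      by (simp add: hom_opposite)
    show "\<exists>!y. y \<in> fobj P c \<and> (\<forall>u \<in> S. app (farr P u) y = x u)"
      if cS: "c \<in> obj C" "S \<in> J c" and "\<And>d u. u \<in> S \<Longrightarrow> u \<in> hom C d c \<Longrightarrow> x u \<in> fobj P d"
        "\<And>b d u v. u \<in> S \<Longrightarrow> u \<in> hom C d c \<Longrightarrow> v \<in> hom C b d \<Longrightarrow> x (u \<cdot> v) = app (farr P v) (x u)"
      for c S x
    proof -
      have "matching_family C P S x" unfolding matching_family_iff[OF cS] using that(3,4) by auto
      then show ?thesis using P cS by (simp add: sheaf_def)
    qed
  qed
qed

lemma sheaf_of_sheaf_data:
  assumes Q: "sheaf_data C J Q a"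
  obtains P where "sheaf C J P" "fobj P = Q"
    "\<And>c d u x. u \<in> hom C d c \<Longrightarrow> x \<in> Q c \<Longrightarrow> app (farr P u) x = a u x"
proof -
  define P :: "'u presheaf" where
    "P = \<lparr>fobj = Q, farr = \<lambda>u. (Q (tgt C u), restrict (a u) (Q (tgt C u)), Q (src C u))\<rparr>"
  have fP: "fobj P = Q" by (simp add: P_def)
  note small = sheaf_data.small[OF Q] and a_in = sheaf_data.restrict_in[OF Q]
    and a_id = sheaf_data.restrict_id[OF Q] and a_comp = sheaf_data.restrict_comp[OF Q]
  have ap: "app (farr P u) x = a u x" if "u \<in> hom C d c" "x \<in> Q c" for u c d x
    using that by (simp add: P_def homD)
  have h: "farr P u \<in> hom Sets (Q c) (Q d)" if u: "u \<in> hom C d c" for u c d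
    using C.hom_obj[OF u] small a_in[OF u] by (auto simp: P_def homD[OF u] intro!: Sets_homI)
  have F: "is_functor (opposite C) Sets P"
    unfolding is_functor_def
  proof (intro conjI ballI allI)
    fix X assume "X \<in> obj (opposite C)"
    then have X: "X \<in> obj C" by simp
    show "fobj P X \<in> obj Sets" using small X by (simp add: fP)
    show "farr P (idt (opposite C) X) = idt Sets (fobj P X)"
      unfolding fP
      by (rule Sets_ext[OF _ Sets_id[OF small[OF X]]])
        (use h[OF C.id_in[OF X]] ap[OF C.id_in[OF X]] a_id[OF X] in auto)
  next
    fix X Y f assume "f \<in> hom (opposite C) X Y"
    then show "farr P f \<in> hom Sets (fobj P X) (fobj P Y)" using h by (simp add: hom_opposite fP)
  next
    fix X Y Z f g assume "f \<in> hom (opposite C) X Y" "g \<in> hom (opposite C) Y Z"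
    then have f: "f \<in> hom C Y X" and g: "g \<in> hom C Z Y" by (simp_all add: hom_opposite)
    have "farr P (f \<cdot> g) = farr P g \<bullet> farr P f"
    proof (rule Sets_ext[OF h[OF C.comp_in[OF g f]] Sets_comp[OF h[OF f] h[OF g]]])
      fix x assume x: "x \<in> Q X"
      show "app (farr P (f \<cdot> g)) x = app (farr P g \<bullet> farr P f) x"
        using Sets_app_comp[OF h[OF f] x] ap[OF C.comp_in[OF g f] x] ap[OF f x]
          ap[OF g a_in[OF f x]] a_comp[OF f g x] by simp
    qed
    then show "farr P (g \<cdot>\<^bsub>opposite C\<^esub> f) = farr P g \<bullet> farr P f" by simp
  qed
  have "\<exists>!y. y \<in> fobj P c \<and> (\<forall>f \<in> S. app (farr P f) y = x f)"
    if c: "c \<in> obj C" and S: "S \<in> J c" and x: "matching_family C P S x" for c S x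
  proof -
    have m: "\<forall>d. \<forall>u \<in> S \<inter> hom C d c. x u \<in> Q d"
      "\<forall>d b. \<forall>u \<in> S \<inter> hom C d c. \<forall>v \<in> hom C b d. x (u \<cdot> v) = app (farr P v) (x u)"
      using x matching_family_iff[OF c S] fP by auto
    then have "\<exists>!y. y \<in> Q c \<and> (\<forall>u \<in> S. a u y = x u)"
      using ap by (intro sheaf_data.amalgamation[OF Q c S]) auto
    moreover have "(y \<in> Q c \<and> (\<forall>u \<in> S. a u y = x u)) \<longleftrightarrow>
        (y \<in> fobj P c \<and> (\<forall>f \<in> S. app (farr P f) y = x f))" for y
      using ap cover_hom[OF c S] fP by metis
    ultimately show ?thesis by simp
  qed
  then have "sheaf C J P" using F by (simp add: sheaf_def)
  then show thesis using that fP ap by blast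
qed

section \<open>Morphisms of sheaves, evaluated on sections\<close>

definition shev :: "'u presheaf \<times> ('u \<Rightarrow> 'u setmap) \<times> 'u presheaf \<Rightarrow> 'u \<Rightarrow> 'u \<Rightarrow> 'u" where
  "shev k c x = app (fst (snd k) c) x"

abbreviation "Sh \<equiv> sheaf_cat C J"

lemma Sh_hom: "k \<in> hom Sh P Q \<longleftrightarrow> sheaf C J P \<and> sheaf C J Q \<and>
    (\<exists>\<eta>. k = (P, \<eta>, Q) \<and> nat_trans (opposite C) Sets P Q \<eta> \<and> \<eta> \<in> extensional (obj C))"
  by (auto simp: hom_def sheaf_cat_def)

lemma Sh_component: "k \<in> hom Sh P Q \<Longrightarrow> c \<in> obj C \<Longrightarrow> fst (snd k) c \<in> hom Sets (fobj P c) (fobj Q c)"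
  by (auto simp: Sh_hom nat_trans_def)

lemma shev_in: "k \<in> hom Sh P Q \<Longrightarrow> c \<in> obj C \<Longrightarrow> x \<in> fobj P c \<Longrightarrow> shev k c x \<in> fobj Q c"
  unfolding shev_def using Sets_app_in[OF Sh_component] .

lemma Sh_restrict:
  assumes "sheaf C J P" "u \<in> hom C d c"
  shows "farr P u \<in> hom Sets (fobj P c) (fobj P d)"
  using assms functor_hom[of "opposite C" Sets P u c d] by (simp add: sheaf_def hom_opposite)

lemma shev_nat:
  assumes k: "k \<in> hom Sh P Q" and u: "u \<in> hom C d c" and x: "x \<in> fobj P c"
  shows "app (farr Q u) (shev k c x) = shev k d (app (farr P u) x)"
proof -
  have P: "sheaf C J P" using k by (simp add: Sh_hom)
  have "farr Q u \<bullet> fst (snd k) c = fst (snd k) d \<bullet> farr P u"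
    using k u by (auto simp: Sh_hom nat_trans_def hom_opposite)
  then show ?thesis
    using Sets_app_comp[OF Sh_component[OF k] x] Sets_app_comp[OF Sh_restrict[OF P u] x] C.hom_obj[OF u]
    unfolding shev_def by metis
qed

lemma Sh_ext:
  assumes k: "k \<in> hom Sh P Q" and l: "l \<in> hom Sh P Q"
    and e: "\<And>c x. c \<in> obj C \<Longrightarrow> x \<in> fobj P c \<Longrightarrow> shev k c x = shev l c x"
  shows "k = l"
proof -
  obtain \<eta> \<theta> where kl: "k = (P, \<eta>, Q)" "l = (P, \<theta>, Q)" and ext: "\<eta> \<in> extensional (obj C)" "\<theta> \<in> extensional (obj C)"
    using k l by (auto simp: Sh_hom)
  have "\<eta> c = \<theta> c" if c: "c \<in> obj C" for c
    using Sets_ext[OF Sh_component[OF k c] Sh_component[OF l c]] e[OF c] kl by (simp add: shev_def)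
  then show ?thesis using kl ext extensionalityI by blast
qed

lemma Sh_make:
  assumes P: "sheaf C J P" and Q: "sheaf C J Q"
    and t_in: "\<And>c x. c \<in> obj C \<Longrightarrow> x \<in> fobj P c \<Longrightarrow> t c x \<in> fobj Q c"
    and t_nat: "\<And>c d u x. u \<in> hom C d c \<Longrightarrow> x \<in> fobj P c \<Longrightarrow>
      app (farr Q u) (t c x) = t d (app (farr P u) x)"
  shows "\<exists>k \<in> hom Sh P Q. \<forall>c \<in> obj C. \<forall>x \<in> fobj P c. shev k c x = t c x"
proof -
  define \<eta> where "\<eta> = (\<lambda>c \<in> obj C. (fobj P c, restrict (t c) (fobj P c), fobj Q c))"
  have small: "small (fobj P c)" "small (fobj Q c)" if "c \<in> obj C" for c
    using P Q that functor_obj[of "opposite C" Sets] by (auto simp: sheaf_def)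
  have comp: "\<eta> c \<in> hom Sets (fobj P c) (fobj Q c)" if "c \<in> obj C" for c
    using small that t_in by (auto simp: \<eta>_def intro!: Sets_homI)
  have ap: "app (\<eta> c) x = t c x" if "c \<in> obj C" "x \<in> fobj P c" for c x
    using that by (simp add: \<eta>_def)
  have "farr Q u \<bullet> \<eta> c = \<eta> d \<bullet> farr P u" if u: "u \<in> hom C d c" for u c d
  proof -
    have d: "d \<in> obj C" and c: "c \<in> obj C" using C.hom_obj[OF u] .
    note Pu = Sh_restrict[OF P u] and Qu = Sh_restrict[OF Q u]
    show ?thesis
    proof (rule Sets_ext[OF Sets_comp[OF comp[OF c] Qu] Sets_comp[OF Pu comp[OF d]]])
      fix x assume x: "x \<in> fobj P c"
      show "app (farr Q u \<bullet> \<eta> c) x = app (\<eta> d \<bullet> farr P u) x"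
        using Sets_app_comp[OF comp[OF c] x] Sets_app_comp[OF Pu x] ap[OF c x]
          ap[OF d Sets_app_in[OF Pu x]] t_nat[OF u x] by simp
    qed
  qed
  then have "(P, \<eta>, Q) \<in> hom Sh P Q"
    using P Q comp by (auto simp: Sh_hom nat_trans_def hom_opposite \<eta>_def)
  then show ?thesis using ap by (intro bexI[of _ "(P, \<eta>, Q)"]) (auto simp: shev_def)
qed

lemma Sh_id: "sheaf C J P \<Longrightarrow> idt Sh P \<in> hom Sh P P"
  and shev_id: "c \<in> obj C \<Longrightarrow> x \<in> fobj P c \<Longrightarrow> shev (idt Sh P) c x = x"
proof -
  show e: "shev (idt Sh P) c x = x" if "c \<in> obj C" "x \<in> fobj P c" for c x
    using that by (simp add: shev_def sheaf_cat_def)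
  show "idt Sh P \<in> hom Sh P P" if P: "sheaf C J P"
  proof -
    have small: "small (fobj P c)" if "c \<in> obj C" for c
      using P that functor_obj[of "opposite C" Sets P c] by (auto simp: sheaf_def)
    have i: "idt Sh P = (P, \<lambda>c \<in> obj C. idt Sets (fobj P c), P)" by (simp add: sheaf_cat_def)
    have "farr P u \<bullet> idt Sets (fobj P c) = idt Sets (fobj P d) \<bullet> farr P u"
      if "u \<in> hom C d c" for u c d
      using Sets_category Sh_restrict[OF P that] unfolding category_def by metis
    then show ?thesis
      using P small by (auto simp: i Sh_hom nat_trans_def hom_opposite Sets_id C.hom_obj simp del: Sets_sel(4))
  qed
qed

lemma shev_comp:
  assumes k: "k \<in> hom Sh P Q" and c: "c \<in> obj C" and x: "x \<in> fobj P c"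
  shows "shev (l \<cdot>\<^bsub>Sh\<^esub> k) c x = shev l c (shev k c x)"
  using Sets_app_comp[OF Sh_component[OF k c] x] c by (simp add: shev_def sheaf_cat_def)

text \<open>Naturality of the composite comes from \<open>Sh_make\<close>, which yields an arrow
  with the right values; the componentwise composite is then identified with it on elements.\<close>

lemma Sh_comp:
  assumes k: "k \<in> hom Sh P Q" and l: "l \<in> hom Sh Q R"
  shows "l \<cdot>\<^bsub>Sh\<^esub> k \<in> hom Sh P R"
proof -
  have P: "sheaf C J P" and R: "sheaf C J R" using k l by (auto simp: Sh_hom)
  obtain m where m: "m \<in> hom Sh P R"
    and ev: "\<And>c x. c \<in> obj C \<Longrightarrow> x \<in> fobj P c \<Longrightarrow> shev m c x = shev l c (shev k c x)"
    using Sh_make[OF P R, of "\<lambda>c x. shev l c (shev k c x)"] shev_in[OF k] shev_in[OF l]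
      shev_nat[OF k] shev_nat[OF l] C.hom_obj by metis
  obtain \<eta> where m_eq: "m = (P, \<eta>, R)" and ext: "\<eta> \<in> extensional (obj C)"
    using m by (auto simp: Sh_hom)
  have lk: "l \<cdot>\<^bsub>Sh\<^esub> k = (P, \<lambda>c \<in> obj C. fst (snd l) c \<bullet> fst (snd k) c, R)"
    using k l by (auto simp: sheaf_cat_def hom_def)
  have "\<eta> c = (\<lambda>c \<in> obj C. fst (snd l) c \<bullet> fst (snd k) c) c" if c: "c \<in> obj C" for c
  proof -
    have "\<eta> c = fst (snd l) c \<bullet> fst (snd k) c"
    proof (rule Sets_ext)
      show "\<eta> c \<in> hom Sets (fobj P c) (fobj R c)" using Sh_component[OF m c] m_eq by simp
      show "fst (snd l) c \<bullet> fst (snd k) c \<in> hom Sets (fobj P c) (fobj R c)"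
        using Sets_comp[OF Sh_component[OF k c] Sh_component[OF l c]] .
      fix x assume x: "x \<in> fobj P c"
      show "app (\<eta> c) x = app (fst (snd l) c \<bullet> fst (snd k) c) x"
        using Sets_app_comp[OF Sh_component[OF k c] x] ev[OF c x] m_eq by (simp add: shev_def)
    qed
    then show ?thesis using c by simp
  qed
  then have "\<eta> = (\<lambda>c \<in> obj C. fst (snd l) c \<bullet> fst (snd k) c)"
    by (rule extensionalityI[OF ext restrict_extensional])
  then show ?thesis using m m_eq lk by simp
qed

lemma Sh_category: "category Sh"
  unfolding category_def
proof (intro conjI allI ballI)
  fix f assume "f \<in> arr Sh"
  then show "src Sh f \<in> obj Sh" "tgt Sh f \<in> obj Sh" by (auto simp: sheaf_cat_def)
next
  fix W X Y Z f g h
  assume f: "f \<in> hom Sh W X" and g: "g \<in> hom Sh X Y" and h: "h \<in> hom Sh Y Z"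
  note gf = Sh_comp[OF f g] and hg = Sh_comp[OF g h]
  show "h \<cdot>\<^bsub>Sh\<^esub> g \<cdot>\<^bsub>Sh\<^esub> f = (h \<cdot>\<^bsub>Sh\<^esub> g) \<cdot>\<^bsub>Sh\<^esub> f"
  proof (rule Sh_ext[OF Sh_comp[OF gf h] Sh_comp[OF f hg]])
    fix c x assume c: "c \<in> obj C" and x: "x \<in> fobj W c"
    show "shev (h \<cdot>\<^bsub>Sh\<^esub> g \<cdot>\<^bsub>Sh\<^esub> f) c x = shev ((h \<cdot>\<^bsub>Sh\<^esub> g) \<cdot>\<^bsub>Sh\<^esub> f) c x"
      using shev_comp[OF gf c x] shev_comp[OF f c x] shev_comp[OF g c shev_in[OF f c x]] by simp
  qed
next
  fix X Y f assume f: "f \<in> hom Sh X Y"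
  have X: "sheaf C J X" and Y: "sheaf C J Y" using f by (auto simp: Sh_hom)
  show "f \<cdot>\<^bsub>Sh\<^esub> idt Sh X = f"
    by (rule Sh_ext[OF Sh_comp[OF Sh_id[OF X] f] f]) (simp add: shev_comp[OF Sh_id[OF X]] shev_id)
  show "idt Sh Y \<cdot>\<^bsub>Sh\<^esub> f = f"
    by (rule Sh_ext[OF Sh_comp[OF f Sh_id[OF Y]] f]) (simp add: shev_comp[OF f] shev_id shev_in[OF f])
next
  fix X assume "X \<in> obj Sh"
  then show "idt Sh X \<in> hom Sh X X" using Sh_id by (simp add: sheaf_cat_def)
qed (rule Sh_comp)

lemma Sh_iso_bij:
  assumes "iso Sh k" and k: "k \<in> hom Sh P Q" and c: "c \<in> obj C"
  shows "bij_betw (shev k c) (fobj P c) (fobj Q c)"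
proof -
  interpret Sh: ctg Sh by (rule ctg.intro[OF Sh_category])
  obtain l where l: "l \<in> hom Sh Q P" and lk: "l \<cdot>\<^bsub>Sh\<^esub> k = idt Sh P" and kl: "k \<cdot>\<^bsub>Sh\<^esub> l = idt Sh Q"
    using Sh.isoE[OF assms(1) k] .
  show ?thesis
  proof (rule bij_betw_byWitness[of _ "shev l c"])
    show "\<forall>x \<in> fobj P c. shev l c (shev k c x) = x"
      using shev_comp[OF k c, of _ l] lk shev_id[OF c] by metis
    show "\<forall>x \<in> fobj Q c. shev k c (shev l c x) = x"
      using shev_comp[OF l c, of _ k] kl shev_id[OF c] by metis
    show "shev k c ` fobj P c \<subseteq> fobj Q c" using shev_in[OF k c] by blast
    show "shev l c ` fobj Q c \<subseteq> fobj P c" using shev_in[OF l c] by blast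
  qed
qed

end

text \<open>Objects of \<open>E\<close> are handled through the sections of the corresponding sheaves on a site:
  \<open>sec X c\<close> is the set of sections of \<open>X\<close> over \<open>c\<close>, \<open>act X u\<close> the restriction along \<open>u\<close> and
  \<open>ev f c\<close> the component of the arrow \<open>f\<close> at \<open>c\<close>.\<close>

locale site_rep = ctg E for E :: "('o, 'a) cat" (structure) +
  fixes C :: "('u, 'u) cat" and J and sec :: "'o \<Rightarrow> 'u \<Rightarrow> 'u set" and act :: "'o \<Rightarrow> 'u \<Rightarrow> 'u \<Rightarrow> 'u"
    and ev :: "'a \<Rightarrow> 'u \<Rightarrow> 'u \<Rightarrow> 'u"
  assumes univ: "universe TYPE('u)" and C: "category C" and J: "grothendieck_topology C J"
    and sections: "X \<in> obj E \<Longrightarrow> sheaf_data C J (sec X) (act X)"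
    and ev_in: "f \<in> hom E X Y \<Longrightarrow> c \<in> obj C \<Longrightarrow> x \<in> sec X c \<Longrightarrow> ev f c x \<in> sec Y c"
    and ev_nat: "f \<in> hom E X Y \<Longrightarrow> u \<in> hom C d c \<Longrightarrow> x \<in> sec X c \<Longrightarrow> act Y u (ev f c x) = ev f d (act X u x)"
    and ev_id: "X \<in> obj E \<Longrightarrow> c \<in> obj C \<Longrightarrow> x \<in> sec X c \<Longrightarrow> ev (idt E X) c x = x"
    and ev_comp: "f \<in> hom E X Y \<Longrightarrow> g \<in> hom E Y Z \<Longrightarrow> c \<in> obj C \<Longrightarrow> x \<in> sec X c \<Longrightarrow>
      ev (g \<cdot> f) c x = ev g c (ev f c x)"
    and faithful: "f \<in> hom E X Y \<Longrightarrow> g \<in> hom E X Y \<Longrightarrow>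
      (\<And>c x. c \<in> obj C \<Longrightarrow> x \<in> sec X c \<Longrightarrow> ev f c x = ev g c x) \<Longrightarrow> f = g"
    and full: "X \<in> obj E \<Longrightarrow> Y \<in> obj E \<Longrightarrow>
      (\<And>c x. c \<in> obj C \<Longrightarrow> x \<in> sec X c \<Longrightarrow> t c x \<in> sec Y c) \<Longrightarrow>
      (\<And>c d u x. u \<in> hom C d c \<Longrightarrow> x \<in> sec X c \<Longrightarrow> act Y u (t c x) = t d (act X u x)) \<Longrightarrow>
      \<exists>f \<in> hom E X Y. \<forall>c \<in> obj C. \<forall>x \<in> sec X c. ev f c x = t c x"
    and realize: "sheaf_data C J Q a \<Longrightarrow> \<exists>X \<in> obj E. \<exists>\<theta>. (\<forall>c \<in> obj C. bij_betw (\<theta> c) (sec X c) (Q c)) \<and>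
      (\<forall>c d. \<forall>u \<in> hom C d c. \<forall>x \<in> sec X c. \<theta> d (act X u x) = a u (\<theta> c x))"

text \<open>\<open>full\<close> and \<open>faithful\<close> restate that the functor to sheaves is
  fully faithful. An equivalence reaches a given sheaf only up to isomorphism, which is why
  \<open>realize\<close> yields natural bijections \<theta> and not an equality of sections.\<close>

lemma grothendieck_topos_site_rep:
  fixes E :: "('o, 'a) cat"
  assumes univ: "universe TYPE('u)" and E: "grothendieck_topos TYPE('u) E"
  obtains C J and sec :: "'o \<Rightarrow> 'u \<Rightarrow> 'u set" and act ev where "site_rep E C J sec act ev"
proof -
  obtain C :: "('u, 'u) cat" and J where cat: "category E" and C: "category C"
    and J: "grothendieck_topology C J" and eq: "equivalent E (sheaf_cat C J)"
    using E unfolding grothendieck_topos_def by blast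
  note Shc = Sh_category[OF C J]
  obtain F where F: "is_functor E (sheaf_cat C J) F" and ff: "full_faithful E (sheaf_cat C J) F"
    and ess: "\<And>Y. Y \<in> obj (sheaf_cat C J) \<Longrightarrow>
      \<exists>X \<in> obj E. \<exists>i \<in> hom (sheaf_cat C J) (fobj F X) Y. iso (sheaf_cat C J) i"
    using equivalent_fully_faithful[OF cat Shc eq] by blast
  interpret E: ctg E by (rule ctg.intro[OF cat])
  have sh: "sheaf C J (fobj F X)" if "X \<in> obj E" for X
    using functor_obj[OF F that] by (simp add: sheaf_cat_def)
  note h = functor_hom[OF F]
  define ev where "ev f = shev (farr F f)" for f
  define act where "act X u = app (farr (fobj F X) u)" for X u
  define sec where "sec X = fobj (fobj F X)" for X
  have "site_rep E C J sec act ev"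
  proof (intro site_rep.intro ctg.intro site_rep_axioms.intro)
    show "sheaf_data C J (sec X) (act X)" if "X \<in> obj E" for X
      using sheaf_imp_sheaf_data[OF C J sh[OF that]] by (simp add: sec_def act_def[abs_def])
    show "ev f c x \<in> sec Y c" if "f \<in> hom E X Y" "c \<in> obj C" "x \<in> sec X c" for f X Y c x
      using shev_in[OF C J h] that by (simp add: sec_def ev_def)
    show "act Y u (ev f c x) = ev f d (act X u x)"
      if "f \<in> hom E X Y" "u \<in> hom C d c" "x \<in> sec X c" for f X Y u c d x
      using shev_nat[OF C J h] that by (simp add: sec_def ev_def act_def)
    show "ev (idt E X) c x = x" if "X \<in> obj E" "c \<in> obj C" "x \<in> sec X c" for X c x
      using shev_id[OF C J] functor_id[OF F] that by (simp add: sec_def ev_def)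
    show "ev (g \<cdot>\<^bsub>E\<^esub> f) c x = ev g c (ev f c x)"
      if "f \<in> hom E X Y" "g \<in> hom E Y Z" "c \<in> obj C" "x \<in> sec X c" for f g X Y Z c x
      using shev_comp[OF C J h[OF that(1)]] functor_comp[OF F that(1,2)] that
      by (simp add: sec_def ev_def)
    show "f = g" if f: "f \<in> hom E X Y" and g: "g \<in> hom E X Y"
      and e: "\<And>c x. c \<in> obj C \<Longrightarrow> x \<in> sec X c \<Longrightarrow> ev f c x = ev g c x" for f g X Y
    proof -
      have "farr F f = farr F g"
        using Sh_ext[OF C J h[OF f] h[OF g]] e by (simp add: sec_def ev_def)
      then show ?thesis
        using ff E.hom_obj[OF f] f g unfolding full_faithful_def bij_betw_def inj_on_def by blast
    qed
    show "\<exists>f \<in> hom E X Y. \<forall>c \<in> obj C. \<forall>x \<in> sec X c. ev f c x = t c x"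
      if X: "X \<in> obj E" and Y: "Y \<in> obj E"
        and t1: "\<And>c x. c \<in> obj C \<Longrightarrow> x \<in> sec X c \<Longrightarrow> t c x \<in> sec Y c"
        and t2: "\<And>c d u x. u \<in> hom C d c \<Longrightarrow> x \<in> sec X c \<Longrightarrow> act Y u (t c x) = t d (act X u x)"
      for X Y t
    proof -
      obtain k where k: "k \<in> hom (sheaf_cat C J) (fobj F X) (fobj F Y)"
        and kt: "\<forall>c \<in> obj C. \<forall>x \<in> sec X c. shev k c x = t c x"
        using Sh_make[OF C J sh[OF X] sh[OF Y], of t] t1 t2 by (auto simp: sec_def act_def)
      have "k \<in> farr F ` hom E X Y"
        using ff X Y k by (simp add: full_faithful_def bij_betw_def)
      then obtain f where "f \<in> hom E X Y" "farr F f = k" by blast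
      then show ?thesis using kt by (auto simp: ev_def)
    qed
    show "\<exists>X \<in> obj E. \<exists>\<theta>. (\<forall>c \<in> obj C. bij_betw (\<theta> c) (sec X c) (Q c)) \<and>
      (\<forall>c d. \<forall>u \<in> hom C d c. \<forall>x \<in> sec X c. \<theta> d (act X u x) = a u (\<theta> c x))"
      if Q: "sheaf_data C J Q a" for Q a
    proof -
      obtain P where P: "sheaf C J P" "fobj P = Q"
        "\<And>c d u x. u \<in> hom C d c \<Longrightarrow> x \<in> Q c \<Longrightarrow> app (farr P u) x = a u x"
        using sheaf_of_sheaf_data[OF C J Q] by metis
      obtain X i where X: "X \<in> obj E" and i: "i \<in> hom (sheaf_cat C J) (fobj F X) P" and "iso (sheaf_cat C J) i"
        using ess[of P] P by (auto simp: sheaf_cat_def)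
      then have b: "\<forall>c \<in> obj C. bij_betw (shev i c) (sec X c) (Q c)"
        using Sh_iso_bij[OF C J _ i] P by (simp add: sec_def)
      have "shev i d (act X u x) = a u (shev i c x)" if u: "u \<in> hom C d c" and x: "x \<in> sec X c" for c d u x
      proof -
        have "c \<in> obj C" using ctg.hom_obj[OF ctg.intro[OF C] u] by blast
        then have "shev i c x \<in> Q c" using shev_in[OF C J i] x P by (simp add: sec_def)
        then show ?thesis using shev_nat[OF C J i u, of x] x P(3)[OF u, of "shev i c x"]
          by (metis act_def sec_def)
      qed
      then show ?thesis using X b by blast
    qed
  qed (use cat C J univ in auto)
  then show thesis using that by blast
qed

section \<open>Limits and complements in a topos\<close>

definition equalizer :: "('o, 'a) cat \<Rightarrow> 'o \<Rightarrow> 'a \<Rightarrow> 'a \<Rightarrow> 'o \<Rightarrow> 'a \<Rightarrow> bool" where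
  "equalizer C X f g K e \<longleftrightarrow> e \<in> hom C K X \<and> f \<cdot>\<^bsub>C\<^esub> e = g \<cdot>\<^bsub>C\<^esub> e \<and>
     (\<forall>W. \<forall>h \<in> hom C W X. f \<cdot>\<^bsub>C\<^esub> h = g \<cdot>\<^bsub>C\<^esub> h \<longrightarrow> (\<exists>!k. k \<in> hom C W K \<and> e \<cdot>\<^bsub>C\<^esub> k = h))"

lemma binary_coproduct_iff:
  "binary_coproduct C A B P i j \<longleftrightarrow> i \<in> hom C A P \<and> j \<in> hom C B P \<and>
     (\<forall>M. \<forall>f \<in> hom C A M. \<forall>g \<in> hom C B M. \<exists>!h. h \<in> hom C P M \<and> h \<cdot>\<^bsub>C\<^esub> i = f \<and> h \<cdot>\<^bsub>C\<^esub> j = g)"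
  by (simp add: binary_coproduct_def binary_product_def hom_opposite)

text \<open>\<open>local\<close> is what remains of the sheaf condition for a subpresheaf of a
  sheaf: amalgamations exist and are unique in \<open>Q\<close>, and only membership in
  \<open>U\<close> has to be checked on a cover.\<close>

locale subsheaf =
  fixes C :: "('u, 'u) cat" and J :: "'u \<Rightarrow> 'u set set" and Q :: "'u \<Rightarrow> 'u set" and a :: "'u \<Rightarrow> 'u \<Rightarrow> 'u"
    and U :: "'u \<Rightarrow> 'u set"
  assumes subset: "c \<in> obj C \<Longrightarrow> U c \<subseteq> Q c"
    and closed: "u \<in> hom C d c \<Longrightarrow> x \<in> U c \<Longrightarrow> a u x \<in> U d"
    and local: "c \<in> obj C \<Longrightarrow> S \<in> J c \<Longrightarrow> x \<in> Q c \<Longrightarrow> (\<And>u. u \<in> S \<Longrightarrow> a u x \<in> U (src C u)) \<Longrightarrow> x \<in> U c"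

context site_rep
begin

abbreviation "subsheaf_of X \<equiv> subsheaf C J (sec X) (act X)"

sublocale C: ctg C by (rule ctg.intro[OF C])

lemma sec_small: "X \<in> obj E \<Longrightarrow> c \<in> obj C \<Longrightarrow> small (sec X c)"
  using sheaf_data.small[OF sections] .

lemma act_in: "X \<in> obj E \<Longrightarrow> u \<in> hom C d c \<Longrightarrow> x \<in> sec X c \<Longrightarrow> act X u x \<in> sec X d"
  using sheaf_data.restrict_in[OF sections] .

lemma act_id: "X \<in> obj E \<Longrightarrow> c \<in> obj C \<Longrightarrow> x \<in> sec X c \<Longrightarrow> act X (idt C c) x = x"
  using sheaf_data.restrict_id[OF sections] .

lemma act_comp: "X \<in> obj E \<Longrightarrow> u \<in> hom C d c \<Longrightarrow> v \<in> hom C b d \<Longrightarrow> x \<in> sec X c \<Longrightarrow>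
    act X (u \<cdot>\<^bsub>C\<^esub> v) x = act X v (act X u x)"
  using sheaf_data.restrict_comp[OF sections] .

lemmas glue = sheaf_data.amalgamation[OF sections]
lemmas cov_hom = cover_hom[OF C J]

lemma topology:
  assumes "c \<in> obj C"
  shows "S \<in> J c \<Longrightarrow> sieve C c S"
    and "{f \<in> arr C. tgt C f = c} \<in> J c"
    and "S \<in> J c \<Longrightarrow> u \<in> arr C \<Longrightarrow> tgt C u = c \<Longrightarrow> pullback_sieve C u S \<in> J (src C u)"
    and "S \<in> J c \<Longrightarrow> sieve C c R \<Longrightarrow> (\<And>u. u \<in> S \<Longrightarrow> pullback_sieve C u R \<in> J (src C u)) \<Longrightarrow> R \<in> J c"
proof -
  note D = J[unfolded grothendieck_topology_def, THEN bspec, OF assms]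
  show "S \<in> J c \<Longrightarrow> sieve C c S" by (rule D[THEN conjunct1, rule_format])
  show "{f \<in> arr C. tgt C f = c} \<in> J c" by (rule D[THEN conjunct2, THEN conjunct1])
  show "S \<in> J c \<Longrightarrow> u \<in> arr C \<Longrightarrow> tgt C u = c \<Longrightarrow> pullback_sieve C u S \<in> J (src C u)"
    by (rule D[THEN conjunct2, THEN conjunct2, THEN conjunct1, rule_format])
  show "S \<in> J c \<Longrightarrow> sieve C c R \<Longrightarrow> (\<And>u. u \<in> S \<Longrightarrow> pullback_sieve C u R \<in> J (src C u)) \<Longrightarrow> R \<in> J c"
    by (rule D[THEN conjunct2, THEN conjunct2, THEN conjunct2, rule_format]) auto
qed

lemma pullback_cover: "u \<in> hom C d c \<Longrightarrow> S \<in> J c \<Longrightarrow> pullback_sieve C u S \<in> J d"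
  using topology(3)[of c S u] C.hom_obj(2)[of u d c] homD[of u C d c] by simp

lemma cover_comp:
  assumes "c \<in> obj C" "S \<in> J c" "u \<in> S" "v \<in> hom C b (src C u)"
  shows "u \<cdot>\<^bsub>C\<^esub> v \<in> S"
  using topology(1)[OF assms(1,2)] assms(3,4) by (simp add: sieve_def hom_def)

text \<open>Both sections are amalgamations of the same family, the restrictions of
  \<open>x\<close>.\<close>

lemma separated:
  assumes X: "X \<in> obj E" and c: "c \<in> obj C" and S: "S \<in> J c"
    and x: "x \<in> sec X c" and y: "y \<in> sec X c" and e: "\<And>u. u \<in> S \<Longrightarrow> act X u x = act X u y"
  shows "x = y"
proof -
  have "\<exists>!z. z \<in> sec X c \<and> (\<forall>u \<in> S. act X u z = act X u x)"
  proof (rule glue[OF X c S])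
    show "act X u x \<in> sec X d" if "u \<in> hom C d c" for d u using act_in[OF X that x] .
    show "act X (u \<cdot>\<^bsub>C\<^esub> v) x = act X v (act X u x)" if "u \<in> hom C d c" "v \<in> hom C b d" for b d u v
      using act_comp[OF X that x] .
  qed
  then obtain z where "\<And>w. w \<in> sec X c \<and> (\<forall>u \<in> S. act X u w = act X u x) \<Longrightarrow> w = z" by (elim ex1E) metis
  from this[of x] this[of y] show ?thesis using x y e by simp
qed

definition injective :: "'o \<Rightarrow> 'a \<Rightarrow> bool" where
  "injective K k \<longleftrightarrow> (\<forall>c \<in> obj C. inj_on (ev k c) (sec K c))"

text \<open>Subobjects are produced by describing their sections: \<open>realize\<close> turns the
  subsheaf into an object whose sections are in bijection \<theta> with \<open>U\<close>, and
  \<open>full\<close> turns \<theta> into an arrow.\<close>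

lemma subsheaf_represented:
  assumes X: "X \<in> obj E" and U: "subsheaf_of X U"
  obtains K k where "k \<in> hom E K X" "injective K k" "\<And>c. c \<in> obj C \<Longrightarrow> ev k c ` sec K c = U c"
proof -
  note sub = subsheaf.subset[OF U] and clos = subsheaf.closed[OF U] and local = subsheaf.local[OF U]
  have "sheaf_data C J U (act X)"
  proof (rule sheaf_data.intro)
    show "small (U c)" if "c \<in> obj C" for c using small_subset[OF sec_small[OF X that] sub[OF that]] .
    show "act X u x \<in> U d" if "u \<in> hom C d c" "x \<in> U c" for u c d x using clos that .
    show "act X (idt C c) x = x" if "c \<in> obj C" "x \<in> U c" for c x
      using act_id[OF X] sub that by blast
    show "act X (u \<cdot>\<^bsub>C\<^esub> v) x = act X v (act X u x)"
      if "u \<in> hom C d c" "v \<in> hom C b d" "x \<in> U c" for u v x b c d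
      using act_comp[OF X that(1,2)] sub[of c] C.hom_obj[OF that(1)] that(3) by blast
    fix c S y
    assume c: "c \<in> obj C" and S: "S \<in> J c"
      and y1: "\<And>d u. u \<in> S \<Longrightarrow> u \<in> hom C d c \<Longrightarrow> y u \<in> U d"
      and y2: "\<And>b d u v. u \<in> S \<Longrightarrow> u \<in> hom C d c \<Longrightarrow> v \<in> hom C b d \<Longrightarrow> y (u \<cdot>\<^bsub>C\<^esub> v) = act X v (y u)"
    have "\<exists>!x. x \<in> sec X c \<and> (\<forall>u \<in> S. act X u x = y u)"
      by (rule glue[OF X c S]) (use y1 y2 sub C.hom_obj in blast)+
    moreover have "x \<in> U c" if "x \<in> sec X c" "\<forall>u \<in> S. act X u x = y u" for x
      by (rule local[OF c S that(1)]) (use that(2) y1 cov_hom[OF c S] in auto)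
    ultimately show "\<exists>!x. x \<in> U c \<and> (\<forall>u \<in> S. act X u x = y u)"
      using sub[OF c] by (metis subsetD)
  qed
  from realize[OF this] obtain K \<theta> where K: "K \<in> obj E"
    and b: "\<And>c. c \<in> obj C \<Longrightarrow> bij_betw (\<theta> c) (sec K c) (U c)"
    and n: "\<And>c d u x. u \<in> hom C d c \<Longrightarrow> x \<in> sec K c \<Longrightarrow> \<theta> d (act K u x) = act X u (\<theta> c x)"
    by blast
  have "\<exists>k \<in> hom E K X. \<forall>c \<in> obj C. \<forall>x \<in> sec K c. ev k c x = \<theta> c x"
    by (rule full[OF K X]) (use b sub n in \<open>auto simp: bij_betw_def\<close>)
  then obtain k where k: "k \<in> hom E K X" and e: "\<And>c x. c \<in> obj C \<Longrightarrow> x \<in> sec K c \<Longrightarrow> ev k c x = \<theta> c x"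
    by blast
  have "bij_betw (ev k c) (sec K c) (U c)" if "c \<in> obj C" for c
    using b[OF that] e[OF that] bij_betw_cong by blast
  then show thesis using that[OF k] unfolding injective_def by (auto simp: bij_betw_def)
qed

text \<open>Sectionwise preimages under \<open>k\<close> are unique, and uniqueness is what makes
  them commute with restriction.\<close>

lemma factor_injective:
  assumes k: "k \<in> hom E K X" and inj: "injective K k" and f: "f \<in> hom E W X"
    and sub: "\<And>c. c \<in> obj C \<Longrightarrow> ev f c ` sec W c \<subseteq> ev k c ` sec K c"
  shows "\<exists>h \<in> hom E W K. k \<cdot> h = f"
proof -
  define t where "t c x = inv_into (sec K c) (ev k c) (ev f c x)" for c x
  have W: "W \<in> obj E" and K: "K \<in> obj E" using hom_obj f k by auto
  have t: "t c x \<in> sec K c" "ev k c (t c x) = ev f c x" if "c \<in> obj C" "x \<in> sec W c" for c x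
  proof -
    have "ev f c x \<in> ev k c ` sec K c" using sub[OF that(1)] that(2) by blast
    then show "t c x \<in> sec K c" "ev k c (t c x) = ev f c x"
      unfolding t_def by (rule inv_into_into, rule f_inv_into_f)
  qed
  have "\<exists>h \<in> hom E W K. \<forall>c \<in> obj C. \<forall>x \<in> sec W c. ev h c x = t c x"
  proof (rule full[OF W K])
    show "t c x \<in> sec K c" if "c \<in> obj C" "x \<in> sec W c" for c x using t that by blast
    fix c d u x assume u: "u \<in> hom C d c" and x: "x \<in> sec W c"
    have d: "d \<in> obj C" and c: "c \<in> obj C" using C.hom_obj[OF u] .
    have wx: "act W u x \<in> sec W d" using act_in[OF W u x] .
    have "ev k d (act K u (t c x)) = act X u (ev k c (t c x))" using ev_nat[OF k u t(1)[OF c x]] by simp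
    also have "\<dots> = ev f d (act W u x)" using t(2)[OF c x] ev_nat[OF f u x] by simp
    also have "\<dots> = ev k d (t d (act W u x))" using t(2)[OF d wx] by simp
    finally show "act K u (t c x) = t d (act W u x)"
      using inj d act_in[OF K u t(1)[OF c x]] t(1)[OF d wx] unfolding injective_def inj_on_def by blast
  qed
  then obtain h where h: "h \<in> hom E W K" "\<And>c x. c \<in> obj C \<Longrightarrow> x \<in> sec W c \<Longrightarrow> ev h c x = t c x"
    by blast
  have "k \<cdot> h = f"
    by (rule faithful[OF comp_in[OF h(1) k] f]) (simp add: ev_comp[OF h(1) k] h(2) t)
  then show ?thesis using h by blast
qed

lemma injective_mono:
  assumes k: "k \<in> hom E K X" and inj: "injective K k"
  shows "mono_arr E k"
  unfolding mono_arr_def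
proof (intro conjI allI ballI impI)
  show "k \<in> arr E" using k by (simp add: hom_def)
  fix W f g assume "f \<in> hom E W (src E k)" "g \<in> hom E W (src E k)" and e: "k \<cdot> f = k \<cdot> g"
  then have f: "f \<in> hom E W K" and g: "g \<in> hom E W K" using homD(2)[OF k] by auto
  show "f = g"
  proof (rule faithful[OF f g])
    fix c x assume c: "c \<in> obj C" and x: "x \<in> sec W c"
    have "ev k c (ev f c x) = ev k c (ev g c x)"
      using ev_comp[OF f k c x] ev_comp[OF g k c x] e by simp
    then show "ev f c x = ev g c x"
      using inj c ev_in[OF f c x] ev_in[OF g c x] unfolding injective_def inj_on_def by blast
  qed
qed

text \<open>The sections on which two arrows agree form a subsheaf because equality of sections of
  \<open>Y\<close> can be tested on a cover.\<close>

lemma equalizer_sections: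
  assumes f: "f \<in> hom E X Y" and g: "g \<in> hom E X Y"
  obtains K e where "equalizer E X f g K e" "injective K e"
    "\<And>c. c \<in> obj C \<Longrightarrow> ev e c ` sec K c = {x \<in> sec X c. ev f c x = ev g c x}"
proof -
  have X: "X \<in> obj E" and Y: "Y \<in> obj E" using hom_obj[OF f] .
  define U where "U c = {x \<in> sec X c. ev f c x = ev g c x}" for c
  have "subsheaf_of X U"
  proof (rule subsheaf.intro)
    show "U c \<subseteq> sec X c" for c by (auto simp: U_def)
    show "act X u x \<in> U d" if "u \<in> hom C d c" "x \<in> U c" for u c d x
      using that act_in[OF X that(1)] ev_nat[OF f that(1)] ev_nat[OF g that(1)]
      unfolding U_def by (metis (mono_tags, lifting) mem_Collect_eq)
    fix c S x assume c: "c \<in> obj C" and S: "S \<in> J c" and x: "x \<in> sec X c"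
      and l: "\<And>u. u \<in> S \<Longrightarrow> act X u x \<in> U (src C u)"
    have "ev f c x = ev g c x"
    proof (rule separated[OF Y c S ev_in[OF f c x] ev_in[OF g c x]])
      fix u assume "u \<in> S"
      then show "act Y u (ev f c x) = act Y u (ev g c x)"
        using l ev_nat[OF f cov_hom[OF c S] x] ev_nat[OF g cov_hom[OF c S] x] by (simp add: U_def)
    qed
    then show "x \<in> U c" using x by (simp add: U_def)
  qed
  from subsheaf_represented[OF X this]
  obtain K e where e: "e \<in> hom E K X" "injective K e" "\<And>c. c \<in> obj C \<Longrightarrow> ev e c ` sec K c = U c"
    by metis
  have "equalizer E X f g K e"
    unfolding equalizer_def
  proof (intro conjI allI ballI impI)
    show "e \<in> hom E K X" by fact
    show "f \<cdot> e = g \<cdot> e"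
    proof (rule faithful[OF comp_in[OF e(1) f] comp_in[OF e(1) g]])
      fix c x assume c: "c \<in> obj C" and x: "x \<in> sec K c"
      then have "ev e c x \<in> U c" using e(3) by blast
      then show "ev (f \<cdot> e) c x = ev (g \<cdot> e) c x"
        using ev_comp[OF e(1) f c x] ev_comp[OF e(1) g c x] by (simp add: U_def)
    qed
    fix W h assume h: "h \<in> hom E W X" and eq: "f \<cdot> h = g \<cdot> h"
    have "ev h c ` sec W c \<subseteq> ev e c ` sec K c" if c: "c \<in> obj C" for c
      unfolding e(3)[OF c] U_def
      using ev_in[OF h c] ev_comp[OF h f c] ev_comp[OF h g c] eq by auto
    then obtain k where "k \<in> hom E W K" "e \<cdot> k = h"
      using factor_injective[OF e(1,2) h] by blast
    moreover have "mono_arr E e" using injective_mono e by blast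
    ultimately show "\<exists>!k. k \<in> hom E W K \<and> e \<cdot> k = h"
      unfolding mono_arr_def homD(2)[OF e(1)] by blast
  qed
  then show thesis using that e unfolding U_def by blast
qed

text \<open>A section of the product over \<open>c\<close> is a family of sections, but a sheaf
  takes values in subsets of \<open>'u\<close>; \<open>Q\<close> therefore consists of codes under
  \<open>enc\<close>, and the rest is transport along \<open>enc\<close> and its inverse
  \<open>dec\<close>.\<close>

lemma product_sections:
  fixes X :: "'u \<Rightarrow> 'o"
  assumes S: "small S" and X: "\<And>s. s \<in> S \<Longrightarrow> X s \<in> obj E"
  obtains P \<pi> where "product_cone E S X P \<pi>"
    "\<And>c. c \<in> obj C \<Longrightarrow> bij_betw (\<lambda>t. \<lambda>s\<in>S. ev (\<pi> s) c t) (sec P c) (\<Pi>\<^sub>E s\<in>S. sec (X s) c)"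
proof -
  define B where "B c = (\<Pi>\<^sub>E s\<in>S. sec (X s) c)" for c
  have "\<exists>f :: ('u \<Rightarrow> 'u) \<Rightarrow> 'u. c \<in> obj C \<longrightarrow> inj_on f (B c) \<and> small (f ` B c)" for c
    using small_PiE_embeds[OF univ S, of "\<lambda>s. sec (X s) c"] sec_small X unfolding B_def by metis
  then obtain enc :: "'u \<Rightarrow> ('u \<Rightarrow> 'u) \<Rightarrow> 'u"
    where enc_inj: "\<And>c. c \<in> obj C \<Longrightarrow> inj_on (enc c) (B c)" and enc_small: "\<And>c. c \<in> obj C \<Longrightarrow> small (enc c ` B c)"
    by metis
  define Q where "Q c = enc c ` B c" for c
  define dec where "dec c = inv_into (B c) (enc c)" for c
  define r where "r u b = (\<lambda>s\<in>S. act (X s) u (b s))" for u and b :: "'u \<Rightarrow> 'u"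
  define a where "a u x = enc (src C u) (r u (dec (tgt C u) x))" for u x
  have dec_enc: "dec c (enc c b) = b" if "c \<in> obj C" "b \<in> B c" for c b
    unfolding dec_def using enc_inj that by (simp add: inv_into_f_f)
  have r_in: "r u b \<in> B d" if "u \<in> hom C d c" "b \<in> B c" for u c d b
    using that X act_in unfolding r_def B_def by (auto simp: PiE_def Pi_def)
  have a_enc: "a u (enc c b) = enc d (r u b)" if "u \<in> hom C d c" "b \<in> B c" for u c d b
    using that dec_enc C.hom_obj[OF that(1)] by (simp add: a_def homD)
  have r_id: "r (idt C c) b = b" if "c \<in> obj C" "b \<in> B c" for c b
    using that act_id X unfolding r_def B_def by (auto simp: PiE_def Pi_def extensional_def fun_eq_iff)
  have r_comp: "r (u \<cdot>\<^bsub>C\<^esub> v) b = r v (r u b)"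
    if "u \<in> hom C d c" "v \<in> hom C b' d" "b \<in> B c" for u v b' c d b
    using that act_comp X unfolding r_def B_def by (auto simp: PiE_def Pi_def fun_eq_iff)
  have Q: "sheaf_data C J Q a"
  proof (rule sheaf_data.intro)
    show "small (Q c)" if "c \<in> obj C" for c using enc_small that by (simp add: Q_def)
    show "a u x \<in> Q d" if "u \<in> hom C d c" "x \<in> Q c" for u c d x
      using that a_enc[OF that(1)] r_in[OF that(1)] unfolding Q_def by auto
    show "a (idt C c) x = x" if "c \<in> obj C" "x \<in> Q c" for c x
      using that a_enc[OF C.id_in] r_id unfolding Q_def by auto
    show "a (u \<cdot>\<^bsub>C\<^esub> v) x = a v (a u x)"
      if u: "u \<in> hom C d c" and v: "v \<in> hom C b d" and "x \<in> Q c" for u v x b c d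
    proof -
      obtain t where t: "t \<in> B c" "x = enc c t" using \<open>x \<in> Q c\<close> by (auto simp: Q_def)
      show ?thesis
        using a_enc[OF C.comp_in[OF v u] t(1)] a_enc[OF u t(1)] a_enc[OF v r_in[OF u t(1)]] r_comp[OF u v t(1)] t(2)
        by simp
    qed
    fix c T y
    assume c: "c \<in> obj C" and T: "T \<in> J c"
      and y1: "\<And>d u. u \<in> T \<Longrightarrow> u \<in> hom C d c \<Longrightarrow> y u \<in> Q d"
      and y2: "\<And>b d u v. u \<in> T \<Longrightarrow> u \<in> hom C d c \<Longrightarrow> v \<in> hom C b d \<Longrightarrow> y (u \<cdot>\<^bsub>C\<^esub> v) = a v (y u)"
    \<comment> \<open>The decoded family is matching in each coordinate, so it glues coordinate by
      coordinate.\<close>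
    define z where "z u = dec (src C u) (y u)" for u
    have z: "z u \<in> B d" "enc d (z u) = y u" if "u \<in> T" "u \<in> hom C d c" for u d
    proof -
      have "y u \<in> enc d ` B d" using y1[OF that] by (simp add: Q_def)
      then show "z u \<in> B d" "enc d (z u) = y u"
        unfolding z_def dec_def homD(2)[OF that(2)] by (rule inv_into_into, rule f_inv_into_f)
    qed
    have z_comp: "z (u \<cdot>\<^bsub>C\<^esub> v) = r v (z u)" if "u \<in> T" "u \<in> hom C d c" "v \<in> hom C b d" for u v b d
    proof -
      have "y (u \<cdot>\<^bsub>C\<^esub> v) = enc b (r v (z u))"
        using y2[OF that] z[OF that(1,2)] a_enc[OF that(3)] by metis
      then show ?thesis
        using dec_enc[OF _ r_in[OF that(3) z(1)[OF that(1,2)]]] C.hom_obj[OF that(3)]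
          homD(2)[OF C.comp_in[OF that(3,2)]] by (simp add: z_def)
    qed
    have ex: "\<exists>!x. x \<in> sec (X s) c \<and> (\<forall>u \<in> T. act (X s) u x = z u s)" if s: "s \<in> S" for s
    proof (rule glue[OF X[OF s] c T])
      show "z u s \<in> sec (X s) d" if "u \<in> T" "u \<in> hom C d c" for d u
        using z(1)[OF that] s by (auto simp: B_def)
      show "z (u \<cdot>\<^bsub>C\<^esub> v) s = act (X s) v (z u s)"
        if "u \<in> T" "u \<in> hom C d c" "v \<in> hom C b d" for b d u v
        using z_comp[OF that] s by (simp add: r_def)
    qed
    then obtain g where g: "\<And>s. s \<in> S \<Longrightarrow> g s \<in> sec (X s) c"
      "\<And>s u. s \<in> S \<Longrightarrow> u \<in> T \<Longrightarrow> act (X s) u (g s) = z u s" by metis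
    have gB: "restrict g S \<in> B c" using g by (auto simp: B_def)
    have rz: "r u b = z u \<longleftrightarrow> (\<forall>s \<in> S. act (X s) u (b s) = z u s)" if "u \<in> T" for u b
    proof -
      have "z u \<in> extensional S" using z(1)[OF that cov_hom[OF c T that]] by (simp add: B_def PiE_def)
      then show ?thesis by (auto simp: r_def fun_eq_iff extensional_def restrict_def)
    qed
    have key: "a u (enc c b) = y u \<longleftrightarrow> r u b = z u" if "u \<in> T" "b \<in> B c" for u b
    proof -
      have u: "u \<in> hom C (src C u) c" using cov_hom[OF c T that(1)] .
      show ?thesis
        using a_enc[OF u that(2)] z[OF that(1) u] r_in[OF u that(2)] dec_enc C.hom_obj[OF u] by metis
    qed
    show "\<exists>!x. x \<in> Q c \<and> (\<forall>u \<in> T. a u x = y u)"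
    proof (rule ex1I[of _ "enc c (restrict g S)"])
      show "enc c (restrict g S) \<in> Q c \<and> (\<forall>u \<in> T. a u (enc c (restrict g S)) = y u)"
        using gB g(2) by (auto simp: Q_def key rz)
      fix x assume x: "x \<in> Q c \<and> (\<forall>u \<in> T. a u x = y u)"
      then obtain b where b: "b \<in> B c" "x = enc c b" by (auto simp: Q_def)
      have h: "\<forall>u \<in> T. \<forall>s \<in> S. act (X s) u (b s) = z u s" using x b key rz by auto
      have "b s = g s" if s: "s \<in> S" for s
        using ex[OF s] g(1)[OF s] g(2)[OF s] h s b(1) unfolding B_def by (metis PiE_mem)
      then have "b = restrict g S"
        using b(1) gB unfolding B_def by (intro PiE_ext[OF b(1)[unfolded B_def] gB[unfolded B_def]]) simp
      then show "x = enc c (restrict g S)" using b by simp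
    qed
  qed
  from realize[OF Q] obtain P \<theta> where P: "P \<in> obj E"
    and bij: "\<And>c. c \<in> obj C \<Longrightarrow> bij_betw (\<theta> c) (sec P c) (Q c)"
    and nat: "\<And>c d u x. u \<in> hom C d c \<Longrightarrow> x \<in> sec P c \<Longrightarrow> \<theta> d (act P u x) = a u (\<theta> c x)"
    by blast
  \<comment> \<open>Decoding after \<theta> identifies the sections of \<open>P\<close> with
    families, compatibly with the restriction \<open>r\<close>; the projections will be the
    coordinates of \<psi>.\<close>
  define \<psi> where "\<psi> c x = dec c (\<theta> c x)" for c x
  have bij_dec: "bij_betw (dec c) (Q c) (B c)" if "c \<in> obj C" for c
    unfolding dec_def Q_def using bij_betw_inv_into[OF inj_on_imp_bij_betw[OF enc_inj[OF that]]] .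
  have \<psi>_bij: "bij_betw (\<psi> c) (sec P c) (B c)" if "c \<in> obj C" for c
    using bij_betw_trans[OF bij[OF that] bij_dec[OF that]] by (simp add: \<psi>_def[abs_def] comp_def)
  have \<psi>_in: "\<psi> c x \<in> B c" if "c \<in> obj C" "x \<in> sec P c" for c x
    using \<psi>_bij[OF that(1)] that(2) by (auto simp: bij_betw_def)
  have \<psi>_nat: "\<psi> d (act P u x) = r u (\<psi> c x)" if u: "u \<in> hom C d c" and x: "x \<in> sec P c" for u c d x
  proof -
    have d: "d \<in> obj C" and c: "c \<in> obj C" using C.hom_obj[OF u] .
    have "\<theta> c x = enc c (\<psi> c x)"
      using bij[OF c] x unfolding \<psi>_def dec_def Q_def
      by (metis bij_betw_imp_surj_on f_inv_into_f imageI)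
    then show ?thesis
      using nat[OF u x] a_enc[OF u \<psi>_in[OF c x]] dec_enc[OF d r_in[OF u \<psi>_in[OF c x]]]
      by (simp add: \<psi>_def)
  qed
  have "\<exists>f \<in> hom E P (X s). \<forall>c \<in> obj C. \<forall>x \<in> sec P c. ev f c x = \<psi> c x s" if s: "s \<in> S" for s
  proof (rule full[OF P X[OF s]])
    show "\<psi> c x s \<in> sec (X s) c" if "c \<in> obj C" "x \<in> sec P c" for c x
      using \<psi>_in[OF that] s by (auto simp: B_def)
    show "act (X s) u (\<psi> c x s) = \<psi> d (act P u x) s"
      if "u \<in> hom C d c" "x \<in> sec P c" for c d u x
      using \<psi>_nat[OF that] s by (simp add: r_def)
  qed
  then obtain \<pi> where \<pi>: "\<And>s. s \<in> S \<Longrightarrow> \<pi> s \<in> hom E P (X s)"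
    and \<pi>\<psi>: "\<And>s c x. s \<in> S \<Longrightarrow> c \<in> obj C \<Longrightarrow> x \<in> sec P c \<Longrightarrow> ev (\<pi> s) c x = \<psi> c x s" by metis
  have eq: "(\<lambda>s\<in>S. ev (\<pi> s) c x) = \<psi> c x" if "c \<in> obj C" "x \<in> sec P c" for c x
    using \<psi>_in[OF that] \<pi>\<psi>[OF _ that] unfolding B_def by (auto simp: fun_eq_iff restrict_def)
  have \<pi>_bij: "bij_betw (\<lambda>t. \<lambda>s\<in>S. ev (\<pi> s) c t) (sec P c) (\<Pi>\<^sub>E s\<in>S. sec (X s) c)" if "c \<in> obj C" for c
    using \<psi>_bij[OF that] eq[OF that] bij_betw_cong unfolding B_def by (metis (no_types, lifting))
  have "product_cone E S X P \<pi>"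
    unfolding product_cone_def
  proof (intro conjI allI ballI impI)
    show "P \<in> obj E" by fact
    show "\<pi> s \<in> hom E P (X s)" if "s \<in> S" for s using \<pi> that .
    fix M \<rho> assume "M \<in> obj E \<and> (\<forall>s \<in> S. \<rho> s \<in> hom E M (X s))"
    then have M: "M \<in> obj E" and \<rho>: "\<And>s. s \<in> S \<Longrightarrow> \<rho> s \<in> hom E M (X s)" by auto
    define t where "t c x = inv_into (sec P c) (\<psi> c) (\<lambda>s\<in>S. ev (\<rho> s) c x)" for c x
    have \<rho>B: "(\<lambda>s\<in>S. ev (\<rho> s) c x) \<in> B c" if "c \<in> obj C" "x \<in> sec M c" for c x
      using ev_in[OF \<rho> that] by (auto simp: B_def)
    have t: "t c x \<in> sec P c" "\<psi> c (t c x) = (\<lambda>s\<in>S. ev (\<rho> s) c x)" if "c \<in> obj C" "x \<in> sec M c" for c x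
    proof -
      have "(\<lambda>s\<in>S. ev (\<rho> s) c x) \<in> \<psi> c ` sec P c"
        using \<rho>B[OF that] \<psi>_bij[OF that(1)] by (simp add: bij_betw_def)
      then show "t c x \<in> sec P c" "\<psi> c (t c x) = (\<lambda>s\<in>S. ev (\<rho> s) c x)"
        unfolding t_def by (rule inv_into_into, rule f_inv_into_f)
    qed
    have "\<exists>h \<in> hom E M P. \<forall>c \<in> obj C. \<forall>x \<in> sec M c. ev h c x = t c x"
    proof (rule full[OF M P])
      show "t c x \<in> sec P c" if "c \<in> obj C" "x \<in> sec M c" for c x using t(1) that .
      fix c d u x assume u: "u \<in> hom C d c" and x: "x \<in> sec M c"
      have d: "d \<in> obj C" and c: "c \<in> obj C" using C.hom_obj[OF u] .
      have "\<psi> d (act P u (t c x)) = r u (\<lambda>s\<in>S. ev (\<rho> s) c x)"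
        using \<psi>_nat[OF u t(1)[OF c x]] t(2)[OF c x] by simp
      also have "\<dots> = (\<lambda>s\<in>S. ev (\<rho> s) d (act M u x))"
        using ev_nat[OF \<rho> u x] by (auto simp: r_def fun_eq_iff)
      also have "\<dots> = \<psi> d (t d (act M u x))" using t(2)[OF d act_in[OF M u x]] by simp
      finally show "act P u (t c x) = t d (act M u x)"
        using \<psi>_bij[OF d] act_in[OF P u t(1)[OF c x]] t(1)[OF d act_in[OF M u x]]
        by (auto simp: bij_betw_def inj_on_def)
    qed
    then obtain h where h: "h \<in> hom E M P" and ht: "\<And>c x. c \<in> obj C \<Longrightarrow> x \<in> sec M c \<Longrightarrow> ev h c x = t c x"
      by blast
    have iff: "\<psi> c (ev k c x) = (\<lambda>s\<in>S. ev (\<rho> s) c x)"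
      if k: "k \<in> hom E M P" "\<forall>s \<in> S. \<pi> s \<cdot> k = \<rho> s" and c: "c \<in> obj C" and x: "x \<in> sec M c" for k c x
    proof -
      have "ev (\<pi> s) c (ev k c x) = ev (\<rho> s) c x" if s: "s \<in> S" for s
        using ev_comp[OF k(1) \<pi>[OF s] c x] k(2) s by simp
      then show ?thesis using eq[OF c ev_in[OF k(1) c x], symmetric] by (simp cong: restrict_cong)
    qed
    show "\<exists>!h. h \<in> hom E M P \<and> (\<forall>s \<in> S. \<pi> s \<cdot> h = \<rho> s)"
    proof (rule ex1I[of _ h])
      have "\<pi> s \<cdot> h = \<rho> s" if s: "s \<in> S" for s
      proof (rule faithful[OF comp_in[OF h \<pi>[OF s]] \<rho>[OF s]])
        fix c x assume c: "c \<in> obj C" and x: "x \<in> sec M c"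
        show "ev (\<pi> s \<cdot> h) c x = ev (\<rho> s) c x"
          using ev_comp[OF h \<pi>[OF s] c x] ht[OF c x] \<pi>\<psi>[OF s c t(1)[OF c x]] t(2)[OF c x] s by simp
      qed
      then show "h \<in> hom E M P \<and> (\<forall>s \<in> S. \<pi> s \<cdot> h = \<rho> s)" using h by blast
      fix k assume k: "k \<in> hom E M P \<and> (\<forall>s \<in> S. \<pi> s \<cdot> k = \<rho> s)"
      show "k = h"
      proof (rule faithful)
        show "k \<in> hom E M P" "h \<in> hom E M P" using k h by auto
        fix c x assume c: "c \<in> obj C" and x: "x \<in> sec M c"
        have "\<psi> c (ev k c x) = \<psi> c (ev h c x)"
          using iff[of k, OF _ _ c x] k ht[OF c x] t(2)[OF c x] by simp
        then show "ev k c x = ev h c x"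
          using \<psi>_bij[OF c] ev_in[of k M P, OF _ c x] ev_in[OF h c x] k
          by (auto simp: bij_betw_def inj_on_def)
      qed
    qed
  qed
  then show thesis using that \<pi>_bij by blast
qed

text \<open>The mono property is applied to the kernel pair, the equalizer of the two composites
  \<open>M \<times> M \<rightarrow> X\<close>: its projections to \<open>M\<close> become equal
  after \<open>m\<close>, hence are equal, and two sections with the same image under
  \<open>ev m c\<close> form a section of it.\<close>

lemma mono_injective:
  assumes m: "m \<in> hom E M X" and mono: "mono_arr E m"
  shows "injective M m"
proof -
  have M: "M \<in> obj E" using hom_obj[OF m] by blast
  obtain a b :: 'u where ab: "a \<noteq> b" and S: "small {a, b}" by (rule two_elements[OF univ])
  from product_sections[OF S, of "\<lambda>_. M"] M obtain P \<pi> where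
    P: "product_cone E {a, b} (\<lambda>_. M) P \<pi>" and
    bij: "\<And>c. c \<in> obj C \<Longrightarrow> bij_betw (\<lambda>t. \<lambda>s\<in>{a, b}. ev (\<pi> s) c t) (sec P c) (\<Pi>\<^sub>E s\<in>{a, b}. sec M c)"
    by metis
  have \<pi>: "\<pi> a \<in> hom E P M" "\<pi> b \<in> hom E P M" using P by (auto simp: product_cone_def)
  obtain K e where K: "equalizer E P (m \<cdot> \<pi> a) (m \<cdot> \<pi> b) K e"
    and img: "\<And>c. c \<in> obj C \<Longrightarrow> ev e c ` sec K c = {x \<in> sec P c. ev (m \<cdot> \<pi> a) c x = ev (m \<cdot> \<pi> b) c x}"
    by (rule equalizer_sections[OF comp_in[OF \<pi>(1) m] comp_in[OF \<pi>(2) m]]) (rule that, assumption, simp)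
  have e: "e \<in> hom E K P" and "(m \<cdot> \<pi> a) \<cdot> e = (m \<cdot> \<pi> b) \<cdot> e" using K by (auto simp: equalizer_def)
  then have "m \<cdot> (\<pi> a \<cdot> e) = m \<cdot> (\<pi> b \<cdot> e)" using assoc[OF e \<pi>(1) m] assoc[OF e \<pi>(2) m] by simp
  then have pe: "\<pi> a \<cdot> e = \<pi> b \<cdot> e"
    using mono comp_in[OF e \<pi>(1)] comp_in[OF e \<pi>(2)] homD(2)[OF m] unfolding mono_arr_def by blast
  show ?thesis
    unfolding injective_def
  proof (intro ballI inj_onI)
    fix c x y assume c: "c \<in> obj C" and x: "x \<in> sec M c" and y: "y \<in> sec M c"
      and eq: "ev m c x = ev m c y"
    have "(\<lambda>s\<in>{a, b}. if s = a then x else y) \<in> (\<Pi>\<^sub>E s\<in>{a, b}. sec M c)" using x y by auto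
    then obtain t where t: "t \<in> sec P c"
      and tt: "(\<lambda>s\<in>{a, b}. ev (\<pi> s) c t) = (\<lambda>s\<in>{a, b}. if s = a then x else y)"
      using bij[OF c] unfolding bij_betw_def by (metis (no_types, lifting) imageE)
    have ta: "ev (\<pi> a) c t = x" and tb: "ev (\<pi> b) c t = y"
      using fun_cong[OF tt, of a] fun_cong[OF tt, of b] ab by auto
    have "t \<in> ev e c ` sec K c"
      unfolding img[OF c] using t ta tb eq ev_comp[OF \<pi>(1) m c t] ev_comp[OF \<pi>(2) m c t] by simp
    then obtain k where k: "k \<in> sec K c" "t = ev e c k" by blast
    show "x = y" using ta tb k pe ev_comp[OF e \<pi>(1) c k(1)] ev_comp[OF e \<pi>(2) c k(1)] by simp
  qed
qed

section \<open>Empty covers and initial objects\<close>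

lemma pullback_empty: "pullback_sieve C u {} = {}"
  by (simp add: pullback_sieve_def)

lemma empty_cover_unique:
  assumes "X \<in> obj E" "c \<in> obj C" "{} \<in> J c"
  shows "\<exists>!x. x \<in> sec X c"
  using glue[OF assms] by simp

text \<open>Where the empty sieve covers, every sheaf has exactly one section. Such sections lie in
  every subsheaf, so this one is the least subobject of \<open>X\<close>.\<close>

lemma subsheaf_empty_cover:
  assumes X: "X \<in> obj E"
  shows "subsheaf_of X (\<lambda>c. {x \<in> sec X c. {} \<in> J c})"
proof (rule subsheaf.intro)
  fix c S x assume c: "c \<in> obj C" and S: "S \<in> J c" and x: "x \<in> sec X c"
    and l: "\<And>u. u \<in> S \<Longrightarrow> act X u x \<in> {x \<in> sec X (src C u). {} \<in> J (src C u)}"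
  \<comment> \<open>The pullbacks of the empty sieve along \<open>S\<close> are empty and cover by
    assumption, so transitivity of the topology applies.\<close>
  have "{} \<in> J c"
    by (rule topology(4)[OF c S]) (use l in \<open>auto simp: pullback_empty sieve_def\<close>)
  then show "x \<in> {x \<in> sec X c. {} \<in> J c}" using x by simp
next
  fix c d u x assume u: "u \<in> hom C d c" and x: "x \<in> {x \<in> sec X c. {} \<in> J c}"
  show "act X u x \<in> {x \<in> sec X d. {} \<in> J d}"
    using act_in[OF X u] x pullback_cover[OF u, of "{}"] by (simp add: pullback_empty)
qed auto

text \<open>Wherever \<open>V\<close> has a section, every object has exactly one, so
  \<open>V\<close> maps to each object in exactly one way.\<close>

lemma initial_if_empty_covers:
  assumes V: "V \<in> obj E" and ec: "\<And>c x. c \<in> obj C \<Longrightarrow> x \<in> sec V c \<Longrightarrow> {} \<in> J c"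
  shows "initial E V"
  unfolding initial_def
proof (intro conjI ballI)
  show "V \<in> obj E" by fact
  fix Y assume Y: "Y \<in> obj E"
  define t where "t c (x :: 'u) = (THE y. y \<in> sec Y c)" for c x
  have t: "t c x \<in> sec Y c" if "c \<in> obj C" "x \<in> sec V c" for c x
    unfolding t_def using theI'[OF empty_cover_unique[OF Y that(1) ec[OF that]]] .
  have uniq: "y = z" if "c \<in> obj C" "x \<in> sec V c" "y \<in> sec Y c" "z \<in> sec Y c" for c x y z
    using separated[OF Y that(1) ec[OF that(1,2)] that(3,4)] by simp
  have "\<exists>f \<in> hom E V Y. \<forall>c \<in> obj C. \<forall>x \<in> sec V c. ev f c x = t c x"
  proof (rule full[OF V Y])
    show "t c x \<in> sec Y c" if "c \<in> obj C" "x \<in> sec V c" for c x using t that .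
    fix c d u x assume u: "u \<in> hom C d c" and x: "x \<in> sec V c"
    have d: "d \<in> obj C" and c: "c \<in> obj C" using C.hom_obj[OF u] .
    show "act Y u (t c x) = t d (act V u x)"
      by (rule uniq[OF d act_in[OF V u x] act_in[OF Y u t[OF c x]] t[OF d act_in[OF V u x]]])
  qed
  moreover have "f = g" if f: "f \<in> hom E V Y" and g: "g \<in> hom E V Y" for f g
    by (rule faithful[OF f g]) (blast intro: uniq ev_in[OF f] ev_in[OF g])
  ultimately show "\<exists>!f. f \<in> hom E V Y" by blast
qed

text \<open>Initiality splits the inclusion of the least subobject of \<open>Z\<close>, so
  \<open>Z\<close> has sections only where the empty sieve covers; a map to \<open>Z\<close> imposes
  the same on \<open>V\<close>.\<close>

lemma strict_initial:
  assumes Z: "initial E Z" and f: "f \<in> hom E V Z"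
  shows "initial E V"
proof -
  have Zo: "Z \<in> obj E" using Z by (simp add: initial_def)
  obtain K k where k: "k \<in> hom E K Z"
    and img: "\<And>c. c \<in> obj C \<Longrightarrow> ev k c ` sec K c = {x \<in> sec Z c. {} \<in> J c}"
    by (rule subsheaf_represented[OF Zo subsheaf_empty_cover[OF Zo]]) (rule that, assumption, simp)
  obtain h where h: "h \<in> hom E Z K" using Z hom_obj[OF k] unfolding initial_def by blast
  have kh: "k \<cdot> h = idt E Z"
    using Z Zo comp_in[OF h k] id_in[OF Zo] unfolding initial_def by blast
  show ?thesis
  proof (rule initial_if_empty_covers)
    show "V \<in> obj E" using hom_obj[OF f] by blast
    fix c x assume c: "c \<in> obj C" and x: "x \<in> sec V c"
    define z where "z = ev f c x"
    have z: "z \<in> sec Z c" unfolding z_def using ev_in[OF f c x] .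
    have "z = ev k c (ev h c z)" using ev_comp[OF h k c z] ev_id[OF Zo c z] kh by simp
    then have "z \<in> ev k c ` sec K c" using ev_in[OF h c z] by blast
    then show "{} \<in> J c" using img[OF c] by blast
  qed
qed

text \<open>Converse to \<open>subsheaf_represented\<close>: local preimages under an injective
  \<open>k\<close> are unique, hence match, and glue in \<open>K\<close>.\<close>

lemma subsheaf_image:
  assumes k: "k \<in> hom E K X" and inj: "injective K k"
  shows "subsheaf_of X (\<lambda>c. ev k c ` sec K c)"
proof (rule subsheaf.intro)
  have K: "K \<in> obj E" and X: "X \<in> obj E" using hom_obj[OF k] .
  show "ev k c ` sec K c \<subseteq> sec X c" if "c \<in> obj C" for c using ev_in[OF k that] by blast
  show "act X u x \<in> ev k d ` sec K d" if u: "u \<in> hom C d c" and "x \<in> ev k c ` sec K c" for c d u x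
    using ev_nat[OF k u] act_in[OF K u] that(2) by auto
  fix c S x assume c: "c \<in> obj C" and S: "S \<in> J c" and x: "x \<in> sec X c"
    and l: "\<And>u. u \<in> S \<Longrightarrow> act X u x \<in> ev k (src C u) ` sec K (src C u)"
  define y where "y u = inv_into (sec K (src C u)) (ev k (src C u)) (act X u x)" for u
  have y: "y u \<in> sec K (src C u)" "ev k (src C u) (y u) = act X u x" if "u \<in> S" for u
  proof -
    have "act X u x \<in> ev k (src C u) ` sec K (src C u)" using l that by blast
    then show "y u \<in> sec K (src C u)" "ev k (src C u) (y u) = act X u x"
      unfolding y_def by (rule inv_into_into, rule f_inv_into_f)
  qed
  have "\<exists>!z. z \<in> sec K c \<and> (\<forall>u \<in> S. act K u z = y u)"
  proof (rule glue[OF K c S])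
    show "y u \<in> sec K d" if "u \<in> S" "u \<in> hom C d c" for d u using y(1)[OF that(1)] homD(2)[OF that(2)] by simp
    fix b d u v assume u: "u \<in> S" "u \<in> hom C d c" and v: "v \<in> hom C b d"
    have su: "src C u = d" and sv: "src C (u \<cdot>\<^bsub>C\<^esub> v) = b" using homD(2)[OF u(2)] homD(2)[OF C.comp_in[OF v u(2)]] .
    have uv: "u \<cdot>\<^bsub>C\<^esub> v \<in> S" using cover_comp[OF c S u(1)] v su by simp
    have yu: "y u \<in> sec K d" using y(1)[OF u(1)] su by simp
    have "ev k b (y (u \<cdot>\<^bsub>C\<^esub> v)) = act X v (act X u x)" using y(2)[OF uv] sv act_comp[OF X u(2) v x] by simp
    also have "\<dots> = ev k b (act K v (y u))" using ev_nat[OF k v yu] y(2)[OF u(1)] su by simp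
    finally show "y (u \<cdot>\<^bsub>C\<^esub> v) = act K v (y u)"
      using inj C.hom_obj[OF v] y(1)[OF uv] sv act_in[OF K v yu] unfolding injective_def inj_on_def by blast
  qed
  then obtain z where z: "z \<in> sec K c" "\<And>u. u \<in> S \<Longrightarrow> act K u z = y u" by blast
  have "ev k c z = x"
  proof (rule separated[OF X c S ev_in[OF k c z(1)] x])
    fix u assume u: "u \<in> S"
    show "act X u (ev k c z) = act X u x"
      using ev_nat[OF k cov_hom[OF c S u] z(1)] z(2)[OF u] y(2)[OF u] by simp
  qed
  then show "x \<in> ev k c ` sec K c" using z by blast
qed

lemma sub_le_image:
  assumes "sub_le E k m" "k \<in> hom E K X" "m \<in> hom E M X" "c \<in> obj C"
  shows "ev k c ` sec K c \<subseteq> ev m c ` sec M c"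
proof -
  obtain h where h: "h \<in> hom E K M" and k: "k = m \<cdot> h"
    using assms(1) homD(2)[OF assms(2)] homD(2)[OF assms(3)] by (auto simp: sub_le_def)
  show ?thesis using ev_comp[OF h assms(3,4)] ev_in[OF h assms(4)] k by auto
qed

lemma sub_leI:
  assumes "k \<in> hom E K X" "m \<in> hom E M X" "injective M m"
    "\<And>c. c \<in> obj C \<Longrightarrow> ev k c ` sec K c \<subseteq> ev m c ` sec M c"
  shows "sub_le E k m"
  using factor_injective[OF assms(2,3,1,4)] homD(2)[OF assms(1)] homD(2)[OF assms(2)]
  by (auto simp: sub_le_def)

text \<open>Trivial meet says that the two images share sections only where the empty sieve covers;
  full join says that every section lies locally in one of the images. Arrows from \<open>M\<close>
  and \<open>N\<close> then glue uniquely. This passes from the order on subobjects to a universal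
  property.\<close>

lemma complements_coproduct:
  assumes m: "m \<in> hom E M X" and mm: "mono_arr E m" and n: "n \<in> hom E N X" and nm: "mono_arr E n"
    and comp: "complements E X m n"
  shows "binary_coproduct E M N X m n"
proof -
  have M: "M \<in> obj E" and X: "X \<in> obj E" and N: "N \<in> obj E" using hom_obj[OF m] hom_obj[OF n] by auto
  have mi: "injective M m" and ni: "injective N n"
    using mono_injective m mm n nm by auto
  define Im where "Im c = ev m c ` sec M c" for c
  define In where "In c = ev n c ` sec N c" for c
  have sIm: "subsheaf_of X Im" and sIn: "subsheaf_of X In"
    using subsheaf_image[OF m mi] subsheaf_image[OF n ni] by (auto simp: Im_def[abs_def] In_def[abs_def])
  note meet = comp[unfolded complements_def, THEN conjunct1, rule_format, OF _ conjI]
    and join = comp[unfolded complements_def, THEN conjunct2, rule_format, OF _ conjI]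
  have subobj: "k \<in> subobjects E X" if "k \<in> hom E K X" "injective K k" for k K
    using injective_mono[OF that] homD(3)[OF that(1)] by (simp add: subobjects_def)
  note act_Im = subsheaf.closed[OF sIm] and act_In = subsheaf.closed[OF sIn]
  have disjoint: "{} \<in> J c" if c: "c \<in> obj C" and x: "x \<in> Im c" "x \<in> In c" for c x
  proof -
    \<comment> \<open>The meet condition is tested on the intersection of the images, against the
      least subobject.\<close>
    have "subsheaf_of X (\<lambda>c. Im c \<inter> In c)"
    proof (rule subsheaf.intro)
      show "Im c \<inter> In c \<subseteq> sec X c" if "c \<in> obj C" for c using subsheaf.subset[OF sIm that] by blast
      show "act X u x \<in> Im d \<inter> In d" if "u \<in> hom C d c" "x \<in> Im c \<inter> In c" for c d u x
        using act_Im[OF that(1)] act_In[OF that(1)] that(2) by blast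
      show "x \<in> Im c \<inter> In c" if "c \<in> obj C" "S \<in> J c" "x \<in> sec X c"
        "\<And>u. u \<in> S \<Longrightarrow> act X u x \<in> Im (src C u) \<inter> In (src C u)" for c S x
        using subsheaf.local[OF sIm that(1-3)] subsheaf.local[OF sIn that(1-3)] that(4) by blast
    qed
    then obtain K k where k: "k \<in> hom E K X" "injective K k"
      and ki: "\<And>c. c \<in> obj C \<Longrightarrow> ev k c ` sec K c = Im c \<inter> In c"
      by (rule subsheaf_represented[OF X]) (rule that; assumption)
    obtain L l where l: "l \<in> hom E L X" "injective L l"
      and li: "\<And>c. c \<in> obj C \<Longrightarrow> ev l c ` sec L c = {x \<in> sec X c. {} \<in> J c}"
      by (rule subsheaf_represented[OF X subsheaf_empty_cover[OF X]]) (rule that; assumption)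
    have "sub_le E k m" "sub_le E k n"
      using sub_leI[OF k(1) m mi] sub_leI[OF k(1) n ni] ki by (auto simp: Im_def In_def)
    then have "sub_le E k l" using meet[OF subobj[OF k] _ _ subobj[OF l]] by blast
    from sub_le_image[OF this k(1) l(1) c] have "Im c \<inter> In c \<subseteq> {x \<in> sec X c. {} \<in> J c}"
      unfolding ki[OF c] li[OF c] .
    then show ?thesis using x by auto
  qed
  \<comment> \<open>The sieve of all arrows along which \<open>x\<close> restricts into one of the
    images; the join condition will show that it covers.\<close>
  define cov where "cov c x = {u \<in> arr C. tgt C u = c \<and> act X u x \<in> Im (src C u) \<union> In (src C u)}" for c x
  have covI: "u \<in> cov c x" if "u \<in> hom C d c" "act X u x \<in> Im d \<union> In d" for u c d x
    using that by (simp add: cov_def hom_def)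
  have covD: "u \<in> hom C (src C u) c" "act X u x \<in> Im (src C u) \<union> In (src C u)" if "u \<in> cov c x" for u c x
    using that by (simp_all add: cov_def hom_def)
  have cov_sieve: "sieve C c (cov c x)" if x: "x \<in> sec X c" for c x
    unfolding sieve_def
  proof (intro conjI ballI impI subsetI)
    show "u \<in> {f \<in> arr C. tgt C f = c}" if "u \<in> cov c x" for u using that by (simp add: cov_def)
    fix u v assume u: "u \<in> cov c x" and "v \<in> arr C" "tgt C v = src C u"
    then have v: "v \<in> hom C (src C v) (src C u)" by (simp add: hom_def)
    have "act X v (act X u x) \<in> Im (src C v) \<union> In (src C v)"
      using covD(2)[OF u] act_Im[OF v] act_In[OF v] by blast
    then show "u \<cdot>\<^bsub>C\<^esub> v \<in> cov c x"
      using covI[OF C.comp_in[OF v covD(1)[OF u]]] act_comp[OF X covD(1)[OF u] v x] by simp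
  qed
  have cov_pullback: "pullback_sieve C u (cov c x) = cov d (act X u x)"
    if u: "u \<in> hom C d c" and x: "x \<in> sec X c" for c d u x
  proof (rule set_eqI)
    fix v
    show "v \<in> pullback_sieve C u (cov c x) \<longleftrightarrow> v \<in> cov d (act X u x)"
    proof (cases "v \<in> hom C (src C v) d")
      case True
      then show ?thesis
        using act_comp[OF X u True x] C.comp_in[OF True u] homD[OF u]
        by (auto simp: pullback_sieve_def cov_def hom_def)
    next
      case False
      then show ?thesis using homD[OF u] by (auto simp: pullback_sieve_def cov_def hom_def)
    qed
  qed
  have cover: "cov c x \<in> J c" if c: "c \<in> obj C" and x: "x \<in> sec X c" for c x
  proof -
    \<comment> \<open>The sections that lie locally in the union of the images form a subobject
      containing both, so the join condition makes it all of \<open>X\<close>.\<close>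
    define U where "U c = {x \<in> sec X c. cov c x \<in> J c}" for c
    have "subsheaf_of X U"
    proof (rule subsheaf.intro)
      show "U c \<subseteq> sec X c" for c by (auto simp: U_def)
      show "act X u x \<in> U d" if u: "u \<in> hom C d c" and "x \<in> U c" for u c d x
        using that pullback_cover[OF u, of "cov c x"] cov_pullback[OF u] act_in[OF X u] by (simp add: U_def)
      fix c S x assume c: "c \<in> obj C" and S: "S \<in> J c" and x: "x \<in> sec X c"
        and l: "\<And>u. u \<in> S \<Longrightarrow> act X u x \<in> U (src C u)"
      have "cov c x \<in> J c"
      proof (rule topology(4)[OF c S cov_sieve[OF x]])
        fix u assume u: "u \<in> S"
        show "pullback_sieve C u (cov c x) \<in> J (src C u)"
          using cov_pullback[OF cov_hom[OF c S u] x] l u by (simp add: U_def)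
      qed
      then show "x \<in> U c" using x by (simp add: U_def)
    qed
    then obtain K k where k: "k \<in> hom E K X" "injective K k"
      and ki: "\<And>c. c \<in> obj C \<Longrightarrow> ev k c ` sec K c = U c"
      by (rule subsheaf_represented[OF X]) (rule that; assumption)
    have tot: "x \<in> U c" if c: "c \<in> obj C" and x: "x \<in> sec X c" "x \<in> Im c \<union> In c" for c x
    proof -
      have "cov c x = {f \<in> arr C. tgt C f = c}"
        using x(2) act_Im act_In by (auto simp: cov_def hom_def)
      then show ?thesis using topology(2)[OF c] x by (simp add: U_def)
    qed
    have "sub_le E m k" "sub_le E n k"
      using sub_leI[OF m k] sub_leI[OF n k] ki tot ev_in[OF m] ev_in[OF n] by (auto simp: Im_def In_def image_subset_iff)
    moreover have "idt E X \<in> subobjects E X"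
      using id_in[OF X] by (intro subobj[of _ X]) (auto simp: injective_def inj_on_def ev_id[OF X])
    ultimately have "sub_le E (idt E X) k" using join[OF subobj[OF k]] by blast
    from sub_le_image[OF this id_in[OF X] k(1) c] have "ev (idt E X) c ` sec X c \<subseteq> U c"
      unfolding ki[OF c] .
    then have "ev (idt E X) c x \<in> U c" using x by (rule subsetD[OF _ imageI])
    then show ?thesis using ev_id[OF X c x] by (simp add: U_def)
  qed
  show ?thesis
    unfolding binary_coproduct_iff
  proof (intro conjI allI ballI)
    show "m \<in> hom E M X" "n \<in> hom E N X" by fact+
    fix Y f g assume f: "f \<in> hom E M Y" and g: "g \<in> hom E N Y"
    have Y: "Y \<in> obj E" using hom_obj[OF f] by blast
    \<comment> \<open>On the overlap of the images both branches agree: there the empty sieve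
      covers, so \<open>Y\<close> has only one section.\<close>
    define t0 where "t0 c x = (if x \<in> Im c then ev f c (inv_into (sec M c) (ev m c) x)
      else ev g c (inv_into (sec N c) (ev n c) x))" for c x
    have t0m: "t0 c (ev m c w) = ev f c w" if "c \<in> obj C" "w \<in> sec M c" for c w
      using mi that by (simp add: t0_def Im_def injective_def inv_into_f_f)
    have t0n: "t0 c (ev n c w) = ev g c w" if c: "c \<in> obj C" and w: "w \<in> sec N c" for c w
    proof (cases "ev n c w \<in> Im c")
      case True
      then obtain w' where w': "w' \<in> sec M c" "ev n c w = ev m c w'" by (auto simp: Im_def)
      have "{} \<in> J c" using disjoint[OF c True] w by (simp add: In_def)
      then show ?thesis
        using separated[OF Y c _ ev_in[OF f c w'(1)] ev_in[OF g c w], of "{}"] t0m[OF c w'(1)] w'(2)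
        by simp
    next
      case False
      then show ?thesis using ni c w by (simp add: t0_def injective_def inv_into_f_f)
    qed
    have t0_in: "t0 c x \<in> sec Y c" if c: "c \<in> obj C" and x: "x \<in> Im c \<union> In c" for c x
      using x t0m[OF c] t0n[OF c] ev_in[OF f c] ev_in[OF g c] by (auto simp: Im_def In_def)
    have t0_nat: "act Y u (t0 c x) = t0 d (act X u x)"
      if u: "u \<in> hom C d c" and x: "x \<in> Im c \<union> In c" for c d u x
    proof -
      have d: "d \<in> obj C" and c: "c \<in> obj C" using C.hom_obj[OF u] .
      show ?thesis
        using x ev_nat[OF f u] ev_nat[OF g u] ev_nat[OF m u] ev_nat[OF n u]
          t0m[OF c] t0n[OF c] t0m[OF d] t0n[OF d] act_in[OF M u] act_in[OF N u]
        by (auto simp: Im_def In_def)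
    qed
    have glued: "\<exists>!y. y \<in> sec Y c \<and> (\<forall>u \<in> cov c x. act Y u y = t0 (src C u) (act X u x))"
      if c: "c \<in> obj C" and x: "x \<in> sec X c" for c x
    proof (rule glue[OF Y c cover[OF c x]])
      show "t0 (src C u) (act X u x) \<in> sec Y d" if "u \<in> cov c x" "u \<in> hom C d c" for d u
        using t0_in covD(2)[OF that(1)] C.hom_obj[OF that(2)] homD(2)[OF that(2)] by simp
      show "t0 (src C (u \<cdot>\<^bsub>C\<^esub> v)) (act X (u \<cdot>\<^bsub>C\<^esub> v) x) = act Y v (t0 (src C u) (act X u x))"
        if "u \<in> cov c x" "u \<in> hom C d c" "v \<in> hom C b d" for b d u v
        using homD(2)[OF that(2)] homD(2)[OF C.comp_in[OF that(3,2)]] act_comp[OF X that(2,3) x]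
          t0_nat[OF that(3)] covD(2)[OF that(1)] by simp
    qed
    \<comment> \<open>The value at an arbitrary section is glued from the values of
      \<open>t0\<close> along \<open>cov c x\<close>.\<close>
    define t where "t c x = (THE y. y \<in> sec Y c \<and> (\<forall>u \<in> cov c x. act Y u y = t0 (src C u) (act X u x)))" for c x
    have t: "t c x \<in> sec Y c" "\<And>u. u \<in> cov c x \<Longrightarrow> act Y u (t c x) = t0 (src C u) (act X u x)"
      if c: "c \<in> obj C" and x: "x \<in> sec X c" for c x
      using theI'[OF glued[OF c x]] by (auto simp: t_def)
    have t_eq: "y = t c x" if c: "c \<in> obj C" and x: "x \<in> sec X c" and y: "y \<in> sec Y c"
      "\<And>u. u \<in> cov c x \<Longrightarrow> act Y u y = t0 (src C u) (act X u x)" for c x y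
      by (rule separated[OF Y c cover[OF c x] y(1) t(1)[OF c x]]) (simp add: y(2) t(2)[OF c x])
    have "\<exists>h \<in> hom E X Y. \<forall>c \<in> obj C. \<forall>x \<in> sec X c. ev h c x = t c x"
    proof (rule full[OF X Y])
      show "t c x \<in> sec Y c" if "c \<in> obj C" "x \<in> sec X c" for c x using t(1)[OF that] .
      fix c d u x assume u: "u \<in> hom C d c" and x: "x \<in> sec X c"
      have d: "d \<in> obj C" and c: "c \<in> obj C" using C.hom_obj[OF u] .
      show "act Y u (t c x) = t d (act X u x)"
      proof (rule t_eq[OF d act_in[OF X u x] act_in[OF Y u t(1)[OF c x]]])
        fix v assume v: "v \<in> cov d (act X u x)"
        have vh: "v \<in> hom C (src C v) d" using covD(1)[OF v] .
        have uv: "u \<cdot>\<^bsub>C\<^esub> v \<in> cov c x"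
          using covI[OF C.comp_in[OF vh u]] covD(2)[OF v] act_comp[OF X u vh x] by simp
        show "act Y v (act Y u (t c x)) = t0 (src C v) (act X v (act X u x))"
          using t(2)[OF c x uv] act_comp[OF Y u vh t(1)[OF c x]] act_comp[OF X u vh x]
            homD(2)[OF C.comp_in[OF vh u]] by simp
      qed
    qed
    then obtain h where h: "h \<in> hom E X Y" and ht: "\<And>c x. c \<in> obj C \<Longrightarrow> x \<in> sec X c \<Longrightarrow> ev h c x = t c x"
      by blast
    have restr: "h \<cdot> l = k" if l: "l \<in> hom E L X" and k: "k \<in> hom E L Y"
      and sub: "\<And>c w. c \<in> obj C \<Longrightarrow> w \<in> sec L c \<Longrightarrow> ev l c w \<in> Im c \<union> In c"
      and t0l: "\<And>c w. c \<in> obj C \<Longrightarrow> w \<in> sec L c \<Longrightarrow> t0 c (ev l c w) = ev k c w" for L l k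
    proof (rule faithful[OF comp_in[OF l h] k])
      fix c w assume c: "c \<in> obj C" and w: "w \<in> sec L c"
      have x: "ev l c w \<in> sec X c" using ev_in[OF l c w] .
      have "ev k c w = t c (ev l c w)"
      proof (rule t_eq[OF c x ev_in[OF k c w]])
        fix u assume "u \<in> cov c (ev l c w)"
        then have u: "u \<in> hom C (src C u) c" using covD(1) by blast
        show "act Y u (ev k c w) = t0 (src C u) (act X u (ev l c w))"
          using t0_nat[OF u sub[OF c w]] t0l[OF c w] by simp
      qed
      then show "ev (h \<cdot> l) c w = ev k c w" using ev_comp[OF l h c w] ht[OF c x] by simp
    qed
    have hm: "h \<cdot> m = f" and hn: "h \<cdot> n = g"
      using restr[OF m f _ t0m] restr[OF n g _ t0n] by (auto simp: Im_def In_def)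
    show "\<exists>!h. h \<in> hom E X Y \<and> h \<cdot> m = f \<and> h \<cdot> n = g"
    proof (rule ex1I[of _ h])
      show "h \<in> hom E X Y \<and> h \<cdot> m = f \<and> h \<cdot> n = g" using h hm hn by blast
      fix k assume k: "k \<in> hom E X Y \<and> k \<cdot> m = f \<and> k \<cdot> n = g"
      then have kh: "k \<in> hom E X Y" by blast
      show "k = h"
      proof (rule faithful[OF kh h])
        fix c x assume c: "c \<in> obj C" and x: "x \<in> sec X c"
        have "ev k c x = t c x"
        proof (rule t_eq[OF c x ev_in[OF kh c x]])
          fix u assume u: "u \<in> cov c x"
          have uh: "u \<in> hom C (src C u) c" using covD(1)[OF u] .
          have d: "src C u \<in> obj C" using C.hom_obj[OF uh] by blast
          have "ev k (src C u) (act X u x) = t0 (src C u) (act X u x)"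
            using covD(2)[OF u] ev_comp[OF m kh d] ev_comp[OF n kh d] k t0m[OF d] t0n[OF d]
            by (auto simp: Im_def In_def)
          then show "act Y u (ev k c x) = t0 (src C u) (act X u x)"
            using ev_nat[OF kh uh x] by simp
        qed
        then show "ev k c x = ev h c x" using ht[OF c x] by simp
      qed
    qed
  qed
qed

end

section \<open>Left exact functors, adjunctions and sets\<close>

lemma ex1_unique: "\<exists>!x. P x \<Longrightarrow> P a \<Longrightarrow> P b \<Longrightarrow> a = b"
  by blast

text \<open>The arrows \<open>0\<close> and \<open>1\<close> are the identities, \<open>2\<close>
  and \<open>3\<close> are parallel arrows from the object \<open>0\<close> to the object
  \<open>1\<close>. With \<open>A = {0, 1}\<close> this is the discrete pair, whose limits are
  binary products; with all four arrows it is the parallel pair of an equalizer. In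
  \<open>cmp\<close>, an arrow \<open>v\<close> greater than \<open>1\<close> can only follow the
  identity \<open>0\<close>.\<close>

definition shape :: "nat set \<Rightarrow> (nat, nat) cat" where
  "shape A = \<lparr>obj = {0, 1}, arr = A, src = (\<lambda>u. if u = 1 then 1 else 0), tgt = (\<lambda>u. if u = 0 then 0 else 1),
     idt = (\<lambda>i. i), cmp = (\<lambda>v u. if v \<le> 1 then u else v)\<rparr>"

definition diagram :: "('q, 'c) cat \<Rightarrow> 'q \<Rightarrow> 'q \<Rightarrow> 'c \<Rightarrow> 'c \<Rightarrow> (nat, nat, 'q, 'c) fctr" where
  "diagram K X Y f g = \<lparr>fobj = (\<lambda>i. if i = 0 then X else Y),
     farr = (\<lambda>u. if u = 0 then idt K X else if u = 1 then idt K Y else if u = 2 then f else g)\<rparr>"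

lemma shape_sel:
  "obj (shape A) = {0, 1}" "arr (shape A) = A" "src (shape A) u = (if u = 1 then 1 else 0)"
  "tgt (shape A) u = (if u = 0 then 0 else 1)" "idt (shape A) i = i"
  "v \<cdot>\<^bsub>shape A\<^esub> u = (if v \<le> 1 then u else v)"
  by (simp_all add: shape_def)

lemma shape_hom: "u \<in> hom (shape A) i j \<longleftrightarrow> u \<in> A \<and> i = (if u = 1 then 1 else 0) \<and> j = (if u = 0 then 0 else 1)"
  by (auto simp: hom_def shape_def)

lemma shape_category:
  assumes "{0, 1} \<subseteq> A" "A \<subseteq> {0, 1, 2, 3}"
  shows "category (shape A)"
  unfolding category_def
  by (intro conjI allI ballI) (use assms in \<open>auto simp: shape_hom shape_sel\<close>)

context
  fixes C :: "('o, 'a) cat" and C' :: "('p, 'b) cat" and F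
  assumes C: "category C" and C': "category C'" and F: "is_functor C C' F" and lex: "left_exact C C' F"
begin

interpretation C: ctg C by (rule ctg.intro[OF C])
interpretation C': ctg C' by (rule ctg.intro[OF C'])

lemma left_exactD:
  fixes I :: "(nat, nat) cat"
  assumes "category I" "finite (obj I)" "finite (arr I)" "is_functor I C D" "limit_cone I C D L \<pi>"
  shows "limit_cone I C' (comp_functor F D) (fobj F L) (\<lambda>i. farr F (\<pi> i))"
  using lex[unfolded left_exact_def, rule_format, OF conjI[OF assms(1) conjI[OF assms(2) conjI[OF assms(3) conjI[OF assms(4,5)]]]]] .

lemma left_exact_terminal:
  assumes T: "terminal C T"
  shows "terminal C' (fobj F T)"
proof -
  define I :: "(nat, nat) cat" where
    "I = \<lparr>obj = {}, arr = {}, src = (\<lambda>u. 0), tgt = (\<lambda>u. 0), idt = (\<lambda>i. 0), cmp = (\<lambda>v u. 0)\<rparr>"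
  have h: "hom I i j = {}" for i j by (simp add: I_def hom_def)
  have I: "obj I = {}" "arr I = {}" by (simp_all add: I_def)
  \<comment> \<open>A terminal object is a limit of the empty diagram; without objects and arrows
    any functor and any legs will do, hence \<open>undefined\<close>.\<close>
  have "limit_cone I C' (comp_functor F undefined) (fobj F T) (\<lambda>i. farr F undefined)"
    by (rule left_exactD)
      (use T in \<open>auto simp: category_def is_functor_def h limit_cone_def cone_def terminal_def I\<close>)
  then show ?thesis by (auto simp: limit_cone_def cone_def h terminal_def I)
qed

lemma diagram_image:
  "X \<in> obj C \<Longrightarrow> Y \<in> obj C \<Longrightarrow>
    comp_functor F (diagram C X Y f g) = diagram C' (fobj F X) (fobj F Y) (farr F f) (farr F g)"
  by (auto simp: comp_functor_def diagram_def fun_eq_iff functor_id[OF F])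

lemma diagram_functor:
  assumes A: "A \<subseteq> {0, 1, 2, 3}" and X: "X \<in> obj C" and Y: "Y \<in> obj C"
    and fg: "2 \<in> A \<or> 3 \<in> A \<Longrightarrow> f \<in> hom C X Y \<and> g \<in> hom C X Y"
  shows "is_functor (shape A) C (diagram C X Y f g)"
  unfolding is_functor_def
proof (intro conjI allI ballI impI)
  show "fobj (diagram C X Y f g) i \<in> obj C" for i using X Y by (simp add: diagram_def)
  show "farr (diagram C X Y f g) (idt (shape A) i) = idt C (fobj (diagram C X Y f g) i)"
    if "i \<in> obj (shape A)" for i using that by (auto simp: diagram_def shape_sel)
  fix i j u assume u: "u \<in> hom (shape A) i j"
  then have "u \<in> {0, 1, 2, 3}" using A by (auto simp: shape_hom)
  then show d: "farr (diagram C X Y f g) u \<in> hom C (fobj (diagram C X Y f g) i) (fobj (diagram C X Y f g) j)"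
    using u fg C.id_in[OF X] C.id_in[OF Y] by (auto simp: diagram_def shape_hom)
  fix k v assume v: "v \<in> hom (shape A) j k"
  then have "v \<in> {0, 1, 2, 3}" using A by (auto simp: shape_hom)
  then show "farr (diagram C X Y f g) (v \<cdot>\<^bsub>shape A\<^esub> u) =
      farr (diagram C X Y f g) v \<cdot>\<^bsub>C\<^esub> farr (diagram C X Y f g) u"
    using u v d fg C.id_left C.id_right[of f X Y] C.id_right[of g X Y] C.id_right[OF C.id_in[OF X]]
    by (auto simp: shape_hom) (auto simp: diagram_def shape_sel)
qed

lemma left_exact_shape:
  assumes "{0, 1} \<subseteq> A" "A \<subseteq> {0, 1, 2, 3}" "X \<in> obj C" "Y \<in> obj C"
    and "2 \<in> A \<or> 3 \<in> A \<Longrightarrow> f \<in> hom C X Y \<and> g \<in> hom C X Y"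
    and "limit_cone (shape A) C (diagram C X Y f g) L \<pi>"
  shows "limit_cone (shape A) C' (diagram C' (fobj F X) (fobj F Y) (farr F f) (farr F g)) (fobj F L)
    (\<lambda>i. farr F (\<pi> i))"
proof -
  have "finite A" using assms(2) finite_subset by blast
  then show ?thesis
    using left_exactD[OF shape_category[OF assms(1,2)] _ _ diagram_functor[OF assms(2-5)] assms(6)]
      diagram_image[OF assms(3,4)] by (simp add: shape_def)
qed

end

lemma shape_cone:
  "cone (shape A) D G K \<pi> \<longleftrightarrow> K \<in> obj D \<and> \<pi> 0 \<in> hom D K (fobj G 0) \<and> \<pi> 1 \<in> hom D K (fobj G 1) \<and>
    (\<forall>u \<in> A. farr G u \<cdot>\<^bsub>D\<^esub> \<pi> (if u = 1 then 1 else 0) = \<pi> (if u = 0 then 0 else 1))"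
proof -
  have "(\<forall>i j. \<forall>u \<in> hom (shape A) i j. Q i j u) \<longleftrightarrow>
      (\<forall>u \<in> A. Q (if u = 1 then 1 else 0) (if u = 0 then 0 else 1) u)" for Q
    by (auto simp: shape_hom Ball_def simp del: split_paired_All)
  then show ?thesis unfolding cone_def by (simp add: shape_sel)
qed

context ctg
begin

text \<open>A cone over a parallel pair is determined by its leg at the source, the other leg being
  the composite of that one with \<open>f\<close>.\<close>

lemma limit_cone_equalizer:
  assumes f: "f \<in> hom E X Y" and g: "g \<in> hom E X Y"
  shows "limit_cone (shape {0, 1, 2, 3}) E (diagram E X Y f g) K \<pi> \<longleftrightarrow>
    equalizer E X f g K (\<pi> 0) \<and> \<pi> 1 = f \<cdot> \<pi> 0"
proof -
  let ?I = "shape {0, 1, 2, 3}" and ?G = "diagram E X Y f g"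
  have cone: "cone ?I E ?G L \<rho> \<longleftrightarrow>
      \<rho> 0 \<in> hom E L X \<and> f \<cdot> \<rho> 0 = g \<cdot> \<rho> 0 \<and> \<rho> 1 = f \<cdot> \<rho> 0" for L \<rho>
    unfolding shape_cone
  proof (intro iffI, goal_cases)
    case 1
    then have "\<rho> 0 \<in> hom E L X" "f \<cdot> \<rho> 0 = \<rho> 1" "g \<cdot> \<rho> 0 = \<rho> 1" by (auto simp: diagram_def)
    then show ?case by simp
  next
    case 2
    then show ?case
      using comp_in[of "\<rho> 0" L X f Y] f g id_left[of "\<rho> 0" L X] id_left[of "f \<cdot> \<rho> 0" L Y] hom_obj[of "\<rho> 0" L X]
      by (simp add: diagram_def)
  qed
  show ?thesis
  proof
    assume l: "limit_cone ?I E ?G K \<pi>"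
    then have c: "\<pi> 0 \<in> hom E K X" "f \<cdot> \<pi> 0 = g \<cdot> \<pi> 0" "\<pi> 1 = f \<cdot> \<pi> 0"
      unfolding limit_cone_def cone by blast+
    have "\<exists>!k. k \<in> hom E W K \<and> \<pi> 0 \<cdot> k = h"
      if h: "h \<in> hom E W X" "f \<cdot> h = g \<cdot> h" for W h
    proof -
      define \<rho> where "\<rho> i = (if i = (0 :: nat) then h else f \<cdot> h)" for i
      have "cone ?I E ?G W \<rho>" unfolding cone using h by (simp add: \<rho>_def)
      then have "\<exists>!k. k \<in> hom E W K \<and> (\<forall>i \<in> {0, 1}. \<pi> i \<cdot> k = \<rho> i)"
        using l unfolding limit_cone_def shape_sel(1) by blast
      moreover have "(k \<in> hom E W K \<and> (\<forall>i \<in> {0, 1}. \<pi> i \<cdot> k = \<rho> i)) \<longleftrightarrow>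
          (k \<in> hom E W K \<and> \<pi> 0 \<cdot> k = h)" for k
        using assoc[OF _ c(1) f, symmetric] c(3) by (auto simp: \<rho>_def)
      ultimately show ?thesis by simp
    qed
    then show "equalizer E X f g K (\<pi> 0) \<and> \<pi> 1 = f \<cdot> \<pi> 0"
      using c by (auto simp: equalizer_def)
  next
    assume e: "equalizer E X f g K (\<pi> 0) \<and> \<pi> 1 = f \<cdot> \<pi> 0"
    then have c: "\<pi> 0 \<in> hom E K X" by (simp add: equalizer_def)
    have "\<exists>!k. k \<in> hom E W K \<and> (\<forall>i \<in> {0, 1}. \<pi> i \<cdot> k = \<rho> i)"
      if \<rho>: "cone ?I E ?G W \<rho>" for W \<rho>
    proof -
      have "\<exists>!k. k \<in> hom E W K \<and> \<pi> 0 \<cdot> k = \<rho> 0" using e \<rho> unfolding equalizer_def cone by blast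
      moreover have "(k \<in> hom E W K \<and> (\<forall>i \<in> {0, 1}. \<pi> i \<cdot> k = \<rho> i)) \<longleftrightarrow>
          (k \<in> hom E W K \<and> \<pi> 0 \<cdot> k = \<rho> 0)" for k
        using assoc[OF _ c f, symmetric] e \<rho>[unfolded cone] by auto
      ultimately show ?thesis by simp
    qed
    moreover have "cone ?I E ?G K \<pi>"
      unfolding cone using e by (simp add: equalizer_def)
    ultimately show "limit_cone ?I E ?G K \<pi>"
      unfolding limit_cone_def shape_sel(1) by blast
  qed
qed

lemma limit_cone_product:
  assumes X: "X \<in> obj E" and Y: "Y \<in> obj E"
  shows "limit_cone (shape {0, 1}) E (diagram E X Y f g) P \<pi> \<longleftrightarrow> binary_product E X Y P (\<pi> 0) (\<pi> 1)"
proof -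
  let ?I = "shape {0, 1}" and ?G = "diagram E X Y f g"
  have cone: "cone ?I E ?G L \<rho> \<longleftrightarrow> \<rho> 0 \<in> hom E L X \<and> \<rho> 1 \<in> hom E L Y" for L \<rho>
    unfolding shape_cone
    using id_left[of "\<rho> 0" L X] id_left[of "\<rho> 1" L Y] hom_obj[of "\<rho> 0" L X] by (auto simp: diagram_def)
  show ?thesis
  proof
    assume l: "limit_cone ?I E ?G P \<pi>"
    have "\<exists>!h. h \<in> hom E M P \<and> \<pi> 0 \<cdot> h = a \<and> \<pi> 1 \<cdot> h = b"
      if "a \<in> hom E M X" "b \<in> hom E M Y" for M a b
    proof -
      define \<rho> where "\<rho> i = (if i = (0 :: nat) then a else b)" for i
      have "cone ?I E ?G M \<rho>" unfolding cone using that by (simp add: \<rho>_def)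
      then have "\<exists>!k. k \<in> hom E M P \<and> (\<forall>i \<in> {0, 1}. \<pi> i \<cdot> k = \<rho> i)"
        using l unfolding limit_cone_def shape_sel(1) by blast
      then show ?thesis by (simp add: \<rho>_def)
    qed
    then show "binary_product E X Y P (\<pi> 0) (\<pi> 1)"
      using l unfolding binary_product_def limit_cone_def cone by blast
  next
    assume "binary_product E X Y P (\<pi> 0) (\<pi> 1)"
    then show "limit_cone ?I E ?G P \<pi>"
      unfolding limit_cone_def cone shape_sel(1) binary_product_def by simp
  qed
qed

end

lemma left_exact_equalizer:
  assumes cats: "category C" "category C'" "is_functor C C' F" "left_exact C C' F"
    and f: "f \<in> hom C X Y" and g: "g \<in> hom C X Y" and e: "equalizer C X f g K e"
  shows "equalizer C' (fobj F X) (farr F f) (farr F g) (fobj F K) (farr F e)"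
proof -
  interpret ctg C by (rule ctg.intro[OF cats(1)])
  define \<pi> where "\<pi> i = (if i = (0 :: nat) then e else f \<cdot>\<^bsub>C\<^esub> e)" for i
  have "limit_cone (shape {0, 1, 2, 3}) C (diagram C X Y f g) K \<pi>"
    unfolding ctg.limit_cone_equalizer[OF ctg.intro[OF cats(1)] f g] using e by (simp add: \<pi>_def)
  then have "limit_cone (shape {0, 1, 2, 3}) C' (diagram C' (fobj F X) (fobj F Y) (farr F f) (farr F g)) (fobj F K)
    (\<lambda>i. farr F (\<pi> i))"
    by (intro left_exact_shape[OF cats]) (use hom_obj[OF f] f g in auto)
  then show ?thesis
    unfolding ctg.limit_cone_equalizer[OF ctg.intro[OF cats(2)] functor_hom[OF cats(3) f] functor_hom[OF cats(3) g]]
    by (simp add: \<pi>_def)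
qed

lemma left_exact_binary_product:
  assumes cats: "category C" "category C'" "is_functor C C' F" "left_exact C C' F"
    and P: "binary_product C X Y P p q" and X: "X \<in> obj C" and Y: "Y \<in> obj C"
  shows "binary_product C' (fobj F X) (fobj F Y) (fobj F P) (farr F p) (farr F q)"
proof -
  define \<pi> where "\<pi> i = (if i = (0 :: nat) then p else q)" for i
  have "limit_cone (shape {0, 1}) C (diagram C X Y p q) P \<pi>"
    unfolding ctg.limit_cone_product[OF ctg.intro[OF cats(1)] X Y] using P by (simp add: \<pi>_def)
  then have "limit_cone (shape {0, 1}) C' (diagram C' (fobj F X) (fobj F Y) (farr F p) (farr F q)) (fobj F P)
    (\<lambda>i. farr F (\<pi> i))"
    by (intro left_exact_shape[OF cats]) (use X Y in auto)
  then show ?thesis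
    unfolding ctg.limit_cone_product[OF ctg.intro[OF cats(2)] functor_obj[OF cats(3) X] functor_obj[OF cats(3) Y]]
    by (simp add: \<pi>_def)
qed

section \<open>Adjunctions and jointly epimorphic families\<close>

definition jointly_epi :: "('o, 'a) cat \<Rightarrow> 'i set \<Rightarrow> ('i \<Rightarrow> 'o) \<Rightarrow> 'o \<Rightarrow> ('i \<Rightarrow> 'a) \<Rightarrow> bool" where
  "jointly_epi C I M X m \<longleftrightarrow> (\<forall>i \<in> I. m i \<in> hom C (M i) X) \<and>
     (\<forall>Y. \<forall>f \<in> hom C X Y. \<forall>g \<in> hom C X Y. (\<forall>i \<in> I. f \<cdot>\<^bsub>C\<^esub> m i = g \<cdot>\<^bsub>C\<^esub> m i) \<longrightarrow> f = g)"

locale adjunction =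
  fixes C :: "('o, 'a) cat" (structure) and D :: "('p, 'b) cat" and L R
  assumes C: "category C" and D: "category D"
    and L: "is_functor C D L" and R: "is_functor D C R" and adj: "adjoint C D L R"
begin

sublocale C: ctg C by (rule ctg.intro[OF C])
sublocale D: ctg D by (rule ctg.intro[OF D])

definition natural_transpose :: "('o \<Rightarrow> 'p \<Rightarrow> 'b \<Rightarrow> 'a) \<Rightarrow> bool" where
  "natural_transpose \<phi> \<longleftrightarrow>
     (\<forall>X \<in> obj C. \<forall>Y \<in> obj D. bij_betw (\<phi> X Y) (hom D (fobj L X) Y) (hom C X (fobj R Y))) \<and>
     (\<forall>X X' Y Y'. \<forall>f \<in> hom C X' X. \<forall>g \<in> hom D Y Y'. \<forall>h \<in> hom D (fobj L X) Y.
        \<phi> X' Y' (g \<cdot>\<^bsub>D\<^esub> (h \<cdot>\<^bsub>D\<^esub> farr L f)) = farr R g \<cdot> (\<phi> X Y h \<cdot> f))"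

definition \<phi> where "\<phi> = (SOME \<phi>. natural_transpose \<phi>)"

lemma natural_transpose: "natural_transpose \<phi>"
  unfolding \<phi>_def using adj[unfolded adjoint_def, folded natural_transpose_def] by (rule someI_ex)

lemma transpose_bij: "X \<in> obj C \<Longrightarrow> Y \<in> obj D \<Longrightarrow>
    bij_betw (\<phi> X Y) (hom D (fobj L X) Y) (hom C X (fobj R Y))"
  using natural_transpose by (simp add: natural_transpose_def)

lemma transpose_in: "X \<in> obj C \<Longrightarrow> h \<in> hom D (fobj L X) Y \<Longrightarrow> \<phi> X Y h \<in> hom C X (fobj R Y)"
  using transpose_bij[of X Y] D.hom_obj(2)[of h] by (auto simp: bij_betw_def)

lemma transpose_nat:
  "f \<in> hom C X' X \<Longrightarrow> g \<in> hom D Y Y' \<Longrightarrow> h \<in> hom D (fobj L X) Y \<Longrightarrow>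
    \<phi> X' Y' (g \<cdot>\<^bsub>D\<^esub> (h \<cdot>\<^bsub>D\<^esub> farr L f)) = farr R g \<cdot> (\<phi> X Y h \<cdot> f)"
  by (rule natural_transpose[unfolded natural_transpose_def, THEN conjunct2, rule_format])

lemma transpose_nat_left:
  assumes f: "f \<in> hom C X' X" and h: "h \<in> hom D (fobj L X) Y"
  shows "\<phi> X' Y (h \<cdot>\<^bsub>D\<^esub> farr L f) = \<phi> X Y h \<cdot> f"
  using transpose_nat[OF f D.id_in h] D.id_left[OF D.comp_in[OF functor_hom[OF L f] h]] D.hom_obj[OF h]
    C.id_left[OF C.comp_in[OF f transpose_in[OF C.hom_obj(2)[OF f] h]]] functor_id[OF R] by simp

lemma transpose_nat_right:
  assumes X: "X \<in> obj C" and g: "g \<in> hom D Y Y'" and h: "h \<in> hom D (fobj L X) Y"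
  shows "\<phi> X Y' (g \<cdot>\<^bsub>D\<^esub> h) = farr R g \<cdot> \<phi> X Y h"
  using transpose_nat[OF C.id_in[OF X] g h] functor_id[OF L X] D.id_right[OF h]
    C.id_right[OF transpose_in[OF X h]] by simp

text \<open>Transposition turns composition with \<open>farr L (m i)\<close> into composition with
  \<open>m i\<close>. The lemma serves for both \<open>inv_im \<gamma>\<close> and
  \<open>inv_im p\<close>, which are left adjoints.\<close>

lemma left_adjoint_jointly_epi:
  assumes e: "jointly_epi C I M X m" and X: "X \<in> obj C"
  shows "jointly_epi D I (\<lambda>i. fobj L (M i)) (fobj L X) (\<lambda>i. farr L (m i))"
proof -
  have m: "m i \<in> hom C (M i) X" if "i \<in> I" for i using e that by (simp add: jointly_epi_def)
  have "f = g" if f: "f \<in> hom D (fobj L X) Y" and g: "g \<in> hom D (fobj L X) Y"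
    and eq: "\<forall>i \<in> I. f \<cdot>\<^bsub>D\<^esub> farr L (m i) = g \<cdot>\<^bsub>D\<^esub> farr L (m i)" for f g Y
  proof -
    have "\<forall>i \<in> I. \<phi> X Y f \<cdot> m i = \<phi> X Y g \<cdot> m i"
      using transpose_nat_left[OF m f] transpose_nat_left[OF m g] eq by metis
    then have "\<phi> X Y f = \<phi> X Y g" using e transpose_in[OF X] f g unfolding jointly_epi_def by blast
    then show ?thesis using transpose_bij[OF X D.hom_obj(2)[OF f]] f g by (auto simp: bij_betw_def inj_on_def)
  qed
  then show ?thesis using m functor_hom[OF L] unfolding jointly_epi_def by blast
qed

lemma left_adjoint_initial:
  assumes Z: "initial C Z"
  shows "initial D (fobj L Z)"
  unfolding initial_def
proof (intro conjI ballI)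
  have Zo: "Z \<in> obj C" using Z by (simp add: initial_def)
  show "fobj L Z \<in> obj D" using functor_obj[OF L Zo] .
  fix Y assume Y: "Y \<in> obj D"
  obtain h where h: "hom C Z (fobj R Y) = {h}"
    using Z functor_obj[OF R Y] unfolding initial_def by blast
  have "\<exists>k. hom D (fobj L Z) Y = {k}"
    using transpose_bij[OF Zo Y] unfolding h by (metis bij_betw_inv_into bij_betw_def image_insert image_empty)
  then show "\<exists>!f. f \<in> hom D (fobj L Z) Y" by auto
qed

definition unit where "unit X = \<phi> X (fobj L X) (idt D (fobj L X))"

lemma unit_in: "X \<in> obj C \<Longrightarrow> unit X \<in> hom C X (fobj R (fobj L X))"
  unfolding unit_def by (rule transpose_in[OF _ D.id_in[OF functor_obj[OF L]]])

lemma unit_universal: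
  assumes X: "X \<in> obj C" and Y: "Y \<in> obj D" and f: "f \<in> hom C X (fobj R Y)"
  shows "\<exists>h \<in> hom D (fobj L X) Y. f = farr R h \<cdot> unit X"
proof -
  have "f \<in> \<phi> X Y ` hom D (fobj L X) Y" using transpose_bij[OF X Y] f by (simp add: bij_betw_def)
  then obtain h where h: "h \<in> hom D (fobj L X) Y" "f = \<phi> X Y h" by blast
  have "f = farr R h \<cdot> unit X"
    using transpose_nat_right[OF X h(1) D.id_in[OF functor_obj[OF L X]]] D.id_right[OF h(1)] h(2)
    by (simp add: unit_def)
  then show ?thesis using h(1) by blast
qed

end

section \<open>Limits and covers in the category of sets\<close>

context
  assumes univ: "universe TYPE('u)"
begin

lemma small_singleton: "small {x :: 'u}"
  using small_finite[OF univ] by simp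

lemma Sets_terminal_iff: "terminal Sets (T :: 'u set) \<longleftrightarrow> (\<exists>t. T = {t})"
proof
  assume T: "terminal Sets T"
  fix x :: 'u
  have sT: "small T" using T by (simp add: terminal_def)
  have ex: "\<exists>!f. f \<in> hom Sets {undefined :: 'u} T" using T small_singleton by (simp add: terminal_def)
  then obtain f where f: "f \<in> hom Sets {undefined :: 'u} T" by blast
  have "t = app f undefined" if "t \<in> T" for t
  proof -
    have k: "({undefined}, \<lambda>x \<in> {undefined}. t, T) \<in> hom Sets {undefined :: 'u} T"
      using Sets_homI[OF small_singleton sT] that by simp
    then have "f = ({undefined}, \<lambda>x \<in> {undefined}. t, T)" using ex f by blast
    then show ?thesis by simp
  qed
  then show "\<exists>t. T = {t}" using Sets_app_in[OF f, of undefined] by blast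
next
  assume "\<exists>t. T = {t}"
  then obtain t where t: "T = {t}" by blast
  show "terminal Sets T"
    unfolding terminal_def
  proof (intro conjI ballI)
    show "T \<in> obj Sets" using t small_singleton by simp
    fix X assume "X \<in> obj (Sets :: ('u set, 'u setmap) cat)"
    then have X: "small X" by simp
    have "(X, \<lambda>x \<in> X. t, T) \<in> hom Sets X T" using X small_singleton t by (intro Sets_homI) auto
    moreover have "f = g" if "f \<in> hom Sets X T" "g \<in> hom Sets X T" for f g
      using Sets_ext[OF that] Sets_app_in[OF that(1)] Sets_app_in[OF that(2)] t by auto
    ultimately show "\<exists>!f. f \<in> hom Sets X T" by blast
  qed
qed

lemma Sets_initial: "initial Sets ({} :: 'u set)"
  unfolding initial_def
proof (intro conjI ballI)
  have s: "small ({} :: 'u set)" using small_finite[OF univ] by simp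
  then show "{} \<in> obj (Sets :: ('u set, 'u setmap) cat)" by simp
  fix X assume "X \<in> obj (Sets :: ('u set, 'u setmap) cat)"
  then have "({}, restrict undefined {}, X) \<in> hom Sets {} X" using s by (intro Sets_homI) auto
  moreover have "f = g" if "f \<in> hom Sets {} X" "g \<in> hom Sets {} X" for f g
    using Sets_ext[OF that] by simp
  ultimately show "\<exists>!f. f \<in> hom Sets {} X" by blast
qed

text \<open>If \<open>x\<close> were missed by all \<open>m i\<close>, a constant function and its
  modification at \<open>x\<close> would agree after every \<open>m i\<close>.\<close>

lemma Sets_jointly_epi:
  assumes e: "jointly_epi Sets I M (X :: 'u set) m" and X: "small X" and x: "x \<in> X"
  shows "\<exists>i \<in> I. \<exists>y \<in> M i. x = app (m i) y"
proof (rule ccontr)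
  assume no: "\<not> ?thesis"
  obtain a b :: 'u where ab: "a \<noteq> b" and sT: "small {a, b}" by (rule two_elements[OF univ])
  define f g where "f = (X, \<lambda>y \<in> X. a, {a, b})" and "g = (X, \<lambda>y \<in> X. if y = x then b else a, {a, b})"
  have f: "f \<in> hom Sets X {a, b}" and g: "g \<in> hom Sets X {a, b}"
    unfolding f_def g_def using X sT by (auto intro!: Sets_homI)
  have m: "m i \<in> hom Sets (M i) X" if "i \<in> I" for i using e that by (simp add: jointly_epi_def)
  have "f \<bullet> m i = g \<bullet> m i" if i: "i \<in> I" for i
  proof (rule Sets_ext[OF Sets_comp[OF m[OF i] f] Sets_comp[OF m[OF i] g]])
    fix y assume y: "y \<in> M i"
    then have "app (m i) y \<in> X" "app (m i) y \<noteq> x" using Sets_app_in[OF m[OF i]] no i by auto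
    then show "app (f \<bullet> m i) y = app (g \<bullet> m i) y"
      using Sets_app_comp[OF m[OF i] y] by (simp add: f_def g_def)
  qed
  then have "f = g" using e f g unfolding jointly_epi_def by blast
  then have "app f x = app g x" by simp
  then show False using x ab by (simp add: f_def g_def)
qed

lemma Sets_point: "small X \<Longrightarrow> x \<in> X \<Longrightarrow> ({s :: 'u}, \<lambda>y \<in> {s}. x, X) \<in> hom Sets {s} X"
  using Sets_homI[OF small_singleton] by simp

lemma Sets_point_comp:
  assumes r: "r \<in> hom Sets P Z" and z: "z \<in> P"
  shows "r \<bullet> ({s :: 'u}, \<lambda>y \<in> {s}. z, P) = ({s}, \<lambda>y \<in> {s}. app r z, Z)"
proof -
  have P: "small P" and Z: "small Z" using r by (auto simp: Sets_hom)
  note h = Sets_point[OF P z, of s]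
  show ?thesis
    by (rule Sets_ext[OF Sets_comp[OF h r] Sets_point[OF Z Sets_app_in[OF r z]]]) (simp add: Sets_app_comp[OF h])
qed

text \<open>The universal property is tested on a one-point set, whose maps to \<open>X\<close> are
  the elements of \<open>X\<close>.\<close>

lemma Sets_equalizer:
  assumes e: "equalizer Sets (X :: 'u set) f g K e" and f: "f \<in> hom Sets X Y" and g: "g \<in> hom Sets X Y"
  shows "inj_on (app e) K" "app e ` K = {x \<in> X. app f x = app g x}"
proof -
  have eh: "e \<in> hom Sets K X" and feq: "f \<bullet> e = g \<bullet> e"
    using e by (auto simp: equalizer_def)
  have sX: "small X" and sK: "small K" using f eh by (auto simp: Sets_hom)
  let ?pt = "\<lambda>x A. ({undefined :: 'u}, \<lambda>y \<in> {undefined :: 'u}. x :: 'u, A :: 'u set)"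
  have ex: "\<exists>!k. k \<in> hom Sets {undefined} K \<and> e \<bullet> k = ?pt x X"
    if x: "x \<in> X" "app f x = app g x" for x
  proof -
    note h = Sets_point[OF sX x(1), of undefined]
    have "f \<bullet> ?pt x X = g \<bullet> ?pt x X"
      by (rule Sets_ext[OF Sets_comp[OF h f] Sets_comp[OF h g]]) (simp add: Sets_app_comp[OF h] x)
    then show ?thesis using e h unfolding equalizer_def by blast
  qed
  have sat: "app f (app e k) = app g (app e k)" if "k \<in> K" for k
    using Sets_app_comp[OF eh that] feq by metis
  show "inj_on (app e) K"
  proof (rule inj_onI)
    fix k l assume k: "k \<in> K" and l: "l \<in> K" and kl: "app e k = app e l"
    have "?pt k K = ?pt l K"
      by (rule ex1_unique[OF ex[OF Sets_app_in[OF eh k] sat[OF k]]])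
        (use Sets_point[OF sK k] Sets_point[OF sK l] Sets_point_comp[OF eh k] Sets_point_comp[OF eh l] kl in simp_all)
    then show "k = l" by (auto simp: fun_eq_iff split: if_splits)
  qed
  show "app e ` K = {x \<in> X. app f x = app g x}"
  proof (intro equalityI subsetI)
    show "x \<in> {x \<in> X. app f x = app g x}" if "x \<in> app e ` K" for x
      using that sat Sets_app_in[OF eh] by auto
    fix x assume "x \<in> {x \<in> X. app f x = app g x}"
    then obtain k where k: "k \<in> hom Sets {undefined} K" "e \<bullet> k = ?pt x X"
      using ex by blast
    have "x = app e (app k undefined)"
      using Sets_app_comp[OF k(1), of undefined e] k(2) by simp
    then show "x \<in> app e ` K" using Sets_app_in[OF k(1), of undefined] by simp
  qed
qed

lemma Sets_binary_product:
  assumes P: "binary_product Sets (X :: 'u set) Y P p q"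
  shows "bij_betw (\<lambda>z. (app p z, app q z)) P (X \<times> Y)"
proof -
  have p: "p \<in> hom Sets P X" and q: "q \<in> hom Sets P Y" using P by (auto simp: binary_product_def)
  have s: "small X" "small Y" "small P" using p q by (auto simp: Sets_hom)
  let ?pt = "\<lambda>x A. ({undefined :: 'u}, \<lambda>y \<in> {undefined :: 'u}. x :: 'u, A :: 'u set)"
  have ex: "\<exists>!h. h \<in> hom Sets {undefined} P \<and> p \<bullet> h = ?pt x X \<and> q \<bullet> h = ?pt y Y"
    if "x \<in> X" "y \<in> Y" for x y
    using P Sets_point[OF s(1) that(1), of undefined] Sets_point[OF s(2) that(2), of undefined]
    unfolding binary_product_def by blast
  show ?thesis
    unfolding bij_betw_def
  proof (intro conjI inj_onI equalityI subsetI)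
    fix z w assume z: "z \<in> P" and w: "w \<in> P" and e: "(app p z, app q z) = (app p w, app q w)"
    have "?pt z P = ?pt w P"
      by (rule ex1_unique[OF ex[OF Sets_app_in[OF p z] Sets_app_in[OF q z]]])
        (use Sets_point[OF s(3) z] Sets_point[OF s(3) w] Sets_point_comp[OF p] Sets_point_comp[OF q] z w e in simp_all)
    then show "z = w" by (auto simp: fun_eq_iff split: if_splits)
  next
    fix w assume "w \<in> (\<lambda>z. (app p z, app q z)) ` P"
    then show "w \<in> X \<times> Y" using Sets_app_in[OF p] Sets_app_in[OF q] by auto
  next
    fix w assume "w \<in> X \<times> Y"
    then obtain x y where xy: "w = (x, y)" "x \<in> X" "y \<in> Y" by blast
    obtain h where h: "h \<in> hom Sets {undefined} P" "p \<bullet> h = ?pt x X" "q \<bullet> h = ?pt y Y"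
      using ex[OF xy(2,3)] by blast
    have "app p (app h undefined) = x" "app q (app h undefined) = y"
      using Sets_app_comp[OF h(1), of undefined p] Sets_app_comp[OF h(1), of undefined q] h(2,3) by simp_all
    then show "w \<in> (\<lambda>z. (app p z, app q z)) ` P"
      using xy(1) Sets_app_in[OF h(1), of undefined] by (auto intro!: image_eqI[of _ _ "app h undefined"])
  qed
qed

lemma Sets_points_jointly_epi:
  assumes S: "small (S :: 'u set)"
  shows "jointly_epi Sets S (\<lambda>s. {s}) S (\<lambda>s. ({s}, \<lambda>x \<in> {s}. x, S))"
  unfolding jointly_epi_def
proof (intro conjI allI ballI impI)
  show h: "({s}, \<lambda>x \<in> {s}. x, S) \<in> hom Sets {s} S" if "s \<in> S" for s
    using S that by (intro Sets_homI small_singleton) auto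
  fix Y f g assume f: "f \<in> hom Sets S Y" and g: "g \<in> hom Sets S Y"
    and e: "\<forall>s \<in> S. f \<bullet> ({s}, \<lambda>x \<in> {s}. x, S) = g \<bullet> ({s}, \<lambda>x \<in> {s}. x, S)"
  show "f = g"
  proof (rule Sets_ext[OF f g])
    fix s assume s: "s \<in> S"
    show "app f s = app g s"
      using Sets_app_comp[OF h[OF s], of s f] Sets_app_comp[OF h[OF s], of s g] e s by simp
  qed
qed

end

section \<open>Fibres of a point\<close>

context ctg
begin

lemma initial_ext: "initial E V \<Longrightarrow> f \<in> hom E V Y \<Longrightarrow> g \<in> hom E V Y \<Longrightarrow> f = g"
  using hom_obj(2)[of f] unfolding initial_def by blast

lemma terminal_ext: "terminal E T \<Longrightarrow> f \<in> hom E X T \<Longrightarrow> g \<in> hom E X T \<Longrightarrow> f = g"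
  using hom_obj(1)[of f] unfolding terminal_def by blast

lemma coproduct_map:
  assumes P: "binary_coproduct E A B P i j" and "f \<in> hom E A Y" "g \<in> hom E B Y"
  obtains h where "h \<in> hom E P Y" "h \<cdot> i = f" "h \<cdot> j = g"
  using assms unfolding binary_coproduct_iff by blast

lemma coproduct_ext:
  assumes P: "binary_coproduct E A B P i j" and "f \<in> hom E P Y" "g \<in> hom E P Y"
    and "f \<cdot> i = g \<cdot> i" "f \<cdot> j = g \<cdot> j"
  shows "f = g"
proof -
  have ij: "i \<in> hom E A P" "j \<in> hom E B P" using P by (simp_all add: binary_coproduct_iff)
  have "\<exists>!h. h \<in> hom E P Y \<and> h \<cdot> i = g \<cdot> i \<and> h \<cdot> j = g \<cdot> j"
    using P comp_in[OF ij(1) assms(3)] comp_in[OF ij(2) assms(3)] unfolding binary_coproduct_iff by blast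
  then show ?thesis by (rule ex1_unique) (use assms in auto)
qed

lemma equalizer_factor:
  assumes "equalizer E X f g K e" "h \<in> hom E W X" "f \<cdot> h = g \<cdot> h"
  obtains k where "k \<in> hom E W K" "e \<cdot> k = h"
  using assms unfolding equalizer_def by blast

lemma equalizer_mono:
  assumes e: "equalizer E X f g K e" and f: "f \<in> hom E X Y" and g: "g \<in> hom E X Y"
  shows "mono_arr E e"
proof -
  have eh: "e \<in> hom E K X" and fe: "f \<cdot> e = g \<cdot> e" using e by (auto simp: equalizer_def)
  show ?thesis
    unfolding mono_arr_def homD(2)[OF eh]
  proof (intro conjI allI ballI impI)
    show "e \<in> arr E" using eh by (simp add: hom_def)
    fix W h k assume h: "h \<in> hom E W K" and k: "k \<in> hom E W K" and eq: "e \<cdot> h = e \<cdot> k"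
    have "f \<cdot> e \<cdot> h = g \<cdot> e \<cdot> h" using assoc[OF h eh f] assoc[OF h eh g] fe by simp
    then have "\<exists>!l. l \<in> hom E W K \<and> e \<cdot> l = e \<cdot> h"
      using e comp_in[OF h eh] unfolding equalizer_def by blast
    then show "h = k" by (rule ex1_unique) (use h k eq in auto)
  qed
qed

end

locale pointed_topos =
  fixes E :: "('o, 'a) cat" (structure)
    and \<gamma> :: "('o, 'a, 'u) structure_morphism"
    and p :: "('u set, 'u setmap, 'o, 'a) geom"
  assumes univ: "universe TYPE('u)"
    and atomic: "connected_atomic_topos E \<gamma>"
    and point: "point E p"
begin

lemma over_sets: "topos_over_sets E \<gamma>"
  using atomic by (simp add: connected_atomic_topos_def connected_topos_def)

lemma grothendieck: "grothendieck_topos TYPE('u) E"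
  using over_sets by (simp add: topos_over_sets_def)

sublocale ctg E
  by unfold_locales (use grothendieck in \<open>simp add: grothendieck_topos_def\<close>)

sublocale P: adjunction E Sets "inv_im p" "dir_im p"
  by unfold_locales
    (use point category Sets_category in \<open>simp_all add: point_def geometric_morphism_def\<close>)

sublocale \<Gamma>: adjunction Sets E "inv_im \<gamma>" "dir_im \<gamma>"
  by unfold_locales
    (use over_sets category Sets_category in \<open>simp_all add: topos_over_sets_def geometric_morphism_def\<close>)

lemma p_left_exact: "left_exact E Sets (inv_im p)"
  using point by (simp add: point_def geometric_morphism_def)

lemma \<gamma>_left_exact: "left_exact Sets E (inv_im \<gamma>)"
  using over_sets by (simp add: topos_over_sets_def geometric_morphism_def)

lemma site:
  obtains C J and sec :: "'o \<Rightarrow> 'u \<Rightarrow> 'u set" and act ev where "site_rep E C J sec act ev"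
  using grothendieck_topos_site_rep[OF univ grothendieck] by metis

lemma ex_equalizer:
  assumes "f \<in> hom E X Y" "g \<in> hom E X Y"
  obtains K e where "equalizer E X f g K e"
  by (rule site, rule site_rep.equalizer_sections[OF _ assms]) (assumption, rule that)

lemma ex_product:
  fixes X :: "'u \<Rightarrow> 'o"
  assumes "small S" "\<And>s. s \<in> S \<Longrightarrow> X s \<in> obj E"
  obtains P \<pi> where "product_cone E S X P \<pi>"
  by (rule site, rule site_rep.product_sections[of E _ _ _ _ _ S X])
    (assumption, rule assms(1), rule assms(2), assumption, rule that)

lemma strict: "initial E Z \<Longrightarrow> f \<in> hom E V Z \<Longrightarrow> initial E V"
  by (rule site) (rule site_rep.strict_initial)

lemma ex_complement:
  assumes m: "m \<in> hom E M X" and mono: "mono_arr E m"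
  obtains N n where "binary_coproduct E M N X m n"
proof -
  have "m \<in> subobjects E X" using m mono by (simp add: subobjects_def hom_def)
  then obtain n where n: "n \<in> subobjects E X" and c: "complements E X m n"
    using atomic hom_obj[OF m] by (auto simp: connected_atomic_topos_def boolean_topos_def)
  have n': "n \<in> hom E (src E n) X" "mono_arr E n"
    using n by (auto simp: subobjects_def hom_def mono_arr_def)
  have "binary_coproduct E M (src E n) X m n"
    by (rule site) (rule site_rep.complements_coproduct[OF _ m mono n' c])
  then show thesis by (rule that)
qed

lemma ex_binary_product:
  assumes X: "X \<in> obj E" and Y: "Y \<in> obj E"
  obtains Q q r where "binary_product E X Y Q q r"
proof -
  obtain a b :: 'u where ab: "a \<noteq> b" and S: "small {a, b}" by (rule two_elements[OF univ])
  define Z where "Z s = (if s = a then X else Y)" for s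
  have "Z s \<in> obj E" for s using X Y by (simp add: Z_def)
  then obtain Q \<pi> where Q: "product_cone E {a, b} Z Q \<pi>"
    using ex_product[OF S, of Z] by blast
  have "binary_product E X Y Q (\<pi> a) (\<pi> b)"
    unfolding binary_product_def
  proof (intro conjI allI ballI)
    show "\<pi> a \<in> hom E Q X" "\<pi> b \<in> hom E Q Y" using Q ab by (auto simp: product_cone_def Z_def)
    fix M f g assume f: "f \<in> hom E M X" and g: "g \<in> hom E M Y"
    define \<rho> where "\<rho> s = (if s = a then f else g)" for s
    have "M \<in> obj E" "\<forall>s \<in> {a, b}. \<rho> s \<in> hom E M (Z s)"
      using hom_obj[OF f] f g ab by (auto simp: \<rho>_def Z_def)
    then have "\<exists>!h. h \<in> hom E M Q \<and> (\<forall>s \<in> {a, b}. \<pi> s \<cdot> h = \<rho> s)"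
      using Q unfolding product_cone_def by blast
    then show "\<exists>!h. h \<in> hom E M Q \<and> \<pi> a \<cdot> h = f \<and> \<pi> b \<cdot> h = g" using ab by (simp add: \<rho>_def)
  qed
  then show thesis using that by blast
qed

abbreviation fib :: "'o \<Rightarrow> 'u set" where "fib X \<equiv> fobj (inv_im p) X"

definition el :: "'a \<Rightarrow> 'u \<Rightarrow> 'u" where "el f x = app (farr (inv_im p) f) x"

lemma fib_small: "X \<in> obj E \<Longrightarrow> small (fib X)"
  using functor_obj[OF P.L] by simp

lemma el_in: "f \<in> hom E X Y \<Longrightarrow> x \<in> fib X \<Longrightarrow> el f x \<in> fib Y"
  unfolding el_def using Sets_app_in[OF functor_hom[OF P.L]] .

lemma el_comp: "f \<in> hom E X Y \<Longrightarrow> g \<in> hom E Y Z \<Longrightarrow> x \<in> fib X \<Longrightarrow> el (g \<cdot> f) x = el g (el f x)"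
  unfolding el_def using Sets_app_comp[OF functor_hom[OF P.L]] functor_comp[OF P.L] by simp

lemma el_id: "X \<in> obj E \<Longrightarrow> x \<in> fib X \<Longrightarrow> el (idt E X) x = x"
  unfolding el_def using functor_id[OF P.L] by simp

lemma fib_terminal: "terminal E T \<Longrightarrow> \<exists>t. fib T = {t}"
  using left_exact_terminal[OF category Sets_category P.L p_left_exact] Sets_terminal_iff[OF univ] by blast

lemma fib_equalizer:
  assumes "equalizer E X f g K e" "f \<in> hom E X Y" "g \<in> hom E X Y"
  shows "inj_on (el e) (fib K)" "el e ` fib K = {x \<in> fib X. el f x = el g x}"
  using Sets_equalizer[OF univ left_exact_equalizer[OF category Sets_category P.L p_left_exact assms(2,3,1)]
    functor_hom[OF P.L assms(2)] functor_hom[OF P.L assms(3)]]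
  by (simp_all add: el_def[abs_def])

lemma fib_product:
  assumes "binary_product E X Y Q q r"
  shows "bij_betw (\<lambda>z. (el q z, el r z)) (fib Q) (fib X \<times> fib Y)"
proof -
  have "X \<in> obj E" "Y \<in> obj E" using assms hom_obj by (auto simp: binary_product_def)
  from Sets_binary_product[OF univ left_exact_binary_product[OF category Sets_category P.L p_left_exact assms this]]
  show ?thesis by (simp add: el_def)
qed

lemma fib_product_eq:
  assumes "binary_product E X Y Q q r" "z \<in> fib Q" "w \<in> fib Q" "el q z = el q w" "el r z = el r w"
  shows "z = w"
  using fib_product[OF assms(1)] assms(2-) by (auto simp: bij_betw_def inj_on_def)

lemma fib_product_ex:
  assumes "binary_product E X Y Q q r" "x \<in> fib X" "y \<in> fib Y"
  shows "\<exists>z \<in> fib Q. el q z = x \<and> el r z = y"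
proof -
  have "(x, y) \<in> (\<lambda>z. (el q z, el r z)) ` fib Q"
    using fib_product[OF assms(1)] assms(2,3) by (simp add: bij_betw_def)
  then show ?thesis by auto
qed

lemma fib_initial:
  assumes "initial E V"
  shows "fib V = {}"
proof -
  have "initial Sets (fib V)" using P.left_adjoint_initial[OF assms] .
  moreover have "{} \<in> obj (Sets :: ('u set, 'u setmap) cat)" using Sets_initial[OF univ] by (simp add: initial_def)
  ultimately obtain f where "f \<in> hom Sets (fib V) {}" unfolding initial_def by blast
  from Sets_app_in[OF this] show ?thesis by auto
qed

text \<open>The left adjoint \<open>inv_im p\<close> keeps the family jointly epimorphic, which for
  sets means jointly surjective. Every later proof that elements of a fibre can be lifted goes back
  to this, directly or through finite limits.\<close>

lemma fib_jointly_epi: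
  assumes "jointly_epi E I M X m" "X \<in> obj E" "x \<in> fib X"
  shows "\<exists>i \<in> I. \<exists>y \<in> fib (M i). x = el (m i) y"
  using Sets_jointly_epi[OF univ P.left_adjoint_jointly_epi[OF assms(1,2)] fib_small[OF assms(2)] assms(3)]
  by (simp add: el_def)

section \<open>Constant objects and their fibres\<close>

abbreviation \<Delta> :: "'u set \<Rightarrow> 'o" where "\<Delta> S \<equiv> fobj (inv_im \<gamma>) S"

abbreviation \<Delta>\<^sub>m :: "'u setmap \<Rightarrow> 'a" where "\<Delta>\<^sub>m k \<equiv> farr (inv_im \<gamma>) k"

abbreviation incl :: "'u set \<Rightarrow> 'u \<Rightarrow> 'u setmap" where "incl S s \<equiv> ({s}, \<lambda>x \<in> {s}. x, S)"

abbreviation const :: "'o \<Rightarrow> 'u set \<Rightarrow> 'u \<Rightarrow> 'a" where "const X S s \<equiv> const_at E \<gamma> X S s"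

lemma \<Delta>_obj: "small S \<Longrightarrow> \<Delta> S \<in> obj E"
  using functor_obj[OF \<Gamma>.L] by simp

lemma \<Delta>_hom: "k \<in> hom Sets S T \<Longrightarrow> \<Delta>\<^sub>m k \<in> hom E (\<Delta> S) (\<Delta> T)"
  using functor_hom[OF \<Gamma>.L] .

lemma \<Delta>_singleton: "terminal E (\<Delta> {s})"
  using left_exact_terminal[OF Sets_category category \<Gamma>.L \<gamma>_left_exact] Sets_terminal_iff[OF univ] by blast

lemma \<Delta>_empty: "initial E (\<Delta> {})"
  using \<Gamma>.left_adjoint_initial[OF Sets_initial[OF univ]] .

lemma incl_in: "small S \<Longrightarrow> s \<in> S \<Longrightarrow> incl S s \<in> hom Sets {s} S"
  using Sets_homI[OF small_singleton[OF univ]] by simp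

lemma bang: "X \<in> obj E \<Longrightarrow> (THE u. u \<in> hom E X (\<Delta> {s})) \<in> hom E X (\<Delta> {s})"
  by (rule theI') (rule \<Delta>_singleton[unfolded terminal_def, THEN conjunct2, THEN bspec])

lemma const_in: "X \<in> obj E \<Longrightarrow> small S \<Longrightarrow> s \<in> S \<Longrightarrow> const X S s \<in> hom E X (\<Delta> S)"
  unfolding const_at_def using comp_in[OF bang \<Delta>_hom[OF incl_in]] .

lemma const_unique:
  assumes X: "X \<in> obj E" and u: "u \<in> hom E X (\<Delta> {s})"
  shows "const X S s = \<Delta>\<^sub>m (incl S s) \<cdot> u"
  unfolding const_at_def using terminal_ext[OF \<Delta>_singleton bang[OF X] u] by simp

lemma const_comp:
  assumes f: "f \<in> hom E W X" and S: "small S" "s \<in> S"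
  shows "const X S s \<cdot> f = const W S s"
proof -
  have W: "W \<in> obj E" and X: "X \<in> obj E" using hom_obj[OF f] .
  show ?thesis
    using const_unique[OF W comp_in[OF f bang[OF X]], of S s]
      assoc[OF f bang[OF X] \<Delta>_hom[OF incl_in[OF S]]] by (simp add: const_at_def)
qed

lemma const_map:
  assumes k: "k \<in> hom Sets S T" and X: "X \<in> obj E" and s: "s \<in> S"
  shows "\<Delta>\<^sub>m k \<cdot> const X S s = const X T (app k s)"
proof -
  have S: "small S" and T: "small T" using k by (auto simp: Sets_hom)
  define j where "j = ({s}, \<lambda>x \<in> {s}. app k s, {app k s})"
  have j: "j \<in> hom Sets {s} {app k s}"
    unfolding j_def using Sets_point[OF univ small_singleton[OF univ]] by simp
  note ks = Sets_app_in[OF k s]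
  note iS = incl_in[OF S s] and iT = incl_in[OF T ks]
  have eq: "k \<bullet> incl S s = incl T (app k s) \<bullet> j"
    by (rule Sets_ext[OF Sets_comp[OF iS k] Sets_comp[OF j iT]])
      (simp add: Sets_app_comp[OF iS] Sets_app_comp[OF j], simp add: j_def)
  have "\<Delta>\<^sub>m k \<cdot> const X S s = \<Delta>\<^sub>m (k \<bullet> incl S s) \<cdot> (THE u. u \<in> hom E X (\<Delta> {s}))"
    unfolding const_at_def functor_comp[OF \<Gamma>.L iS k] using assoc[OF bang[OF X] \<Delta>_hom[OF iS] \<Delta>_hom[OF k]] .
  also have "\<dots> = \<Delta>\<^sub>m (incl T (app k s)) \<cdot> \<Delta>\<^sub>m j \<cdot> (THE u. u \<in> hom E X (\<Delta> {s}))"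
    unfolding eq functor_comp[OF \<Gamma>.L j iT] using assoc[OF bang[OF X] \<Delta>_hom[OF j] \<Delta>_hom[OF iT]] by simp
  also have "\<dots> = const X T (app k s)"
    using const_unique[OF X comp_in[OF bang[OF X] \<Delta>_hom[OF j]]] by simp
  finally show ?thesis .
qed

lemma const_singleton: "const (\<Delta> {s}) {s} s = idt E (\<Delta> {s})"
proof -
  have o: "\<Delta> {s} \<in> obj E" using \<Delta>_obj[OF small_singleton[OF univ]] .
  show ?thesis
    by (rule terminal_ext[OF \<Delta>_singleton const_in[OF o small_singleton[OF univ]] id_in[OF o]]) simp
qed

text \<open>The element that the constant map at \<open>s\<close> picks out in the fibre of
  \<open>\<Delta> S\<close>. By \<open>\<iota>_surj\<close> and \<open>\<iota>_inj\<close> it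
  identifies this fibre with \<open>S\<close>, an elementary form of the fact that \<open>p\<close>
  followed by the structure morphism is the identity of the category of sets up to
  isomorphism.\<close>

definition \<iota> :: "'u set \<Rightarrow> 'u \<Rightarrow> 'u" where
  "\<iota> S s = el (\<Delta>\<^sub>m (incl S s)) (THE z. z \<in> fib (\<Delta> {s}))"

lemma el_const:
  assumes X: "X \<in> obj E" and x: "x \<in> fib X" and S: "small S" "s \<in> S"
  shows "el (const X S s) x = \<iota> S s"
proof -
  have b: "el (THE u. u \<in> hom E X (\<Delta> {s})) x \<in> fib (\<Delta> {s})" using el_in[OF bang[OF X] x] .
  obtain t where t: "fib (\<Delta> {s}) = {t}" using fib_terminal[OF \<Delta>_singleton] by blast
  show ?thesis
    using el_comp[OF bang[OF X] \<Delta>_hom[OF incl_in[OF S]] x] b t by (simp add: const_at_def \<iota>_def)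
qed

text \<open>The points of \<open>S\<close> are jointly epimorphic and both inverse images are left
  adjoints, so the objects \<open>\<Delta> {s}\<close> cover \<open>\<Delta> S\<close> and their
  one-element fibres cover its fibre.\<close>

lemma \<iota>_surj:
  assumes S: "small S" and z: "z \<in> fib (\<Delta> S)"
  shows "\<exists>s \<in> S. z = \<iota> S s"
proof -
  have So: "S \<in> obj Sets" using S by simp
  obtain s y where s: "s \<in> S" and y: "y \<in> fib (\<Delta> {s})" "z = el (\<Delta>\<^sub>m (incl S s)) y"
    using fib_jointly_epi[OF \<Gamma>.left_adjoint_jointly_epi[OF Sets_points_jointly_epi[OF univ S] So] \<Delta>_obj[OF S] z]
    by blast
  obtain t where t: "fib (\<Delta> {s}) = {t}" using fib_terminal[OF \<Delta>_singleton] by blast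
  have "z = \<iota> S s" using y t by (simp add: \<iota>_def)
  then show ?thesis using s by blast
qed

lemma \<iota>_map:
  assumes k: "k \<in> hom Sets S T" and s: "s \<in> S"
  shows "el (\<Delta>\<^sub>m k) (\<iota> S s) = \<iota> T (app k s)"
proof -
  have S: "small S" and T: "small T" using k by (auto simp: Sets_hom)
  have o: "\<Delta> {s} \<in> obj E" using \<Delta>_obj[OF small_singleton[OF univ]] .
  obtain t where t: "t \<in> fib (\<Delta> {s})" using fib_terminal[OF \<Delta>_singleton] by blast
  show ?thesis
    using el_comp[OF const_in[OF o S s] \<Delta>_hom[OF k] t] const_map[OF k o s]
      el_const[OF o t S s] el_const[OF o t T Sets_app_in[OF k s]] by simp
qed

text \<open>Two distinct points of \<open>S\<close> have empty equalizer, and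
  \<open>inv_im \<gamma>\<close> preserves it. Equality of the constant maps on \<open>X\<close>
  therefore gives a map from \<open>X\<close> to \<open>\<Delta> {}\<close>, which is initial, and
  initial objects are strict.\<close>

lemma const_distinct:
  assumes X: "X \<in> obj E" and S: "small S" "s \<in> S" "s' \<in> S" and ne: "s \<noteq> s'"
    and eq: "const X S s = const X S s'"
  shows "initial E X"
proof -
  define a where "a r = ({s}, \<lambda>x \<in> {s}. r, S)" for r :: 'u
  have a: "a r \<in> hom Sets {s} S" if "r \<in> S" for r
    unfolding a_def using Sets_point[OF univ S(1) that] .
  have se: "small ({} :: 'u set)" using small_finite[OF univ] by simp
  define e :: "'u setmap" where "e = ({}, restrict undefined {}, {s})"
  have e: "e \<in> hom Sets {} {s}" unfolding e_def using se small_singleton[OF univ] by (intro Sets_homI) auto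
  have "equalizer Sets {s} (a s) (a s') {} e"
    unfolding equalizer_def
  proof (intro conjI allI ballI impI)
    show "e \<in> hom Sets {} {s}" by fact
    show "a s \<bullet> e = a s' \<bullet> e"
      by (rule Sets_ext[OF Sets_comp[OF e a] Sets_comp[OF e a]]) (use S in auto)
    fix W h assume h: "h \<in> hom Sets W {s}" and he: "a s \<bullet> h = a s' \<bullet> h"
    have W: "W = {}"
    proof (rule ccontr)
      assume "W \<noteq> {}"
      then obtain w where w: "w \<in> W" by blast
      have "app (a s) (app h w) = app (a s') (app h w)"
        using Sets_app_comp[OF h w, of "a s"] Sets_app_comp[OF h w, of "a s'"] he by simp
      then show False using Sets_app_in[OF h w] ne by (simp add: a_def)
    qed
    have "\<exists>!k. k \<in> hom Sets W {}" using Sets_initial[OF univ] se W by (simp add: initial_def)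
    moreover have "e \<bullet> k = h" if "k \<in> hom Sets W {}" for k
      by (rule Sets_ext[OF Sets_comp[OF that e] h]) (use W in auto)
    ultimately show "\<exists>!k. k \<in> hom Sets W {} \<and> e \<bullet> k = h" by blast
  qed
  from left_exact_equalizer[OF Sets_category category \<Gamma>.L \<gamma>_left_exact a[OF S(2)] a[OF S(3)] this]
  have eqz: "equalizer E (\<Delta> {s}) (\<Delta>\<^sub>m (a s)) (\<Delta>\<^sub>m (a s')) (\<Delta> {}) (\<Delta>\<^sub>m e)" .
  have u: "const X {s} s \<in> hom E X (\<Delta> {s})" using const_in[OF X small_singleton[OF univ]] by simp
  have "\<Delta>\<^sub>m (a r) \<cdot> const X {s} s = const X S r" if "r \<in> S" for r
    using const_map[OF a[OF that] X, of s] by (simp add: a_def)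
  then have "\<Delta>\<^sub>m (a s) \<cdot> const X {s} s = \<Delta>\<^sub>m (a s') \<cdot> const X {s} s" using S eq by simp
  then obtain k where "k \<in> hom E X (\<Delta> {})" using eqz u unfolding equalizer_def by blast
  then show ?thesis using strict \<Delta>_empty by blast
qed

text \<open>The equalizer of the two constant maps on a terminal object is initial by
  \<open>const_distinct\<close>, so its fibre is empty; since \<open>inv_im p\<close> preserves it,
  the two maps differ at the only element of the fibre.\<close>

lemma \<iota>_inj:
  assumes S: "small S" "s \<in> S" "s' \<in> S" and eq: "\<iota> S s = \<iota> S s'"
  shows "s = s'"
proof (rule ccontr)
  assume ne: "s \<noteq> s'"
  have o: "\<Delta> {s} \<in> obj E" using \<Delta>_obj[OF small_singleton[OF univ]] .
  obtain t where t: "t \<in> fib (\<Delta> {s})" using fib_terminal[OF \<Delta>_singleton] by blast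
  note c = const_in[OF o S(1,2)] and c' = const_in[OF o S(1,3)]
  obtain K e where K: "equalizer E (\<Delta> {s}) (const (\<Delta> {s}) S s) (const (\<Delta> {s}) S s') K e"
    using ex_equalizer[OF c c'] .
  have e: "e \<in> hom E K (\<Delta> {s})" using K by (simp add: equalizer_def)
  have "const K S s = const K S s'"
    using K const_comp[OF e S(1,2)] const_comp[OF e S(1,3)] by (simp add: equalizer_def)
  then have "initial E K" using const_distinct[OF _ S ne] hom_obj[OF e] by blast
  then have "fib K = {}" by (rule fib_initial)
  then show False
    using fib_equalizer(2)[OF K c c'] t el_const[OF o t S(1,2)] el_const[OF o t S(1,3)] eq by auto
qed

text \<open>Connectedness enters here: a complemented subobject of the terminal object is classified by a
  map to \<open>\<Delta>\<close> of a two-element set, which comes from a point of that set since \<open>\<gamma>\<^sup>*\<close> is full;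
  hence the subobject is trivial.\<close>

lemma initial_if_fib_empty:
  assumes X: "X \<in> obj E" and empty: "fib X = {}"
  shows "initial E X"
proof (rule ccontr)
  assume ni: "\<not> initial E X"
  obtain a b :: 'u where ab: "a \<noteq> b" and S: "small {a, b}" by (rule two_elements[OF univ])
  define T where "T = \<Delta> {a}"
  have s1: "small {a}" using small_singleton[OF univ] .
  have T: "T \<in> obj E" and tT: "terminal E T" unfolding T_def using \<Delta>_obj[OF s1] \<Delta>_singleton by auto
  have idc: "const T {a} a = idt E T" unfolding T_def using const_singleton .
  obtain t where t: "t \<in> hom E X T" using tT X unfolding terminal_def by blast
  \<comment> \<open>A noninitial \<open>X\<close> makes its map \<open>t\<close> to the terminal
    object epi. The equalizer \<open>K\<close> of two maps that agree after \<open>t\<close>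
    receives a map from \<open>X\<close>, so by strictness it is not initial; it remains to see that
    its complement \<open>N\<close> is.\<close>
  have epi: "f = g" if f: "f \<in> hom E T Y" and g: "g \<in> hom E T Y" and eq: "f \<cdot> t = g \<cdot> t" for f g Y
  proof -
    obtain K e where K: "equalizer E T f g K e" using ex_equalizer[OF f g] .
    have e: "e \<in> hom E K T" and fe: "f \<cdot> e = g \<cdot> e" using K by (auto simp: equalizer_def)
    obtain h where h: "h \<in> hom E X K" using equalizer_factor[OF K t eq] .
    obtain N n where N: "binary_coproduct E K N T e n"
      using ex_complement[OF e equalizer_mono[OF K f g]] .
    have n: "n \<in> hom E N T" using N by (simp add: binary_coproduct_iff)
    have Ko: "K \<in> obj E" and No: "N \<in> obj E" using hom_obj[OF e] hom_obj[OF n] by auto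
    obtain \<chi> where \<chi>: "\<chi> \<in> hom E T (\<Delta> {a, b})"
      and \<chi>e: "\<chi> \<cdot> e = const K {a, b} a" and \<chi>n: "\<chi> \<cdot> n = const N {a, b} b"
      using coproduct_map[OF N const_in[OF Ko S, of a] const_in[OF No S, of b]] by auto
    have "\<chi> \<in> \<Delta>\<^sub>m ` hom Sets {a} {a, b}"
      using atomic \<chi> s1 S
      by (simp add: T_def connected_atomic_topos_def connected_topos_def full_faithful_def bij_betw_def)
    then obtain k where k: "k \<in> hom Sets {a} {a, b}" "\<chi> = \<Delta>\<^sub>m k" by blast
    define v where "v = app k a"
    have v: "v = a \<or> v = b" using Sets_app_in[OF k(1), of a] by (simp add: v_def)
    have "\<chi> = const T {a, b} v"
      using const_map[OF k(1) T, of a] id_right[OF \<chi>] k(2) idc by (simp add: v_def)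
    then have ce: "const K {a, b} v = const K {a, b} a" and cn: "const N {a, b} v = const N {a, b} b"
      using \<chi>e \<chi>n const_comp[OF e S, of v] const_comp[OF n S, of v] v by auto
    have "v \<noteq> b"
    proof
      assume "v = b"
      then have "initial E K" using const_distinct[OF Ko S, of b a] ce ab by simp
      then show False using strict[OF _ h] ni by blast
    qed
    then have "v = a" using v by blast
    then have Ni: "initial E N" using const_distinct[OF No S, of a b] cn ab by simp
    have "f \<cdot> n = g \<cdot> n" using initial_ext[OF Ni comp_in[OF n f] comp_in[OF n g]] .
    then show "f = g" using coproduct_ext[OF N f g fe _] by blast
  qed
  have "jointly_epi E {()} (\<lambda>_. X) T (\<lambda>_. t)" using t epi by (auto simp: jointly_epi_def)
  moreover obtain z where "z \<in> fib T" using fib_terminal[OF tT] by blast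
  ultimately show False using fib_jointly_epi[OF _ T] empty by blast
qed

text \<open>The injections are jointly epimorphic, which gives the union. For disjointness, \<chi>
  labels the two summands by \<open>a\<close> and \<open>b\<close>, and the labels stay distinct in
  the fibre by \<open>\<iota>_inj\<close>.\<close>

lemma coproduct_fib:
  assumes P: "binary_coproduct E A B P i j"
  shows "fib P = el i ` fib A \<union> el j ` fib B" "el i ` fib A \<inter> el j ` fib B = {}"
proof -
  have i: "i \<in> hom E A P" and j: "j \<in> hom E B P" using P by (simp_all add: binary_coproduct_iff)
  have A: "A \<in> obj E" and B: "B \<in> obj E" and Po: "P \<in> obj E" using hom_obj[OF i] hom_obj[OF j] by auto
  have "jointly_epi E (UNIV :: bool set) (\<lambda>x. if x then A else B) P (\<lambda>x. if x then i else j)"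
    using i j coproduct_ext[OF P _ _ _ _] by (auto simp: jointly_epi_def UNIV_bool)
  from fib_jointly_epi[OF this Po]
  have "fib P \<subseteq> el i ` fib A \<union> el j ` fib B" by (fastforce simp: UNIV_bool)
  then show "fib P = el i ` fib A \<union> el j ` fib B" using el_in[OF i] el_in[OF j] by blast
  obtain a b :: 'u where ab: "a \<noteq> b" and S: "small {a, b}" by (rule two_elements[OF univ])
  obtain \<chi> where \<chi>: "\<chi> \<in> hom E P (\<Delta> {a, b})"
    and \<chi>i: "\<chi> \<cdot> i = const A {a, b} a" and \<chi>j: "\<chi> \<cdot> j = const B {a, b} b"
    using coproduct_map[OF P const_in[OF A S, of a] const_in[OF B S, of b]] by auto
  have "el \<chi> (el i x) = \<iota> {a, b} a" if "x \<in> fib A" for x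
    using el_comp[OF i \<chi> that] \<chi>i el_const[OF A that S] by simp
  moreover have "el \<chi> (el j x) = \<iota> {a, b} b" if "x \<in> fib B" for x
    using el_comp[OF j \<chi> that] \<chi>j el_const[OF B that S] by simp
  moreover have "\<iota> {a, b} a \<noteq> \<iota> {a, b} b" using \<iota>_inj[OF S, of a b] ab by blast
  ultimately show "el i ` fib A \<inter> el j ` fib B = {}" by fastforce
qed

text \<open>If \<open>f\<close> and \<open>g\<close> agree on the fibre, the complement of their
  equalizer has empty fibre, so it is initial.\<close>

lemma el_faithful:
  assumes f: "f \<in> hom E X Y" and g: "g \<in> hom E X Y" and eq: "\<And>x. x \<in> fib X \<Longrightarrow> el f x = el g x"
  shows "f = g"
proof -
  obtain K e where K: "equalizer E X f g K e" using ex_equalizer[OF f g] .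
  have fe: "f \<cdot> e = g \<cdot> e" and e: "e \<in> hom E K X" using K by (auto simp: equalizer_def)
  obtain N n where N: "binary_coproduct E K N X e n"
    using ex_complement[OF e equalizer_mono[OF K f g]] .
  have n: "n \<in> hom E N X" using N by (simp add: binary_coproduct_iff)
  have "el e ` fib K = fib X" using fib_equalizer(2)[OF K f g] eq by auto
  then have "fib N = {}" using coproduct_fib[OF N] by auto
  then have "initial E N" using initial_if_fib_empty hom_obj[OF n] by blast
  then have "f \<cdot> n = g \<cdot> n" by (rule initial_ext[OF _ comp_in[OF n f] comp_in[OF n g]])
  then show ?thesis using coproduct_ext[OF N f g fe _] by blast
qed

text \<open>Injectivity on the fibre makes \<open>f\<close> mono by \<open>el_faithful\<close>, and
  surjectivity empties the fibre of its complement. So \<open>Y\<close> is the coproduct of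
  \<open>X\<close> with an initial object, and extending the identity of \<open>X\<close> to
  \<open>Y\<close> inverts \<open>f\<close>.\<close>

lemma el_bij_iso:
  assumes f: "f \<in> hom E X Y" and inj: "inj_on (el f) (fib X)" and surj: "el f ` fib X = fib Y"
  shows "iso E f"
proof -
  have X: "X \<in> obj E" and Y: "Y \<in> obj E" using hom_obj[OF f] .
  have "mono_arr E f"
    unfolding mono_arr_def homD(2)[OF f]
  proof (intro conjI allI ballI impI)
    show "f \<in> arr E" using f by (simp add: hom_def)
    fix W g h assume g: "g \<in> hom E W X" and h: "h \<in> hom E W X" and eq: "f \<cdot> g = f \<cdot> h"
    show "g = h"
    proof (rule el_faithful[OF g h])
      fix x assume x: "x \<in> fib W"
      have "el f (el g x) = el f (el h x)" using el_comp[OF g f x] el_comp[OF h f x] eq by simp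
      then show "el g x = el h x" using inj el_in[OF g x] el_in[OF h x] by (auto simp: inj_on_def)
    qed
  qed
  then obtain N n where N: "binary_coproduct E X N Y f n" using ex_complement[OF f] by blast
  have n: "n \<in> hom E N Y" using N by (simp add: binary_coproduct_iff)
  have "fib N = {}" using coproduct_fib[OF N] surj by auto
  then have Ni: "initial E N" using initial_if_fib_empty hom_obj[OF n] by blast
  obtain k where k: "k \<in> hom E N X" using Ni X unfolding initial_def by blast
  obtain r where r: "r \<in> hom E Y X" "r \<cdot> f = idt E X" using coproduct_map[OF N id_in[OF X] k] by blast
  have "f \<cdot> r = idt E Y"
  proof (rule coproduct_ext[OF N comp_in[OF r(1) f] id_in[OF Y] _ _])
    show "(f \<cdot> r) \<cdot> f = idt E Y \<cdot> f" using assoc[OF f r(1) f] r(2) id_right[OF f] id_left[OF f] by simp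
    show "(f \<cdot> r) \<cdot> n = idt E Y \<cdot> n"
      using initial_ext[OF Ni comp_in[OF n comp_in[OF r(1) f]] comp_in[OF n id_in[OF Y]]] .
  qed
  then show ?thesis using isoI[OF f r(1,2)] by blast
qed

section \<open>Atoms and components\<close>

definition atom :: "'o \<Rightarrow> bool" where
  "atom A \<longleftrightarrow> A \<in> obj E \<and> fib A \<noteq> {} \<and>
     (\<forall>M. \<forall>m \<in> hom E M A. mono_arr E m \<longrightarrow> fib M = {} \<or> el m ` fib M = fib A)"

text \<open>The equalizer is a subobject whose fibre contains \<open>t\<close>, so its fibre is
  everything.\<close>

lemma atom_eq:
  assumes A: "atom A" and f: "f \<in> hom E A Y" and g: "g \<in> hom E A Y"
    and t: "t \<in> fib A" and eq: "el f t = el g t"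
  shows "f = g"
proof -
  obtain K e where K: "equalizer E A f g K e" using ex_equalizer[OF f g] .
  have e: "e \<in> hom E K A" using K by (simp add: equalizer_def)
  have img: "el e ` fib K = {x \<in> fib A. el f x = el g x}" using fib_equalizer(2)[OF K f g] .
  then have "fib K \<noteq> {}" using t eq by auto
  then have "el e ` fib K = fib A"
    using A e equalizer_mono[OF K f g] by (auto simp: atom_def)
  then show ?thesis using el_faithful[OF f g] img by blast
qed

text \<open>By \<open>atom_eq\<close> such an \<open>h\<close> is an epimorphism: two maps that
  agree after \<open>h\<close> agree at an element of \<open>fib A\<close>. Epimorphisms are
  surjective on fibres.\<close>

lemma atom_surj:
  assumes A: "atom A" and h: "h \<in> hom E X A" and ne: "fib X \<noteq> {}" and y: "y \<in> fib A"
  shows "\<exists>x \<in> fib X. y = el h x"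
proof -
  have Ao: "A \<in> obj E" using hom_obj[OF h] by blast
  obtain x where x: "x \<in> fib X" using ne by blast
  have "f = g" if f: "f \<in> hom E A Y" and g: "g \<in> hom E A Y" and "f \<cdot> h = g \<cdot> h" for f g Y
    by (rule atom_eq[OF A f g el_in[OF h x]]) (use el_comp[OF h f x] el_comp[OF h g x] that in simp)
  then have "jointly_epi E {()} (\<lambda>_. X) A (\<lambda>_. h)" using h by (auto simp: jointly_epi_def)
  from fib_jointly_epi[OF this Ao y] show ?thesis by simp
qed

text \<open>Two summands with nonempty fibres would each fill the fibre of \<open>A\<close> by
  \<open>atom_surj\<close>, against disjointness. Together with \<open>connected_atom\<close> this
  identifies atoms with the connected objects that are not initial.\<close>

lemma atom_connected:
  assumes A: "atom A"
  shows "connected_object E A" "\<not> initial E A"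
proof -
  show "\<not> initial E A" using A fib_initial by (auto simp: atom_def)
  have Ao: "A \<in> obj E" using A by (simp add: atom_def)
  show "connected_object E A"
    unfolding connected_object_def
  proof (intro conjI allI impI)
    show "A \<in> obj E" by fact
    fix B C i j assume P: "binary_coproduct E B C A i j"
    have i: "i \<in> hom E B A" and j: "j \<in> hom E C A" using P by (simp_all add: binary_coproduct_iff)
    have B: "B \<in> obj E" and C: "C \<in> obj E" using hom_obj[OF i] hom_obj[OF j] by auto
    have "fib B = {} \<or> fib C = {}"
    proof (rule ccontr)
      assume "\<not> ?thesis"
      then have "fib B \<noteq> {}" "fib C \<noteq> {}" by auto
      then have "fib A \<subseteq> el i ` fib B" "fib A \<subseteq> el j ` fib C"
        using atom_surj[OF A i] atom_surj[OF A j] by blast+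
      then show False using coproduct_fib(2)[OF P] A by (auto simp: atom_def)
    qed
    then show "initial E B \<or> initial E C" using initial_if_fib_empty B C by blast
  qed
qed

lemma connected_atom:
  assumes A: "connected_object E A" and ni: "\<not> initial E A"
  shows "atom A"
  unfolding atom_def
proof (intro conjI allI ballI impI)
  show Ao: "A \<in> obj E" using A by (simp add: connected_object_def)
  show "fib A \<noteq> {}" using initial_if_fib_empty[OF Ao] ni by blast
  fix M m assume m: "m \<in> hom E M A" and mono: "mono_arr E m"
  obtain N n where N: "binary_coproduct E M N A m n" using ex_complement[OF m mono] .
  then have "initial E M \<or> initial E N" using A unfolding connected_object_def by blast
  then show "fib M = {} \<or> el m ` fib M = fib A"
    using fib_initial coproduct_fib(1)[OF N] by auto
qed

text \<open>The copairing of the constant maps on \<open>M\<close> and on its complement is a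
  characteristic map with values in a constant object.\<close>

lemma classify:
  assumes m: "m \<in> hom E M X" and mono: "mono_arr E m" and ab: "a \<noteq> b"
  obtains \<chi> where "\<chi> \<in> hom E X (\<Delta> {a, b})"
    "\<And>x. x \<in> fib X \<Longrightarrow> el \<chi> x = \<iota> {a, b} (if x \<in> el m ` fib M then a else b)"
proof -
  have S: "small {a, b}" using small_finite[OF univ] by simp
  obtain N n where N: "binary_coproduct E M N X m n" using ex_complement[OF m mono] .
  have n: "n \<in> hom E N X" using N by (simp add: binary_coproduct_iff)
  have M: "M \<in> obj E" and No: "N \<in> obj E" using hom_obj[OF m] hom_obj[OF n] by auto
  obtain \<chi> where \<chi>: "\<chi> \<in> hom E X (\<Delta> {a, b})"
    and \<chi>m: "\<chi> \<cdot> m = const M {a, b} a" and \<chi>n: "\<chi> \<cdot> n = const N {a, b} b"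
    using coproduct_map[OF N const_in[OF M S, of a] const_in[OF No S, of b]] by auto
  have "el \<chi> (el m x) = \<iota> {a, b} a" if "x \<in> fib M" for x
    using el_comp[OF m \<chi> that] \<chi>m el_const[OF M that S] by simp
  moreover have "el \<chi> (el n x) = \<iota> {a, b} b" if "x \<in> fib N" for x
    using el_comp[OF n \<chi> that] \<chi>n el_const[OF No that S] by simp
  ultimately have "el \<chi> x = \<iota> {a, b} (if x \<in> el m ` fib M then a else b)" if "x \<in> fib X" for x
    using that coproduct_fib[OF N] by auto
  then show thesis using that \<chi> by blast
qed

text \<open>By local connectedness there is a universal map from \<open>X\<close> to a constant object; its fibres
  are the atoms of \<open>X\<close>.\<close>

lemma components:
  assumes X: "X \<in> obj E"
  obtains I \<eta> where "small I" "\<eta> \<in> hom E X (\<Delta> I)"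
    "\<And>S f. small S \<Longrightarrow> f \<in> hom E X (\<Delta> S) \<Longrightarrow> \<exists>h \<in> hom Sets I S. f = \<Delta>\<^sub>m h \<cdot> \<eta>"
proof -
  obtain L where L: "is_functor E Sets L" and adj: "adjoint E Sets L (inv_im \<gamma>)"
    using atomic by (auto simp: connected_atomic_topos_def locally_connected_topos_def)
  interpret L: adjunction E Sets L "inv_im \<gamma>"
    by unfold_locales (use L adj category Sets_category \<Gamma>.L in auto)
  have s: "small (fobj L X)" using functor_obj[OF L X] by simp
  show thesis by (rule that[OF s L.unit_in[OF X]]) (rule L.unit_universal[OF X], simp)
qed

text \<open>A characteristic map takes values in a constant object, so it factors through \<eta>;
  hence no subobject can separate two elements with the same image under \<eta>.\<close>

lemma separated_by_components:
  assumes X: "X \<in> obj E" and I: "small I" and \<eta>: "\<eta> \<in> hom E X (\<Delta> I)"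
    and univ_prop: "\<And>S f. small S \<Longrightarrow> f \<in> hom E X (\<Delta> S) \<Longrightarrow> \<exists>h \<in> hom Sets I S. f = \<Delta>\<^sub>m h \<cdot> \<eta>"
    and m: "m \<in> hom E M X" and mono: "mono_arr E m"
    and x: "x \<in> fib X" and y: "y \<in> fib X" and eq: "el \<eta> x = el \<eta> y" and mx: "x \<in> el m ` fib M"
  shows "y \<in> el m ` fib M"
proof -
  obtain a b :: 'u where ab: "a \<noteq> b" and S: "small {a, b}" by (rule two_elements[OF univ])
  obtain \<chi> where \<chi>: "\<chi> \<in> hom E X (\<Delta> {a, b})"
    and \<chi>m: "\<And>x. x \<in> fib X \<Longrightarrow> el \<chi> x = \<iota> {a, b} (if x \<in> el m ` fib M then a else b)"
    using classify[OF m mono ab] by metis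
  obtain h where h: "h \<in> hom Sets I {a, b}" "\<chi> = \<Delta>\<^sub>m h \<cdot> \<eta>" using univ_prop[OF S \<chi>] by blast
  have "el \<chi> x = el \<chi> y"
    using el_comp[OF \<eta> \<Delta>_hom[OF h(1)] x] el_comp[OF \<eta> \<Delta>_hom[OF h(1)] y] h(2) eq by simp
  then have "\<iota> {a, b} a = \<iota> {a, b} (if y \<in> el m ` fib M then a else b)"
    using \<chi>m[OF x] \<chi>m[OF y] mx by simp
  then have "a = (if y \<in> el m ` fib M then a else b)" by (rule \<iota>_inj[OF S, rotated 2]) auto
  then show ?thesis using ab by (auto split: if_splits)
qed

text \<open>The atom is the part of \<open>X\<close> that \<eta> sends to the label of
  \<open>x\<close>. Its presentation as an equalizer is kept for later: a map into \<open>X\<close>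
  factors through \<open>A\<close> as soon as it equalizes \<open>f\<close> and
  \<open>g\<close>.\<close>

lemma component:
  assumes X: "X \<in> obj E" and x: "x \<in> fib X"
  obtains A a Y f g t where "atom A" "f \<in> hom E X Y" "g \<in> hom E X Y" "equalizer E X f g A a"
    "t \<in> fib A" "el a t = x"
proof -
  obtain I \<eta> where I: "small I" and \<eta>: "\<eta> \<in> hom E X (\<Delta> I)"
    and up: "\<And>S f. small S \<Longrightarrow> f \<in> hom E X (\<Delta> S) \<Longrightarrow> \<exists>h \<in> hom Sets I S. f = \<Delta>\<^sub>m h \<cdot> \<eta>"
    using components[OF X] by metis
  obtain s where s: "s \<in> I" and xs: "el \<eta> x = \<iota> I s" using \<iota>_surj[OF I el_in[OF \<eta> x]] by blast
  note c = const_in[OF X I s]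
  obtain A a where A: "equalizer E X \<eta> (const X I s) A a" using ex_equalizer[OF \<eta> c] .
  have a: "a \<in> hom E A X" using A by (simp add: equalizer_def)
  have img: "el a ` fib A = {y \<in> fib X. el \<eta> y = \<iota> I s}" and inj: "inj_on (el a) (fib A)"
    using fib_equalizer[OF A \<eta> c] el_const[OF X _ I s] by auto
  have "x \<in> el a ` fib A" unfolding img using x xs by simp
  then obtain t where t: "t \<in> fib A" "el a t = x" by blast
  have "atom A"
    unfolding atom_def
  proof (intro conjI allI ballI impI)
    show "A \<in> obj E" using hom_obj[OF a] by blast
    show "fib A \<noteq> {}" using t by blast
    fix M m assume m: "m \<in> hom E M A" and mono: "mono_arr E m"
    \<comment> \<open>A subobject of \<open>A\<close> is viewed in \<open>X\<close>, where
      \<open>separated_by_components\<close> applies: with one element it contains every element of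
      the same label, hence all of \<open>fib A\<close>.\<close>
    have am: "mono_arr E (a \<cdot> m)"
      unfolding mono_arr_def homD(2)[OF comp_in[OF m a]]
    proof (intro conjI allI ballI impI)
      show "a \<cdot> m \<in> arr E" using comp_in[OF m a] by (simp add: hom_def)
      fix W f g assume f: "f \<in> hom E W M" and g: "g \<in> hom E W M" and eq: "(a \<cdot> m) \<cdot> f = (a \<cdot> m) \<cdot> g"
      have "a \<cdot> m \<cdot> f = a \<cdot> m \<cdot> g" using assoc[OF f m a] assoc[OF g m a] eq by simp
      then have "m \<cdot> f = m \<cdot> g"
        using equalizer_mono[OF A \<eta> c] comp_in[OF f m] comp_in[OF g m] homD(2)[OF a]
        unfolding mono_arr_def by blast
      then show "f = g" using mono f g homD(2)[OF m] unfolding mono_arr_def by blast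
    qed
    show "fib M = {} \<or> el m ` fib M = fib A"
    proof (cases "fib M = {}")
      case False
      then obtain z where z: "z \<in> fib M" by blast
      have "y \<in> el m ` fib M" if y: "y \<in> fib A" for y
      proof -
        have ay: "el a y \<in> fib X" "el \<eta> (el a y) = \<iota> I s" using img y by auto
        have mz: "el m z \<in> fib A" using el_in[OF m z] .
        have az: "el a (el m z) \<in> fib X" "el \<eta> (el a (el m z)) = \<iota> I s" using img mz by auto
        have "el a (el m z) \<in> el (a \<cdot> m) ` fib M"
          using imageI[OF z, of "el (a \<cdot> m)"] el_comp[OF m a z] by simp
        then have "el a y \<in> el (a \<cdot> m) ` fib M"
          using separated_by_components[OF X I \<eta> up comp_in[OF m a] am az(1) ay(1)] az(2) ay(2) by simp
        then obtain w where w: "w \<in> fib M" "el a y = el a (el m w)" using el_comp[OF m a] by auto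
        then have "y = el m w" using inj y el_in[OF m w(1)] by (auto simp: inj_on_def)
        then show ?thesis using w by blast
      qed
      then show ?thesis using el_in[OF m] by blast
    qed simp
  qed
  then show thesis using that \<eta> c A t by blast
qed

text \<open>Each level set of \<phi> is the fibre of a subobject, so \<phi> is constant on the
  fibres of \<open>el \<eta>\<close> and factors through a map of sets \<psi>. In this way a
  function on a fibre becomes an arrow to a constant object.\<close>

lemma descend:
  assumes X: "X \<in> obj E" and S: "small S" and ne: "S \<noteq> {}"
    and \<phi>: "\<And>x. x \<in> fib X \<Longrightarrow> \<phi> x \<in> S"
    and sub: "\<And>s. s \<in> S \<Longrightarrow> \<exists>M. \<exists>m \<in> hom E M X. mono_arr E m \<and> el m ` fib M = {x \<in> fib X. \<phi> x = s}"
  obtains d where "d \<in> hom E X (\<Delta> S)" "\<And>x. x \<in> fib X \<Longrightarrow> el d x = \<iota> S (\<phi> x)"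
proof -
  obtain I \<eta> where I: "small I" and \<eta>: "\<eta> \<in> hom E X (\<Delta> I)"
    and up: "\<And>S f. small S \<Longrightarrow> f \<in> hom E X (\<Delta> S) \<Longrightarrow> \<exists>h \<in> hom Sets I S. f = \<Delta>\<^sub>m h \<cdot> \<eta>"
    using components[OF X] by metis
  have same: "\<phi> y = \<phi> x" if x: "x \<in> fib X" and y: "y \<in> fib X" and eq: "el \<eta> x = el \<eta> y" for x y
  proof -
    obtain M m where m: "m \<in> hom E M X" "mono_arr E m" and img: "el m ` fib M = {z \<in> fib X. \<phi> z = \<phi> x}"
      using sub[OF \<phi>[OF x]] by blast
    have "y \<in> el m ` fib M"
      by (rule separated_by_components[OF X I \<eta> up m x y eq]) (use img x in auto)
    then show ?thesis using img by auto
  qed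
  \<comment> \<open>A default value for labels that no element of the fibre has.\<close>
  obtain s0 where s0: "s0 \<in> S" using ne by blast
  have "\<exists>v \<in> S. \<forall>x \<in> fib X. el \<eta> x = \<iota> I l \<longrightarrow> \<phi> x = v" for l
  proof (cases "\<exists>y \<in> fib X. el \<eta> y = \<iota> I l")
    case True
    then obtain y where y: "y \<in> fib X" "el \<eta> y = \<iota> I l" by blast
    have "\<phi> x = \<phi> y" if "x \<in> fib X" "el \<eta> x = \<iota> I l" for x
      by (rule same[OF y(1) that(1)]) (simp add: y(2) that(2))
    then show ?thesis using \<phi>[OF y(1)] by blast
  next
    case False
    then show ?thesis using s0 by blast
  qed
  then obtain \<psi> where \<psi>_in: "\<And>l. \<psi> l \<in> S"
    and \<psi>_eq: "\<And>l x. x \<in> fib X \<Longrightarrow> el \<eta> x = \<iota> I l \<Longrightarrow> \<phi> x = \<psi> l"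
    by metis
  have k: "(I, restrict \<psi> I, S) \<in> hom Sets I S" using Sets_homI[OF I S] \<psi>_in by simp
  show thesis
  proof (rule that)
    show "\<Delta>\<^sub>m (I, restrict \<psi> I, S) \<cdot> \<eta> \<in> hom E X (\<Delta> S)" using comp_in[OF \<eta> \<Delta>_hom[OF k]] .
    fix x assume x: "x \<in> fib X"
    obtain l where l: "l \<in> I" "el \<eta> x = \<iota> I l" using \<iota>_surj[OF I el_in[OF \<eta> x]] by blast
    show "el (\<Delta>\<^sub>m (I, restrict \<psi> I, S) \<cdot> \<eta>) x = \<iota> S (\<phi> x)"
      using el_comp[OF \<eta> \<Delta>_hom[OF k] x] l \<iota>_map[OF k l(1)] \<psi>_eq[OF x l(2)] by simp
  qed
qed

section \<open>Galois objects\<close>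

lemma galois_atom:
  assumes "galois_object E \<gamma> A"
  shows "atom A"
  using assms connected_atom by (simp add: galois_object_def)

lemma Aut_hom: "g \<in> Aut E A \<Longrightarrow> g \<in> hom E A A"
  by (simp add: Aut_def)

text \<open>The canonical isomorphism carries some element of the fibre of
  \<open>A \<times> \<Delta> S\<close> to the pair \<open>(b, b')\<close>. Its second coordinate
  names an \<open>s\<close>, and \<open>e s\<close> is the automorphism sought.\<close>

lemma galois_transitive:
  assumes "galois_object E \<gamma> A" and b: "b \<in> fib A" and b': "b' \<in> fib A"
  shows "\<exists>g \<in> Aut E A. el g b = b'"
proof -
  obtain S e P u1 u2 Q v1 v2 c where S: "small S" and e: "bij_betw e S (Aut E A)"
    and P: "binary_product E A (\<Delta> S) P u1 u2" and Q: "binary_product E A A Q v1 v2"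
    and can: "canonical_morphism E \<gamma> A S e P u1 u2 Q v1 v2 c" and iso: "iso E c"
    using assms(1) unfolding galois_object_def by blast
  have c: "c \<in> hom E P Q" and qc: "v1 \<cdot> c = u1" using can by (simp_all add: canonical_morphism_def)
  have p1: "u1 \<in> hom E P A" and p2: "u2 \<in> hom E P (\<Delta> S)" using P by (simp_all add: binary_product_def)
  have q1: "v1 \<in> hom E Q A" and q2: "v2 \<in> hom E Q A" using Q by (simp_all add: binary_product_def)
  have A: "A \<in> obj E" and Po: "P \<in> obj E" and Qo: "Q \<in> obj E" using hom_obj[OF q1] hom_obj[OF p1] by auto
  obtain d where d: "d \<in> hom E Q P" and cd: "c \<cdot> d = idt E Q" using isoE[OF iso c] .
  obtain z where z: "z \<in> fib Q" "el v1 z = b" "el v2 z = b'" using fib_product_ex[OF Q b b'] by blast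
  define w where "w = el d z"
  have w: "w \<in> fib P" unfolding w_def using el_in[OF d z(1)] .
  have cw: "el c w = z" using el_comp[OF d c z(1)] cd el_id[OF Qo z(1)] by (simp add: w_def)
  obtain s where s: "s \<in> S" "el u2 w = \<iota> S s" using \<iota>_surj[OF S el_in[OF p2 w]] by blast
  note cst = const_in[OF A S s(1)]
  \<comment> \<open>The embedding of the component with label \<open>s\<close>, on which the
    canonical morphism is known to act by \<open>e s\<close>.\<close>
  obtain h where h: "h \<in> hom E A P" "u1 \<cdot> h = idt E A" "u2 \<cdot> h = const A S s"
    using P id_in[OF A] cst unfolding binary_product_def by blast
  have "el h b = w"
  proof (rule fib_product_eq[OF P el_in[OF h(1) b] w])
    show "el u1 (el h b) = el u1 w"
      using el_comp[OF h(1) p1 b] h(2) el_id[OF A b] el_comp[OF c q1 w] qc cw z(2) by simp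
    show "el u2 (el h b) = el u2 w"
      using el_comp[OF h(1) p2 b] h(3) el_const[OF A b S s(1)] s(2) by simp
  qed
  moreover have "v2 \<cdot> c \<cdot> h = e s" using can s(1) h by (simp add: canonical_morphism_def)
  ultimately have "el (e s) b = b'"
    using el_comp[OF comp_in[OF h(1) c] q2 b] el_comp[OF h(1) c b] cw z(3) by simp
  moreover have "e s \<in> Aut E A" using e s(1) by (auto simp: bij_betw_def)
  ultimately show ?thesis by blast
qed

text \<open>An automorphism of an atom is determined by the image of \<open>t\<close>, so
  \<open>fib A\<close> itself can serve as the small set carrying \<open>Aut E A\<close>. The
  inverse \<open>k\<close> of the canonical morphism is built first, because a map into
  \<open>A \<times> \<Delta> S\<close> needs only its two components; on fibres it sends
  \<open>(b, b')\<close> to \<open>b\<close> together with the label of the automorphism moving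
  \<open>b\<close> to \<open>b'\<close>.\<close>

lemma transitive_galois:
  assumes A: "atom A" and transitive: "\<And>b b'. b \<in> fib A \<Longrightarrow> b' \<in> fib A \<Longrightarrow> \<exists>g \<in> Aut E A. el g b = b'"
  shows "galois_object E \<gamma> A"
proof -
  have Ao: "A \<in> obj E" using A by (simp add: atom_def)
  define S where "S = fib A"
  have S: "small S" unfolding S_def using fib_small[OF Ao] .
  obtain t where t: "t \<in> fib A" using A by (auto simp: atom_def)
  obtain e where e_Aut: "\<And>y. y \<in> S \<Longrightarrow> e y \<in> Aut E A" and e_t: "\<And>y. y \<in> S \<Longrightarrow> el (e y) t = y"
    using transitive[OF t] unfolding S_def by metis
  note e_hom = Aut_hom[OF e_Aut]
  have e_inj: "y = y'" if "y \<in> S" "y' \<in> S" "e y = e y'" for y y'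
    using e_t[OF that(1)] e_t[OF that(2)] unfolding that(3) by (rule trans[OF sym])
  have e_surj: "\<exists>y \<in> S. g = e y" if g: "g \<in> Aut E A" for g
  proof -
    have y: "el g t \<in> S" unfolding S_def using el_in[OF Aut_hom[OF g] t] .
    have "g = e (el g t)" using atom_eq[OF A Aut_hom[OF g] e_hom[OF y] t] e_t[OF y] by simp
    then show ?thesis using y by blast
  qed
  have e_bij: "bij_betw e S (Aut E A)"
    unfolding bij_betw_def inj_on_def using e_inj e_surj e_Aut by blast
  have e_unique: "y = y'" if "y \<in> S" "y' \<in> S" "b \<in> fib A" "el (e y) b = el (e y') b" for y y' b
    using e_inj[OF that(1,2)] atom_eq[OF A e_hom[OF that(1)] e_hom[OF that(2)] that(3,4)] by blast
  have epi: "epi_arr E u" if T: "terminal E T" and u: "u \<in> hom E A T" for T u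
    unfolding epi_arr_def homD(3)[OF u]
  proof (intro conjI allI ballI impI)
    show "u \<in> arr E" using u by (simp add: hom_def)
    fix Z f g assume f: "f \<in> hom E T Z" and g: "g \<in> hom E T Z" and eq: "f \<cdot> u = g \<cdot> u"
    obtain z where z: "fib T = {z}" using fib_terminal[OF T] by blast
    then have "el u t = z" using el_in[OF u t] by simp
    then have "el f z = el g z" using el_comp[OF u f t] el_comp[OF u g t] eq by simp
    then show "f = g" using el_faithful[OF f g] z by simp
  qed
  obtain P u1 u2 where P: "binary_product E A (\<Delta> S) P u1 u2" using ex_binary_product[OF Ao \<Delta>_obj[OF S]] .
  obtain Q v1 v2 where Q: "binary_product E A A Q v1 v2" using ex_binary_product[OF Ao Ao] .
  have p1: "u1 \<in> hom E P A" and p2: "u2 \<in> hom E P (\<Delta> S)" using P by (simp_all add: binary_product_def)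
  have q1: "v1 \<in> hom E Q A" and q2: "v2 \<in> hom E Q A" using Q by (simp_all add: binary_product_def)
  have Qo: "Q \<in> obj E" using hom_obj[OF q1] by blast
  have "\<exists>y \<in> S. el (e y) (el v1 z) = el v2 z" if z: "z \<in> fib Q" for z
    using transitive[OF el_in[OF q1 z] el_in[OF q2 z]] e_surj by metis
  then obtain \<phi> where \<phi>_in: "\<And>z. z \<in> fib Q \<Longrightarrow> \<phi> z \<in> S"
    and \<phi>_eq: "\<And>z. z \<in> fib Q \<Longrightarrow> el (e (\<phi> z)) (el v1 z) = el v2 z"
    by metis
  \<comment> \<open>The pairs with label \<open>s\<close> form the graph of \<open>e s\<close>,
    which is an equalizer; this lets \<open>descend\<close> turn \<phi> into an arrow.\<close>
  have fibres: "\<exists>M. \<exists>m \<in> hom E M Q. mono_arr E m \<and> el m ` fib M = {z \<in> fib Q. \<phi> z = s}" if s: "s \<in> S" for s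
  proof -
    note es = comp_in[OF q1 e_hom[OF s]]
    obtain M m where M: "equalizer E Q (e s \<cdot> v1) v2 M m" using ex_equalizer[OF es q2] .
    have m: "m \<in> hom E M Q" using M by (simp add: equalizer_def)
    have "(el (e s \<cdot> v1) z = el v2 z) \<longleftrightarrow> \<phi> z = s" if z: "z \<in> fib Q" for z
      using el_comp[OF q1 e_hom[OF s] z] \<phi>_eq[OF z] e_unique[OF \<phi>_in[OF z] s el_in[OF q1 z]] by auto
    then have "el m ` fib M = {z \<in> fib Q. \<phi> z = s}" using fib_equalizer(2)[OF M es q2] by auto
    then show ?thesis using m equalizer_mono[OF M es q2] by blast
  qed
  have "S \<noteq> {}" using t by (auto simp: S_def)
  from descend[OF Qo S this \<phi>_in fibres]
  obtain d where d: "d \<in> hom E Q (\<Delta> S)" and el_d: "\<And>z. z \<in> fib Q \<Longrightarrow> el d z = \<iota> S (\<phi> z)"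
    by blast
  obtain k where k: "k \<in> hom E Q P" "u1 \<cdot> k = v1" "u2 \<cdot> k = d"
    using P q1 d unfolding binary_product_def by blast
  have el_k: "el u1 (el k z) = el v1 z" "el u2 (el k z) = \<iota> S (\<phi> z)" if z: "z \<in> fib Q" for z
    using el_comp[OF k(1) p1 z] el_comp[OF k(1) p2 z] k(2,3) el_d[OF z] by simp_all
  have "iso E k"
  proof (rule el_bij_iso[OF k(1)])
    show "inj_on (el k) (fib Q)"
    proof (rule inj_onI)
      fix z w assume z: "z \<in> fib Q" and w: "w \<in> fib Q" and eq: "el k z = el k w"
      have 1: "el v1 z = el v1 w" using el_k(1)[OF z] el_k(1)[OF w] eq by simp
      have "\<phi> z = \<phi> w"
        by (rule \<iota>_inj[OF S \<phi>_in[OF z] \<phi>_in[OF w]]) (use el_k(2)[OF z] el_k(2)[OF w] eq in simp)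
      then have "el v2 z = el v2 w" using \<phi>_eq[OF z] \<phi>_eq[OF w] 1 by simp
      then show "z = w" using fib_product_eq[OF Q z w 1] by blast
    qed
    show "el k ` fib Q = fib P"
    proof (intro equalityI subsetI)
      show "w \<in> fib P" if "w \<in> el k ` fib Q" for w using that el_in[OF k(1)] by blast
      fix w assume w: "w \<in> fib P"
      obtain s where s: "s \<in> S" "el u2 w = \<iota> S s" using \<iota>_surj[OF S el_in[OF p2 w]] by blast
      note b = el_in[OF p1 w]
      obtain z where z: "z \<in> fib Q" "el v1 z = el u1 w" "el v2 z = el (e s) (el u1 w)"
        using fib_product_ex[OF Q b el_in[OF e_hom[OF s(1)] b]] by blast
      have "\<phi> z = s"
        by (rule e_unique[OF \<phi>_in[OF z(1)] s(1) b]) (use \<phi>_eq[OF z(1)] z in simp)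
      then have "el k z = w"
        using fib_product_eq[OF P el_in[OF k(1) z(1)] w] el_k[OF z(1)] z(2) s(2) by simp
      then show "w \<in> el k ` fib Q" using z(1) by blast
    qed
  qed
  then obtain c where c: "c \<in> hom E P Q" "c \<cdot> k = idt E Q" "k \<cdot> c = idt E P" using isoE[OF _ k(1)] by blast
  have "canonical_morphism E \<gamma> A S e P u1 u2 Q v1 v2 c"
    unfolding canonical_morphism_def
  proof (intro conjI ballI impI)
    show "c \<in> hom E P Q" by fact
    show "v1 \<cdot> c = u1" using assoc[OF c(1) k(1) p1] k(2) c(3) id_right[OF p1] by simp
    fix s h assume s: "s \<in> S" and h: "h \<in> hom E A P" and ph: "u1 \<cdot> h = idt E A \<and> u2 \<cdot> h = const A S s"
    note ch = comp_in[OF h c(1)]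
    show "v2 \<cdot> c \<cdot> h = e s"
    proof (rule el_faithful[OF comp_in[OF ch q2] e_hom[OF s]])
      fix b assume b: "b \<in> fib A"
      define z where "z = el (c \<cdot> h) b"
      have z: "z \<in> fib Q" unfolding z_def using el_in[OF ch b] .
      have "k \<cdot> c \<cdot> h = h" using assoc[OF h c(1) k(1)] c(3) id_left[OF h] by simp
      then have kz: "el k z = el h b" using el_comp[OF ch k(1) b] by (simp add: z_def)
      have q1z: "el v1 z = b" using el_k(1)[OF z] kz el_comp[OF h p1 b] ph el_id[OF Ao b] by simp
      have "\<iota> S (\<phi> z) = \<iota> S s" using el_k(2)[OF z] kz el_comp[OF h p2 b] ph el_const[OF Ao b S s] by simp
      then have "\<phi> z = s" using \<iota>_inj[OF S \<phi>_in[OF z] s] by blast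
      then have "el v2 z = el (e s) b" using \<phi>_eq[OF z] q1z by simp
      then show "el (v2 \<cdot> c \<cdot> h) b = el (e s) b" using el_comp[OF ch q2 b] by (simp add: z_def)
    qed
  qed
  moreover have "iso E c" using isoI[OF c(1) k(1) c(3,2)] .
  ultimately show ?thesis
    unfolding galois_object_def using atom_connected[OF A] epi S e_bij P Q by blast
qed

section \<open>The two implications\<close>

lemma galois_cover:
  assumes gal: "galois_topos E \<gamma>" and Y: "Y \<in> obj E" and y: "y \<in> fib Y"
  obtains A t f where "galois_object E \<gamma> A" "t \<in> fib A" "f \<in> hom E A Y" "el f t = y"
proof -
  obtain B b u where B: "atom B" and b: "b \<in> hom E B Y" and u: "u \<in> fib B" "el b u = y"
    using component[OF Y y] unfolding equalizer_def by metis
  have Bo: "B \<in> obj E" using hom_obj[OF b] by blast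
  obtain x x' :: 'u where ne: "x \<noteq> x'" and S: "small {x, x'}" by (rule two_elements[OF univ])
  \<comment> \<open>Generation by Galois objects speaks only of distinct parallel maps. Two distinct
    constants on the noninitial \<open>B\<close> are such a pair, and separating them requires a map
    from a Galois object to \<open>B\<close>.\<close>
  have "const B {x, x'} x \<noteq> const B {x, x'} x'"
    using const_distinct[OF Bo S _ _ ne] atom_connected[OF B] by blast
  then obtain A a where A: "galois_object E \<gamma> A" and a: "a \<in> hom E A B"
    using gal const_in[OF Bo S, of x] const_in[OF Bo S, of x']
    unfolding galois_topos_def generated_by_def by blast
  have "fib A \<noteq> {}" using galois_atom[OF A] by (simp add: atom_def)
  then obtain t where t: "t \<in> fib A" "u = el a t" using atom_surj[OF B a _ u(1)] by blast
  show thesis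
    by (rule that[OF A t(1) comp_in[OF a b]]) (use el_comp[OF a b t(1)] t(2) u(2) in simp)
qed

lemma galois_imp_proessential:
  assumes gal: "galois_topos E \<gamma>"
  shows "proessential E p"
  unfolding proessential_def el_def[symmetric]
proof (intro allI impI, elim conjE)
  fix X S P \<pi> assume X: "connected_object E X" and S: "small (S :: 'u set)"
    and P: "product_cone E S (\<lambda>_. X) P \<pi>"
  have Xo: "X \<in> obj E" using X by (simp add: connected_object_def)
  have Po: "P \<in> obj E" and \<pi>: "\<And>s. s \<in> S \<Longrightarrow> \<pi> s \<in> hom E P X"
    using P by (simp_all add: product_cone_def)
  have lift: "\<exists>!h. h \<in> hom E M P \<and> (\<forall>s \<in> S. \<pi> s \<cdot> h = \<rho> s)"
    if "M \<in> obj E" "\<And>s. s \<in> S \<Longrightarrow> \<rho> s \<in> hom E M X" for M \<rho>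
    using P that by (simp add: product_cone_def)
  show "bij_betw (\<lambda>t. \<lambda>s\<in>S. el (\<pi> s) t) (fib P) (S \<rightarrow>\<^sub>E fib X)"
    unfolding bij_betw_def
  proof (intro conjI inj_onI equalityI subsetI)
    fix u v assume u: "u \<in> fib P" and v: "v \<in> fib P"
      and "(\<lambda>s\<in>S. el (\<pi> s) u) = (\<lambda>s\<in>S. el (\<pi> s) v)"
    then have eq: "el (\<pi> s) u = el (\<pi> s) v" if "s \<in> S" for s using that by (metis restrict_apply')
    \<comment> \<open>A Galois object over \<open>P \<times> P\<close> through \<open>(u, v)\<close>
      gives two maps to \<open>P\<close> with values \<open>u\<close> and \<open>v\<close> at one
      and the same \<open>t\<close>, so \<open>atom_eq\<close> can compare their
      projections.\<close>
    obtain Q v1 v2 where Q: "binary_product E P P Q v1 v2" using ex_binary_product[OF Po Po] .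
    have q1: "v1 \<in> hom E Q P" and q2: "v2 \<in> hom E Q P" using Q by (simp_all add: binary_product_def)
    obtain w where w: "w \<in> fib Q" "el v1 w = u" "el v2 w = v" using fib_product_ex[OF Q u v] by blast
    obtain A t f where A: "galois_object E \<gamma> A" and t: "t \<in> fib A" and f: "f \<in> hom E A Q" and ft: "el f t = w"
      using galois_cover[OF gal _ w(1)] hom_obj[OF q1] by metis
    note f1 = comp_in[OF f q1] and f2 = comp_in[OF f q2]
    have t1: "el (v1 \<cdot> f) t = u" and t2: "el (v2 \<cdot> f) t = v"
      using el_comp[OF f q1 t] el_comp[OF f q2 t] ft w by simp_all
    have "\<pi> s \<cdot> v1 \<cdot> f = \<pi> s \<cdot> v2 \<cdot> f" if s: "s \<in> S" for s
      by (rule atom_eq[OF galois_atom[OF A] comp_in[OF f1 \<pi>[OF s]] comp_in[OF f2 \<pi>[OF s]] t])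
        (simp add: el_comp[OF f1 \<pi>[OF s] t] el_comp[OF f2 \<pi>[OF s] t] t1 t2 eq[OF s])
    moreover have "\<exists>!h. h \<in> hom E A P \<and> (\<forall>s \<in> S. \<pi> s \<cdot> h = \<pi> s \<cdot> v2 \<cdot> f)"
      by (rule lift) (use hom_obj[OF f] comp_in[OF f2 \<pi>] in auto)
    ultimately have "v1 \<cdot> f = v2 \<cdot> f" using f1 f2 by (elim ex1_unique) auto
    then show "u = v" using t1 t2 by simp
  next
    fix x assume "x \<in> (\<lambda>t. \<lambda>s\<in>S. el (\<pi> s) t) ` fib P"
    then show "x \<in> S \<rightarrow>\<^sub>E fib X" using el_in[OF \<pi>] by auto
  next
    fix x assume x: "x \<in> S \<rightarrow>\<^sub>E fib X"
    have "\<exists>A. \<exists>t \<in> fib A. A \<in> obj E \<and> (\<forall>s \<in> S. \<exists>f \<in> hom E A X. el f t = x s)"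
    \<comment> \<open>A connected object may be initial, so \<open>X\<close> is known to be an atom
      only once \<open>S\<close> has an element; for empty \<open>S\<close> a terminal object serves
      as \<open>A\<close>.\<close>
    proof (cases "S = {}")
      case True
      obtain z where "fib (\<Delta> {undefined}) = {z}" using fib_terminal[OF \<Delta>_singleton] by blast
      then show ?thesis using True \<Delta>_obj[OF small_singleton[OF univ]] by auto
    next
      case False
      then obtain r where r: "r \<in> S" by blast
      then have xr: "x r \<in> fib X" using x by auto
      then have Xa: "atom X" using connected_atom[OF X] fib_initial[of X] by auto
      obtain A t f where A: "galois_object E \<gamma> A" and t: "t \<in> fib A" and f: "f \<in> hom E A X"
        using galois_cover[OF gal Xo xr] by metis
      have "\<exists>g \<in> hom E A X. el g t = x s" if s: "s \<in> S" for s
      proof -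
        have xs: "x s \<in> fib X" using x s by auto
        \<comment> \<open>An element \<open>b\<close> over \<open>x s\<close> exists because
          \<open>f\<close> is surjective on fibres, and an automorphism moves \<open>t\<close> to
          \<open>b\<close>; so the same \<open>A\<close> and \<open>t\<close> serve all
          coordinates.\<close>
        obtain b where b: "b \<in> fib A" "x s = el f b" using atom_surj[OF Xa f _ xs] t by blast
        obtain g where g: "g \<in> hom E A A" "el g t = b" using galois_transitive[OF A t b(1)] Aut_hom by blast
        then have "el (f \<cdot> g) t = x s" using el_comp[OF g(1) f t] b(2) by simp
        then show ?thesis using comp_in[OF g(1) f] by blast
      qed
      then show ?thesis using t hom_obj(1)[OF f] by blast
    qed
    then obtain A t where t: "t \<in> fib A" and A: "A \<in> obj E" and ex: "\<forall>s \<in> S. \<exists>f \<in> hom E A X. el f t = x s"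
      by blast
    obtain \<rho> where \<rho>: "\<And>s. s \<in> S \<Longrightarrow> \<rho> s \<in> hom E A X" "\<And>s. s \<in> S \<Longrightarrow> el (\<rho> s) t = x s" using ex by metis
    obtain h where h: "h \<in> hom E A P" "\<And>s. s \<in> S \<Longrightarrow> \<pi> s \<cdot> h = \<rho> s" using lift[OF A, of \<rho>] \<rho>(1) by blast
    have "el (\<pi> s) (el h t) = x s" if s: "s \<in> S" for s
      using el_comp[OF h(1) \<pi>[OF s] t] h(2)[OF s] \<rho>(2)[OF s] by simp
    then have "x = (\<lambda>s\<in>S. el (\<pi> s) (el h t))" using x by (intro ext) (auto simp: PiE_def extensional_def)
    then show "x \<in> (\<lambda>t. \<lambda>s\<in>S. el (\<pi> s) t) ` fib P" using el_in[OF h(1) t] by blast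
  qed
qed

text \<open>The Galois closure of an atom \<open>X\<close>: the component \<open>A\<close> of the power of \<open>X\<close> indexed by its own
  fibre that contains the tautological point. Its projections exhaust the fibre of \<open>X\<close>, and
  permuting coordinates shows that \<open>Aut A\<close> acts transitively.\<close>

lemma galois_closure:
  assumes pro: "proessential E p" and X: "atom X"
  obtains A t where "galois_object E \<gamma> A" "t \<in> fib A" "\<And>x. x \<in> fib X \<Longrightarrow> \<exists>f \<in> hom E A X. el f t = x"
proof -
  have Xo: "X \<in> obj E" using X by (simp add: atom_def)
  define S where "S = fib X"
  have S: "small S" unfolding S_def using fib_small[OF Xo] .
  obtain P \<pi> where P: "product_cone E S (\<lambda>_. X) P \<pi>" using ex_product[OF S, of "\<lambda>_. X"] Xo by blast
  have Po: "P \<in> obj E" and \<pi>: "\<And>s. s \<in> S \<Longrightarrow> \<pi> s \<in> hom E P X"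
    using P by (simp_all add: product_cone_def)
  have bij: "bij_betw (\<lambda>t. \<lambda>s\<in>S. el (\<pi> s) t) (fib P) (S \<rightarrow>\<^sub>E S)"
    using pro atom_connected(1)[OF X] S P unfolding proessential_def el_def S_def by blast
  have P_eq: "u = v" if "u \<in> fib P" "v \<in> fib P" "\<And>s. s \<in> S \<Longrightarrow> el (\<pi> s) u = el (\<pi> s) v" for u v
  proof -
    have "(\<lambda>s\<in>S. el (\<pi> s) u) = (\<lambda>s\<in>S. el (\<pi> s) v)" using that(3) by (auto intro: restrict_ext)
    then show ?thesis using bij that(1,2) by (simp add: bij_betw_def inj_on_def)
  qed
  have "(\<lambda>s\<in>S. s) \<in> (\<lambda>t. \<lambda>s\<in>S. el (\<pi> s) t) ` fib P" using bij by (auto simp: bij_betw_def)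
  then obtain t0 where t0: "t0 \<in> fib P" and "(\<lambda>s\<in>S. s) = (\<lambda>s\<in>S. el (\<pi> s) t0)" by blast
  then have t0_eq: "el (\<pi> s) t0 = s" if "s \<in> S" for s using that by (metis restrict_apply')
  obtain A a Y f g t where A: "atom A" and f: "f \<in> hom E P Y" and g: "g \<in> hom E P Y"
    and eqz: "equalizer E P f g A a" and t: "t \<in> fib A" and at: "el a t = t0"
    using component[OF Po t0] by metis
  have a: "a \<in> hom E A P" and fa: "f \<cdot> a = g \<cdot> a" using eqz by (simp_all add: equalizer_def)
  have Ao: "A \<in> obj E" using hom_obj[OF a] by blast
  have End: "\<exists>h \<in> hom E A A. el h t = y" if y: "y \<in> fib A" for y
  proof -
    have ay: "el a y \<in> fib P" using el_in[OF a y] .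
    \<comment> \<open>The coordinates of \<open>y\<close>. Reindexing the projections along \<sigma>
      gives a map \<open>h\<close> from \<open>A\<close> to \<open>P\<close>; as the coordinates of
      \<open>t0\<close> are the indices themselves, \<open>h\<close> sends \<open>t\<close> to
      \<open>el a y\<close>.\<close>
    define \<sigma> where "\<sigma> s = el (\<pi> s) (el a y)" for s
    have \<sigma>: "\<sigma> s \<in> S" if "s \<in> S" for s unfolding \<sigma>_def using el_in[OF \<pi>[OF that] ay] by (simp add: S_def)
    have "A \<in> obj E \<and> (\<forall>s \<in> S. \<pi> (\<sigma> s) \<cdot> a \<in> hom E A X)" using Ao comp_in[OF a \<pi>[OF \<sigma>]] by blast
    then have "\<exists>!h. h \<in> hom E A P \<and> (\<forall>s \<in> S. \<pi> s \<cdot> h = \<pi> (\<sigma> s) \<cdot> a)"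
      by (rule P[unfolded product_cone_def, THEN conjunct2, THEN conjunct2, rule_format])
    then obtain h where h: "h \<in> hom E A P" "\<And>s. s \<in> S \<Longrightarrow> \<pi> s \<cdot> h = \<pi> (\<sigma> s) \<cdot> a" by blast
    have ht: "el h t = el a y"
    proof (rule P_eq[OF el_in[OF h(1) t] ay])
      fix s assume s: "s \<in> S"
      show "el (\<pi> s) (el h t) = el (\<pi> s) (el a y)"
        using el_comp[OF h(1) \<pi>[OF s] t] h(2)[OF s] el_comp[OF a \<pi>[OF \<sigma>[OF s]] t] at t0_eq[OF \<sigma>[OF s]]
        by (simp add: \<sigma>_def)
    qed
    \<comment> \<open>For \<open>h\<close> to factor through \<open>A\<close>, two maps out of an
      atom have to agree, which is checked at \<open>t\<close> alone; there the value of
      \<open>h\<close> comes from \<open>A\<close>.\<close>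
    have "f \<cdot> h = g \<cdot> h"
    proof (rule atom_eq[OF A comp_in[OF h(1) f] comp_in[OF h(1) g] t])
      show "el (f \<cdot> h) t = el (g \<cdot> h) t"
        using el_comp[OF h(1) f t] el_comp[OF h(1) g t] ht el_comp[OF a f y] el_comp[OF a g y] fa by simp
    qed
    then obtain k where k: "k \<in> hom E A A" "a \<cdot> k = h" using equalizer_factor[OF eqz h(1)] by blast
    have "el a (el k t) = el a y" using el_comp[OF k(1) a t] k(2) ht by simp
    then have "el k t = y"
      using fib_equalizer(1)[OF eqz f g] el_in[OF k(1) t] y by (auto simp: inj_on_def)
    then show ?thesis using k(1) by blast
  qed
  \<comment> \<open>An endomorphism of the atom is surjective on the fibre, so it takes some
    \<open>y\<close> to \<open>t\<close>, and an endomorphism taking \<open>t\<close> to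
    \<open>y\<close> is a right inverse. A monoid in which every element has a right inverse is a
    group.\<close>
  have right_inverse: "\<exists>k \<in> hom E A A. h \<cdot> k = idt E A" if h: "h \<in> hom E A A" for h
  proof -
    obtain y where y: "y \<in> fib A" "t = el h y" using atom_surj[OF A h _ t] t by blast
    obtain k where k: "k \<in> hom E A A" "el k t = y" using End[OF y(1)] by blast
    have "h \<cdot> k = idt E A"
      by (rule atom_eq[OF A comp_in[OF k(1) h] id_in[OF Ao] t])
        (use el_comp[OF k(1) h t] k(2) y(2) el_id[OF Ao t] in simp)
    then show ?thesis using k(1) by blast
  qed
  have inverse: "\<exists>k \<in> hom E A A. h \<cdot> k = idt E A \<and> k \<cdot> h = idt E A" if h: "h \<in> hom E A A" for h
  proof -
    obtain k where k: "k \<in> hom E A A" "h \<cdot> k = idt E A" using right_inverse[OF h] by blast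
    obtain l where l: "l \<in> hom E A A" "k \<cdot> l = idt E A" using right_inverse[OF k(1)] by blast
    have "h = l" using assoc[OF l(1) k(1) h] k(2) l(2) id_right[OF h] id_left[OF l(1)] by simp
    then show ?thesis using k l by blast
  qed
  have "galois_object E \<gamma> A"
  proof (rule transitive_galois[OF A])
    fix b b' assume b: "b \<in> fib A" and b': "b' \<in> fib A"
    obtain h where h: "h \<in> hom E A A" "el h t = b" using End[OF b] by blast
    obtain h' where h': "h' \<in> hom E A A" "el h' t = b'" using End[OF b'] by blast
    obtain k where k: "k \<in> hom E A A" "k \<cdot> h = idt E A" using inverse[OF h(1)] by blast
    have kb: "el k b = t" using el_comp[OF h(1) k(1) t] h(2) k(2) el_id[OF Ao t] by simp
    note hk = comp_in[OF k(1) h'(1)]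
    have "iso E (h' \<cdot> k)" using inverse[OF hk] isoI[OF hk] by blast
    moreover have "el (h' \<cdot> k) b = b'" using el_comp[OF k(1) h'(1) b] kb h'(2) by simp
    ultimately show "\<exists>g \<in> Aut E A. el g b = b'" using hk by (auto simp: Aut_def)
  qed
  moreover have "\<exists>f \<in> hom E A X. el f t = x" if x: "x \<in> fib X" for x
  proof -
    have s: "x \<in> S" using x by (simp add: S_def)
    have "el (\<pi> x \<cdot> a) t = x" using el_comp[OF a \<pi>[OF s] t] at t0_eq[OF s] by simp
    then show ?thesis using comp_in[OF a \<pi>[OF s]] by blast
  qed
  ultimately show thesis using that t by blast
qed

text \<open>Two distinct maps differ at an element of the fibre. This element comes from an atom,
  hence from the Galois closure of that atom, and the map through which it comes separates the
  two.\<close>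

lemma proessential_imp_galois:
  assumes pro: "proessential E p"
  shows "galois_topos E \<gamma>"
proof -
  have "\<exists>A \<in> {A. galois_object E \<gamma> A}. \<exists>a \<in> hom E A X. f \<cdot> a \<noteq> g \<cdot> a"
    if f: "f \<in> hom E X Y" and g: "g \<in> hom E X Y" and ne: "f \<noteq> g" for X Y f g
  proof -
    have X: "X \<in> obj E" using hom_obj[OF f] by blast
    obtain x where x: "x \<in> fib X" "el f x \<noteq> el g x" using el_faithful[OF f g] ne by blast
    obtain B b u where B: "atom B" and b: "b \<in> hom E B X" and u: "u \<in> fib B" "el b u = x"
      using component[OF X x(1)] unfolding equalizer_def by metis
    obtain A t where A: "galois_object E \<gamma> A" and t: "t \<in> fib A"
      and ex: "\<And>x. x \<in> fib B \<Longrightarrow> \<exists>f \<in> hom E A B. el f t = x"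
      using galois_closure[OF pro B] by metis
    obtain k where k: "k \<in> hom E A B" "el k t = u" using ex[OF u(1)] by blast
    note bk = comp_in[OF k(1) b]
    have "el (b \<cdot> k) t = x" using el_comp[OF k(1) b t] k(2) u(2) by simp
    then have "el (f \<cdot> b \<cdot> k) t \<noteq> el (g \<cdot> b \<cdot> k) t" using el_comp[OF bk f t] el_comp[OF bk g t] x(2) by simp
    then have "f \<cdot> b \<cdot> k \<noteq> g \<cdot> b \<cdot> k" by auto
    then show ?thesis using A bk by blast
  qed
  then have "generated_by E {A. galois_object E \<gamma> A}" unfolding generated_by_def by blast
  then show ?thesis using atomic by (simp add: galois_topos_def connected_atomic_topos_def)
qed

end

theorem corollary3p3p9:
  fixes E :: "('o, 'a) cat"
    and \<gamma> :: "('o, 'a, 'u) structure_morphism"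
    and p :: "('u set, 'u setmap, 'o, 'a) geom"
  assumes "universe TYPE('u)"
    and "connected_atomic_topos E \<gamma>"
    and "point E p"
  shows "galois_topos E \<gamma> \<longleftrightarrow> proessential E p"
proof -
  interpret pointed_topos E \<gamma> p by (rule pointed_topos.intro[OF assms])
  show ?thesis using galois_imp_proessential proessential_imp_galois by blast
qed

end
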